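(* For each $n$, let $C_n$ be uniformly distributed on $\mathcal{E}_n$, with eigenvalues $\lambda_1,\ldots,\lambda_n$, and let $F_n(x)=\frac{1}{n}\#\{i:\lambda_i\leq x\}$ denote its empirical spectral distribution. Then, as $n\rightarrow\infty$, $F_n$ converges weakly, in probability, to the Marchenko--Pastur law with ratio one, whose density is $$ f_{\mathrm{MP}}(x)=\frac{1}{2\pi x}\sqrt{x(4-x)},\qquad x\in(0,4]. $$
   Context: $\mathcal{E}_n=\{C\in\mathbb{R}^{n\times n}: C=C',\ C\succeq 0,\ C_{ii}=1 \text{ for all } i\}$ is the set of $n\times n$ correlation matrices; the uniform distribution on it is normalized $d$-dimensional Lebesgue measure, $d=n(n-1)/2$, in the off-diagonal coordinates $(C_{ij})_{i<j}$. *)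

theory Defs
  imports "HOL-Probability.Probability" "Jordan_Normal_Form.Char_Poly"
begin

definition pos_semidef :: "nat \<Rightarrow> real mat \<Rightarrow> bool" where
  "pos_semidef n C \<longleftrightarrow> (\<forall>v \<in> carrier_vec n. 0 \<le> scalar_prod v (C *\<^sub>v v))"

definition corr_matrices :: "nat \<Rightarrow> real mat set" where
  "corr_matrices n =
     {C \<in> carrier_mat n n. transpose_mat C = C \<and> pos_semidef n C \<and> (\<forall>i<n. C $$ (i, i) = 1)}"

definition upper_indices :: "nat \<Rightarrow> (nat \<times> nat) set" where
  "upper_indices n = {(i, j). i < j \<and> j < n}"

definition offdiag :: "nat \<Rightarrow> real mat \<Rightarrow> (nat \<times> nat \<Rightarrow> real)" where
  "offdiag n C = restrict (\<lambda>ij. C $$ ij) (upper_indices n)"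

text \<open>Lebesgue measure in the \<open>n (n - 1) / 2\<close> coordinates \<open>C\<^sub>i\<^sub>j\<close>, \<open>i < j\<close>.\<close>

definition offdiag_lebesgue :: "nat \<Rightarrow> (nat \<times> nat \<Rightarrow> real) measure" where
  "offdiag_lebesgue n = PiM (upper_indices n) (\<lambda>_. lborel)"

text \<open>A correlation matrix is determined by its entries above the diagonal, so the law of
  a random element \<open>C\<close> of \<^term>\<open>corr_matrices n\<close> is specified by the law of
  \<^term>\<open>\<lambda>w. offdiag n (C w)\<close>.\<close>

definition uniform_corr :: "'a measure \<Rightarrow> nat \<Rightarrow> ('a \<Rightarrow> real mat) \<Rightarrow> bool" where
  "uniform_corr M n C \<longleftrightarrow>
     C \<in> space M \<rightarrow> corr_matrices n \<and>
     (\<lambda>w. offdiag n (C w)) \<in> measurable M (offdiag_lebesgue n) \<and>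
     distr M (offdiag_lebesgue n) (\<lambda>w. offdiag n (C w)) =
       uniform_measure (offdiag_lebesgue n) (offdiag n ` corr_matrices n)"

text \<open>The multiset \<^term>\<open>proots (char_poly C)\<close> consists of the real eigenvalues of \<open>C\<close> with
  algebraic multiplicity, i.e. of all \<open>n\<close> eigenvalues when \<open>C\<close> is symmetric.\<close>

definition esd :: "real mat \<Rightarrow> real \<Rightarrow> real" where
  "esd C x = real (size {#a \<in># proots (char_poly C). a \<le> x#}) / real (dim_row C)"

definition tendsto_in_prob :: "(nat \<Rightarrow> 'a measure) \<Rightarrow> (nat \<Rightarrow> 'a \<Rightarrow> real) \<Rightarrow> real \<Rightarrow> bool" where
  "tendsto_in_prob M X c \<longleftrightarrow>
     (\<forall>n. X n \<in> borel_measurable (M n)) \<and>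
     (\<forall>\<epsilon>>0. (\<lambda>n. measure (M n) {w \<in> space (M n). \<epsilon> < \<bar>X n w - c\<bar>}) \<longlonglongrightarrow> 0)"

text \<open>The in-probability version of \<^const>\<open>weak_conv\<close>, for random distribution functions
  \<open>F n\<close> and a deterministic limit \<open>G\<close>.\<close>

definition weak_conv_in_prob ::
  "(nat \<Rightarrow> 'a measure) \<Rightarrow> (nat \<Rightarrow> 'a \<Rightarrow> real \<Rightarrow> real) \<Rightarrow> (real \<Rightarrow> real) \<Rightarrow> bool" where
  "weak_conv_in_prob M F G \<longleftrightarrow>
     (\<forall>x. isCont G x \<longrightarrow> tendsto_in_prob M (\<lambda>n w. F n w x) (G x))"

definition mp_density :: "real \<Rightarrow> real" where
  "mp_density x = (if x \<in> {0<..4} then 1 / (2 * pi * x) * sqrt (x * (4 - x)) else 0)"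

definition mp_law :: "real measure" where
  "mp_law = density lborel (\<lambda>x. ennreal (mp_density x))"

end

theory Submission
  imports Defs "Jordan_Normal_Form.Schur_Decomposition"
begin

text \<open>The method of moments, with the moments obtained from integration by parts on the convex body
  of correlation matrices. Think of the entries \<open>C i j\<close> as inner products of unit vectors. Moving the
  \<open>i\<close>-th vector towards the \<open>j\<close>-th one defines a vector field on the body, polynomial in the entries,
  of divergence \<open>- n C i j\<close> and tangent to the boundary because its derivative of \<open>det C\<close>
  is \<open>- 2 C i j det C\<close>. For the directional derivative \<open>L i j\<close> the divergence theorem gives
  \<open>E (L i j f) = n E (C i j f)\<close> for \<open>i \<noteq> j\<close>. Summed over \<open>i, j\<close> with \<open>f = F (C ^ p) j i\<close>, where \<open>F\<close> is a
  product of the normalized traces \<open>m k = tr (C ^ k) / n\<close>, this yields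
  \<open>E (F m (p + 1)) = \<Sum>a + b = p. E (F m a m b) + O(1 / n)\<close>.
  In the limit this is the Catalan recursion satisfied by the Marchenko--Pastur moments, so the moments
  converge in mean square. Polynomials that bound the indicator of \<open>{..x}\<close> from above and below
  on \<open>[0, \<infinity>)\<close> transfer the convergence to the distribution functions.\<close>

unbundle no vec_syntax

subsection \<open>Moments of the Marchenko--Pastur law\<close>

text \<open>The boundary of the body need not be smooth, so the divergence theorem is proved one
  coordinate at a time: a coordinate line meets the body in a segment with \<open>det C = 0\<close>
  at both ends, and the cutoff \<open>det C / (det C + \<epsilon>)\<close> removes all boundary
  terms. The pairs \<open>i = j\<close>, for which the field is zero, escape integration by parts;
  they supply the term \<open>m 0 m p\<close> of the Catalan sum. The eigenvalues lie in
  \<open>[0, n]\<close> with no bound uniform in \<open>n\<close>. Their moments are nevertheless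
  bounded in mean: for \<open>F = 1\<close> the loop equation bounds each moment by the previous
  one, since \<open>m a m b \<le> m (a + b)\<close> by Chebyshev's sum inequality. For the same
  reason the polynomial bounds on the indicator must hold on the whole half-line, not just near the
  support of the limit law. The recursion is quadratic, and \<open>E (m a m b)\<close> is not known
  to factor. Admitting all products \<open>F\<close> closes the system under induction on the total
  degree; since the limits factor, the variances vanish, and this is the only source of
  concentration.\<close>

lemma mp_density_nonneg: "0 \<le> mp_density x"
  by (auto simp: mp_density_def)

lemma mp_density_measurable [measurable]: "mp_density \<in> borel_measurable borel"
  unfolding mp_density_def by measurable

lemma mp_density_outside: "x \<notin> {0<..<4} \<Longrightarrow> mp_density x = 0"
  by (auto simp: mp_density_def)

text \<open>With \<open>s\<close> for the square root the density is
  \<open>s / (2 * pi * x)\<close>. The second part gives the total mass. The function in the third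
  part vanishes at 0 and at 4, so integrating its derivative gives a two-term recursion for the
  moments.\<close>

lemma mp_antiderivatives:
  assumes "0 < x" "x < 4"
  shows "((\<lambda>x. sqrt (x * (4 - x))) has_real_derivative (2 - x) / sqrt (x * (4 - x))) (at x)"
    "((\<lambda>x. (sqrt (x * (4 - x)) + 2 * arcsin ((x - 2) / 2)) / (2 * pi)) has_real_derivative mp_density x) (at x)"
    "((\<lambda>x. x ^ k * (4 - x) * sqrt (x * (4 - x)) / (2 * pi)) has_real_derivative
       ((4 * real k + 2) * x ^ k - (real k + 2) * x ^ Suc k) * mp_density x) (at x)"
proof -
  define s where "s = sqrt (x * (4 - x))"
  have pos: "0 < x * (4 - x)" using assms by simp
  then have s: "s > 0" "s * s = x * (4 - x)" unfolding s_def by simp_all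
  show 1: "((\<lambda>x. sqrt (x * (4 - x))) has_real_derivative (2 - x) / sqrt (x * (4 - x))) (at x)"
  proof -
    have "((\<lambda>x. x * (4 - x)) has_real_derivative 4 - 2 * x) (at x)"
      by (auto intro!: derivative_eq_intros)
    from DERIV_chain2[OF DERIV_real_sqrt[OF pos] this] show ?thesis
      by (rule DERIV_cong) (use s in \<open>unfold s_def[symmetric], simp add: field_simps\<close>)
  qed
  have "1 - ((x - 2) / 2)\<^sup>2 = (s / 2)\<^sup>2"
    using s by (simp add: power2_eq_square field_simps)
  then have sq: "sqrt (1 - ((x - 2) / 2)\<^sup>2) = s / 2" using s by simp
  have 2: "((\<lambda>x. 2 * arcsin ((x - 2) / 2)) has_real_derivative 2 / s) (at x)"
  proof -
    have a: "((\<lambda>x. (x - 2) / 2) has_real_derivative 1 / 2) (at x)"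
      by (auto intro!: derivative_eq_intros)
    have b: "-1 < (x - 2) / 2" "(x - 2) / 2 < 1" using assms by simp_all
    from DERIV_cmult[OF DERIV_chain2[OF DERIV_arcsin[OF b] a], of 2] show ?thesis
      by (rule DERIV_cong) (use s in \<open>simp add: sq\<close>)
  qed
  have d: "mp_density x = s / (2 * pi * x)" unfolding mp_density_def s_def using assms by simp
  have e: "(2 - x) / s + 2 / s = s / x"
    using s assms by (simp add: field_simps)
  have "((\<lambda>x. (sqrt (x * (4 - x)) + 2 * arcsin ((x - 2) / 2)) / (2 * pi)) has_real_derivative
    ((2 - x) / s + 2 / s) / (2 * pi)) (at x)"
    using DERIV_cdivide[OF DERIV_add[OF 1 2], of "2 * pi"] unfolding s_def .
  then show "((\<lambda>x. (sqrt (x * (4 - x)) + 2 * arcsin ((x - 2) / 2)) / (2 * pi)) has_real_derivative mp_density x) (at x)"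
    unfolding d e by (simp add: field_simps)
  have 3: "((\<lambda>x. x ^ k * (4 - x)) has_real_derivative (real k * x ^ (k - 1) * (4 - x) - x ^ k)) (at x)"
    by (auto intro!: derivative_eq_intros simp: algebra_simps)
  \<comment> \<open>Naming the factor \<open>k * x ^ (k - 1)\<close> avoids the truncated exponent:
    \<open>u * x = k * x ^ k\<close> holds for \<open>k = 0\<close> as well.\<close>
  define u where "u = real k * x ^ (k - 1)"
  have u: "u * x = real k * x ^ k" unfolding u_def by (cases k) auto
  have "((u * (4 - x) - x ^ k) * s + (2 - x) / s * (x ^ k * (4 - x))) * (s * x) =
     (u * x * (4 - x) - x ^ k * x) * (s * s) + (2 - x) * (x ^ k * (4 - x)) * x"
  proof -
    have r: "((2 - x) / s * B) * (s * x) = (2 - x) * B * x" for B using s(1) by simp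
    show ?thesis unfolding distrib_right[of _ _ "s * x"] r by (simp add: algebra_simps)
  qed
  also have "\<dots> = (real k * x ^ k * (4 - x) - x ^ k * x) * (s * s) + (2 - x) * (x ^ k * (4 - x)) * x"
    unfolding u ..
  also have "\<dots> = ((4 * real k + 2) * x ^ k - (real k + 2) * x ^ Suc k) * (s * s)"
    unfolding s(2) by (simp add: algebra_simps)
  finally have "(u * (4 - x) - x ^ k) * s + (2 - x) / s * (x ^ k * (4 - x)) =
    ((4 * real k + 2) * x ^ k - (real k + 2) * x ^ Suc k) * (s * s) / (s * x)"
    using s(1) assms by (intro eq_divide_imp) auto
  also have "\<dots> = ((4 * real k + 2) * x ^ k - (real k + 2) * x ^ Suc k) * (s / x)"
    using s(1) by simp
  finally have "(u * (4 - x) - x ^ k) * s + (2 - x) / s * (x ^ k * (4 - x)) =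
    ((4 * real k + 2) * x ^ k - (real k + 2) * x ^ Suc k) * (s / x)" .
  then show "((\<lambda>x. x ^ k * (4 - x) * sqrt (x * (4 - x)) / (2 * pi)) has_real_derivative
       ((4 * real k + 2) * x ^ k - (real k + 2) * x ^ Suc k) * mp_density x) (at x)"
    using DERIV_cdivide[OF DERIV_mult[OF 3 1], of "2 * pi"] unfolding d s_def[symmetric] u_def[symmetric]
    by (simp add: mult_ac)
qed

lemma mp_density_integral: "has_bochner_integral lborel mp_density 1"
proof -
  let ?F = "\<lambda>x::real. (sqrt (x * (4 - x)) + 2 * arcsin ((x - 2) / 2)) / (2 * pi)"
  have c: "continuous_on {0..4} ?F" by (intro continuous_intros) auto
  \<comment> \<open>The density is unbounded near 0, hence the version of the fundamental theorem
    with derivatives only in the open interval and an antiderivative continuous on the closed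
    one.\<close>
  have "(mp_density has_integral ?F 4 - ?F 0) {0..4}"
    using mp_antiderivatives(2)
    by (intro fundamental_theorem_of_calculus_interior c)
       (auto simp: has_real_derivative_iff_has_vector_derivative[symmetric])
  moreover have "?F 4 - ?F 0 = 1" by (simp add: field_simps)
  ultimately have "(mp_density has_integral 1) {0..4}" by simp
  then have "((\<lambda>x. if x \<in> {0..4} then mp_density x else 0) has_integral 1) UNIV"
    by (subst has_integral_restrict_UNIV)
  also have "(\<lambda>x. if x \<in> {0..4} then mp_density x else 0) = mp_density"
    by (rule ext) (use mp_density_outside in force)
  finally have "integral\<^sup>N lborel mp_density = ennreal 1"
    by (intro nn_integral_has_integral_lborel) (auto simp: mp_density_nonneg)
  then show ?thesis by (intro has_bochner_integral_nn_integral) (auto simp: mp_density_nonneg)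
qed

lemma mp_power_integrable: "integrable lborel (\<lambda>x. x ^ k * mp_density x)"
proof (rule Bochner_Integration.integrable_bound)
  show "integrable lborel (\<lambda>x. 4 ^ k * mp_density x)"
    using mp_density_integral by (simp add: has_bochner_integral_iff)
  have "\<bar>x ^ k * mp_density x\<bar> \<le> \<bar>4 ^ k * mp_density x\<bar>" for x
    using mp_density_outside[of x] mp_density_nonneg[of x]
    by (cases "x \<in> {0<..<4}") (auto simp: abs_mult intro!: mult_right_mono power_mono)
  then show "AE x in lborel. norm (x ^ k * mp_density x) \<le> norm (4 ^ k * mp_density x)" by simp
qed measurable

definition mp_moment :: "nat \<Rightarrow> real" where
  "mp_moment k = (\<integral>x. x ^ k * mp_density x \<partial>lborel)"

lemma mp_moment_0: "mp_moment 0 = 1"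
  using mp_density_integral by (simp add: mp_moment_def has_bochner_integral_iff)

lemma mp_moment_le: "mp_moment k \<le> 4 ^ k"
proof -
  have "mp_moment k \<le> (\<integral>x. 4 ^ k * mp_density x \<partial>lborel)"
    unfolding mp_moment_def
  proof (rule integral_mono)
    show "integrable lborel (\<lambda>x. 4 ^ k * mp_density x)"
      using mp_density_integral by (simp add: has_bochner_integral_iff)
    show "x ^ k * mp_density x \<le> 4 ^ k * mp_density x" for x
      using mp_density_outside[of x] mp_density_nonneg[of x]
      by (cases "x \<in> {0<..<4}") (auto intro!: mult_right_mono power_mono)
  qed (rule mp_power_integrable)
  then show ?thesis using mp_density_integral by (simp add: has_bochner_integral_iff)
qed

lemma mp_moment_Suc: "(real k + 2) * mp_moment (Suc k) = (4 * real k + 2) * mp_moment k"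
proof -
  let ?F = "\<lambda>x::real. x ^ k * (4 - x) * sqrt (x * (4 - x)) / (2 * pi)"
  let ?f = "\<lambda>x. ((4 * real k + 2) * x ^ k - (real k + 2) * x ^ Suc k) * mp_density x"
  have i: "integrable lborel ?f"
    using mp_power_integrable[of k] mp_power_integrable[of "Suc k"]
    by (simp add: left_diff_distrib mult.assoc del: power_Suc)
  have c: "continuous_on {0..4} ?F" by (intro continuous_intros) auto
  have "(?f has_integral ?F 4 - ?F 0) {0..4}"
    using mp_antiderivatives(3)
    by (intro fundamental_theorem_of_calculus_interior c)
       (auto simp: has_real_derivative_iff_has_vector_derivative[symmetric])
  then have "(?f has_integral 0) {0..4}" by simp
  then have "((\<lambda>x. if x \<in> {0..4} then ?f x else 0) has_integral 0) UNIV"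
    by (subst has_integral_restrict_UNIV)
  also have "(\<lambda>x. if x \<in> {0..4} then ?f x else 0) = ?f"
    by (rule ext) (use mp_density_outside in force)
  finally have "integral\<^sup>L lborel ?f = 0"
    using has_integral_integral_lborel[OF i] has_integral_unique by blast
  moreover have "integral\<^sup>L lborel ?f = (4 * real k + 2) * mp_moment k - (real k + 2) * mp_moment (Suc k)"
    using mp_power_integrable[of k] mp_power_integrable[of "Suc k"]
    unfolding mp_moment_def by (simp add: left_diff_distrib mult.assoc del: power_Suc)
  ultimately show ?thesis by simp
qed

text \<open>With \<open>F\<close> the generating function of the moments, the recursion reads
  \<open>(X - 4X\<^sup>2) F' + (1 - 2X) F = 1\<close>; hence \<open>D = 1 - 2XF\<close> satisfies \<open>(1 - 4X) D' = -2 D\<close>,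
  which forces \<open>D\<^sup>2 = 1 - 4X\<close>, i.e. \<open>F = 1 + X F\<^sup>2\<close>.\<close>

lemma mp_moment_convolution:
  "mp_moment (Suc p) = (\<Sum>a\<le>p. mp_moment a * mp_moment (p - a))"
proof -
  define F where "F = Abs_fps mp_moment"
  define D where "D = 1 - 2 * fps_X * F"
  have ode: "(fps_X - 4 * fps_X\<^sup>2) * fps_deriv F + (1 - 2 * fps_X) * F = 1"
  proof (rule fps_ext)
    fix m
    show "fps_nth ((fps_X - 4 * fps_X\<^sup>2) * fps_deriv F + (1 - 2 * fps_X) * F) m = fps_nth 1 m"
    proof (cases m)
      case 0 then show ?thesis by (simp add: F_def mp_moment_0 power2_eq_square left_diff_distrib mult.assoc)
    next
      case (Suc k)
      have "fps_nth ((fps_X - 4 * fps_X\<^sup>2) * fps_deriv F) (Suc k) = real (Suc k) * mp_moment (Suc k) - 4 * (real k * mp_moment k)"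
        by (cases k) (auto simp: F_def power2_eq_square left_diff_distrib mult.assoc numeral_fps_const)
      moreover have "fps_nth ((1 - 2 * fps_X) * F) (Suc k) = mp_moment (Suc k) - 2 * mp_moment k"
        by (simp add: F_def left_diff_distrib mult.assoc numeral_fps_const)
      ultimately show ?thesis using Suc mp_moment_Suc[of k] by (simp add: algebra_simps)
    qed
  qed
  have D': "fps_deriv D = - 2 * F - 2 * fps_X * fps_deriv F"
    by (simp add: D_def algebra_simps)
  have "(1 - 4 * fps_X) * fps_deriv D = - 2 * (1 - 4 * fps_X) * F - 2 * ((fps_X - 4 * fps_X\<^sup>2) * fps_deriv F)"
    unfolding D' by (simp add: algebra_simps power2_eq_square)
  also have "(fps_X - 4 * fps_X\<^sup>2) * fps_deriv F = 1 - (1 - 2 * fps_X) * F"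
    using ode by (simp add: algebra_simps)
  also have "- 2 * (1 - 4 * fps_X) * F - 2 * (1 - (1 - 2 * fps_X) * F) = - 2 * D"
    unfolding D_def by (simp add: algebra_simps)
  finally have DD: "(1 - 4 * fps_X) * fps_deriv D = - 2 * D" .
  define E where "E = D * D"
  have "(1 - 4 * fps_X) * fps_deriv E = 2 * D * ((1 - 4 * fps_X) * fps_deriv D)"
    unfolding E_def by (simp add: algebra_simps)
  then have EE: "(1 - 4 * fps_X) * fps_deriv E = - 4 * E"
    unfolding DD E_def by (simp add: algebra_simps)
  have E0: "fps_nth E 0 = 1" by (simp add: E_def D_def)
  \<comment> \<open>The factor \<open>k - 1\<close> vanishes at \<open>k = 1\<close> and so kills
    every coefficient from degree 2 on, leaving the linear polynomial \<open>1 - 4X\<close>.\<close>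
  have Erec: "real (Suc k) * fps_nth E (Suc k) = 4 * (real k - 1) * fps_nth E k" for k
  proof -
    have 1: "fps_nth ((1 - 4 * fps_X) * fps_deriv E) k = real (Suc k) * fps_nth E (Suc k) - 4 * (real k * fps_nth E k)"
      by (cases k) (auto simp: left_diff_distrib mult.assoc numeral_fps_const)
    have 2: "fps_nth (- 4 * E) k = - 4 * fps_nth E k" by (simp add: numeral_fps_const)
    show ?thesis using 1[unfolded EE 2] by (simp add: algebra_simps)
  qed
  have E1: "fps_nth E 1 = - 4" using Erec[of 0] E0 by simp
  have E2: "fps_nth E (Suc (Suc k)) = 0" for k
  proof (induction k)
    case 0 then show ?case using Erec[of 1] by simp
  next
    case (Suc k) then show ?case using Erec[of "Suc (Suc k)"] by simp
  qed
  have "fps_nth E m = fps_nth (1 - 4 * fps_X) m" for m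
  proof (cases m)
    case 0 then show ?thesis using E0 by simp
  next
    case (Suc k) then show ?thesis using E1 E2 by (cases k) (auto simp: numeral_fps_const)
  qed
  then have "E = 1 - 4 * fps_X" by (rule fps_ext)
  then have "4 * fps_X * (F - (1 + fps_X * (F * F))) = 0"
    unfolding E_def D_def by (simp add: algebra_simps)
  then have "F = 1 + fps_X * (F * F)" by simp
  then have "fps_nth F (Suc p) = fps_nth (1 + fps_X * (F * F)) (Suc p)" by simp
  then have "fps_nth F (Suc p) = fps_nth (F * F) p" by simp
  then show ?thesis by (simp add: F_def fps_mult_nth atMost_atLeast0)
qed

subsection \<open>Polynomial bounds for the distribution function\<close>

text \<open>A continuous stand-in for the indicator of \<open>{..a}\<close>, to which Weierstrass
  approximation applies; \<open>d\<close> is the width of the ramp to the right of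
  \<open>a\<close>.\<close>

definition lin_step :: "real \<Rightarrow> real \<Rightarrow> real \<Rightarrow> real" where
  "lin_step a d t = max 0 (min 1 ((a + d - t) / d))"

lemma lin_step:
  assumes "d > 0"
  shows "continuous_on UNIV (lin_step a d)" "0 \<le> lin_step a d t" "lin_step a d t \<le> 1"
    "t \<le> a \<Longrightarrow> lin_step a d t = 1" "a + d \<le> t \<Longrightarrow> lin_step a d t = 0"
proof -
  show "continuous_on UNIV (lin_step a d)" unfolding lin_step_def using assms by (intro continuous_intros) auto
qed (use assms in \<open>auto simp: lin_step_def field_simps min_def max_def\<close>)

lemma polynomial_approx_interval:
  fixes f :: "real \<Rightarrow> real"
  assumes "continuous_on {a..b} f" "e > 0"
  obtains p where "\<And>x. x \<in> {a..b} \<Longrightarrow> \<bar>f x - poly p x\<bar> < e"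
proof -
  obtain g where g: "real_polynomial_function g" "\<And>x. x \<in> {a..b} \<Longrightarrow> \<bar>f x - g x\<bar> < e"
    using Stone_Weierstrass_real_polynomial_function[of "{a..b}" f e] assms by auto
  then obtain c n where c: "g = (\<lambda>x. \<Sum>i\<le>n. c i * x ^ i)"
    using real_polynomial_function_iff_sum[of g] by auto
  show ?thesis
    by (rule that[of "\<Sum>i\<le>n. Polynomial.monom (c i) i"]) (use g(2) in \<open>simp add: c poly_sum poly_monom\<close>)
qed

definition mp_poly :: "real poly \<Rightarrow> real" where
  "mp_poly p = (\<Sum>i\<le>degree p. coeff p i * mp_moment i)"

lemma mp_poly_integral:
  "integrable lborel (\<lambda>x. poly p x * mp_density x)" "(\<integral>x. poly p x * mp_density x \<partial>lborel) = mp_poly p"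
proof -
  have "(\<lambda>x. poly p x * mp_density x) = (\<lambda>x. \<Sum>i\<le>degree p. coeff p i * (x ^ i * mp_density x))"
    by (simp add: poly_altdef sum_distrib_right mult.assoc)
  then show "integrable lborel (\<lambda>x. poly p x * mp_density x)" "(\<integral>x. poly p x * mp_density x \<partial>lborel) = mp_poly p"
    using mp_power_integrable by (simp_all add: mp_poly_def mp_moment_def)
qed

text \<open>Read off from the integral form, since the defining sums run up to degrees that may
  differ between the polynomials.\<close>

lemma mp_poly_linear:
  "mp_poly (p + q) = mp_poly p + mp_poly q" "mp_poly (Polynomial.smult c p) = c * mp_poly p"
  "mp_poly (Polynomial.monom c k) = c * mp_moment k" "mp_poly 1 = 1" "mp_poly (p - q) = mp_poly p - mp_poly q"
proof -
  note i = mp_poly_integral(1)[of p] mp_poly_integral(1)[of q]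
  show "mp_poly (p + q) = mp_poly p + mp_poly q"
    using Bochner_Integration.integral_add[OF i] by (simp add: mp_poly_integral(2)[symmetric] distrib_right)
  show "mp_poly (p - q) = mp_poly p - mp_poly q"
    using Bochner_Integration.integral_diff[OF i] by (simp add: mp_poly_integral(2)[symmetric] left_diff_distrib)
  show "mp_poly (Polynomial.smult c p) = c * mp_poly p"
    by (simp add: mp_poly_integral(2)[symmetric] mult.assoc)
  show "mp_poly (Polynomial.monom c k) = c * mp_moment k"
    by (simp add: mp_poly_integral(2)[symmetric] mult.assoc poly_monom mp_moment_def)
  show "mp_poly 1 = 1" by (simp add: mp_poly_def mp_moment_0)
qed

text \<open>Beyond the support of the limit law the approximating polynomial is dominated by a high
  power \<open>(t / 5) ^ (r + m)\<close>, whose \<open>mp_law\<close>-integral is small because the support ends at \<open>4 < 5\<close>.\<close>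

lemma polynomial_majorant:
  fixes f :: "real \<Rightarrow> real"
  assumes f: "continuous_on UNIV f" "\<And>t. 0 \<le> f t" "\<And>t. f t \<le> 1" and e: "e > 0"
  obtains p where "\<And>t. 0 \<le> t \<Longrightarrow> f t \<le> poly p t"
    "mp_poly p \<le> (\<integral>x. f x * mp_density x \<partial>lborel) + e"
proof -
  \<comment> \<open>One third each for the approximation error of \<open>p\<close>, for the upward
    shift that makes it a majorant on \<open>[0, 5]\<close>, and for the tail monomial.\<close>
  define \<eta> where "\<eta> = e / 3"
  have \<eta>: "\<eta> > 0" using e by (simp add: \<eta>_def)
  have "continuous_on {0..5} f" using f(1) continuous_on_subset by blast
  then obtain p where p: "\<And>x. x \<in> {0..5} \<Longrightarrow> \<bar>f x - poly p x\<bar> < \<eta>"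
    using polynomial_approx_interval \<eta> by blast
  define r where "r = degree p"
  \<comment> \<open>For \<open>t \<ge> 5\<close> every power up to \<open>r\<close> is at most
    \<open>t ^ r\<close>, so the coefficient sum bounds \<open>poly p t\<close> and the extra 1
    bounds \<open>f\<close>; the factor \<open>5 ^ r\<close> compensates for the scaling by
    5.\<close>
  define A where "A = (1 + (\<Sum>i\<le>r. \<bar>coeff p i\<bar>)) * 5 ^ r"
  have A: "A > 0" unfolding A_def by (auto intro!: mult_pos_pos add_pos_nonneg sum_nonneg)
  have bound: "1 + \<bar>poly p t\<bar> \<le> A * (t / 5) ^ r" if "t \<ge> 5" for t
  proof -
    have 1: "t ^ i \<le> t ^ r" if "i \<le> r" for i using \<open>t \<ge> 5\<close> that by (intro power_increasing) auto
    have "\<bar>poly p t\<bar> \<le> (\<Sum>i\<le>r. \<bar>coeff p i * t ^ i\<bar>)" unfolding poly_altdef r_def by (rule sum_abs)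
    also have "\<dots> \<le> (\<Sum>i\<le>r. \<bar>coeff p i\<bar> * t ^ r)"
      using \<open>t \<ge> 5\<close> 1 by (intro sum_mono) (auto simp: abs_mult intro!: mult_left_mono)
    finally have "1 + \<bar>poly p t\<bar> \<le> t ^ r + (\<Sum>i\<le>r. \<bar>coeff p i\<bar>) * t ^ r"
      using 1[of 0] by (simp add: sum_distrib_right)
    moreover have "A * (t / 5) ^ r = (1 + (\<Sum>i\<le>r. \<bar>coeff p i\<bar>)) * t ^ r"
      unfolding A_def by (simp add: power_divide)
    ultimately show ?thesis by (simp add: distrib_right)
  qed
  \<comment> \<open>Raising the exponent from \<open>r\<close> to \<open>r + m\<close> only
    increases the monomial beyond 5 but makes it small on \<open>[0, 4]\<close>.\<close>
  have "(\<lambda>m. A * (4 / 5) ^ (r + m)) \<longlonglongrightarrow> A * 0"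
    by (intro tendsto_mult tendsto_const LIMSEQ_ignore_initial_segment[where f = "\<lambda>m. (4/5::real) ^ m" and k = r, unfolded add.commute[of _ r]] LIMSEQ_realpow_zero) auto
  then have "eventually (\<lambda>m. A * (4 / 5) ^ (r + m) < \<eta>) sequentially"
    using \<eta> by (intro order_tendstoD(2)) auto
  then obtain m where m: "A * (4 / 5) ^ (r + m) < \<eta>" by (auto simp: eventually_sequentially)
  define q where "q = p + Polynomial.smult \<eta> 1 + Polynomial.monom (A / 5 ^ (r + m)) (r + m)"
  have q: "poly q t = poly p t + \<eta> + A * (t / 5) ^ (r + m)" for t
    by (simp add: q_def poly_monom power_divide)
  show ?thesis
  proof (rule that[of q])
    fix t :: real assume t: "0 \<le> t"
    show "f t \<le> poly q t"
    proof (cases "t \<le> 5")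
      case True
      then have "f t \<le> poly p t + \<eta>" using p[of t] t by auto
      moreover have "0 \<le> A * (t / 5) ^ (r + m)" using A t by simp
      ultimately show ?thesis unfolding q by simp
    next
      case False
      have "(t / 5) ^ r \<le> (t / 5) ^ (r + m)" using False by (intro power_increasing) auto
      then have "A * (t / 5) ^ r \<le> A * (t / 5) ^ (r + m)" using A by simp
      then show ?thesis using bound[of t] False f(3)[of t] \<eta> unfolding q by auto
    qed
  next
    have "A / 5 ^ (r + m) * mp_moment (r + m) \<le> A / 5 ^ (r + m) * 4 ^ (r + m)"
      using A mp_moment_le by (intro mult_left_mono) auto
    also have "\<dots> = A * (4 / 5) ^ (r + m)" by (simp add: power_divide)
    finally have 1: "mp_poly q \<le> mp_poly p + \<eta> + \<eta>"
      using m unfolding q_def mp_poly_linear by simp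
    have fi: "integrable lborel (\<lambda>x. f x * mp_density x)"
    proof (rule Bochner_Integration.integrable_bound)
      show "integrable lborel mp_density" using mp_density_integral by (simp add: has_bochner_integral_iff)
      show "(\<lambda>x. f x * mp_density x) \<in> borel_measurable lborel"
        using borel_measurable_continuous_onI[OF f(1)] by simp
      show "AE x in lborel. norm (f x * mp_density x) \<le> norm (mp_density x)"
        using f(2,3) mp_density_nonneg by (auto simp: abs_mult intro!: mult_left_le_one_le)
    qed
    have "mp_poly p = (\<integral>x. poly p x * mp_density x \<partial>lborel)" by (simp add: mp_poly_integral)
    also have "\<dots> \<le> (\<integral>x. f x * mp_density x + \<eta> * mp_density x \<partial>lborel)"
    proof (rule integral_mono)
      fix x
      show "poly p x * mp_density x \<le> f x * mp_density x + \<eta> * mp_density x"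
      proof (cases "x \<in> {0<..<4}")
        case True
        then have "poly p x \<le> f x + \<eta>" using p[of x] by auto
        then show ?thesis using mp_density_nonneg[of x] mult_right_mono by (fastforce simp: distrib_right[symmetric])
      qed (simp add: mp_density_outside)
    qed (use fi mp_poly_integral mp_density_integral in \<open>auto simp: has_bochner_integral_iff\<close>)
    also have "\<dots> = (\<integral>x. f x * mp_density x \<partial>lborel) + \<eta>"
      using fi mp_density_integral by (simp add: has_bochner_integral_iff)
    finally show "mp_poly q \<le> (\<integral>x. f x * mp_density x \<partial>lborel) + e"
      using 1 by (simp add: \<eta>_def)
  qed
qed

lemma cdf_mp_law: "cdf mp_law x = (\<integral>t. indicator {..x} t * mp_density t \<partial>lborel)"
proof -
  have "emeasure mp_law {..x} = (\<integral>\<^sup>+t. ennreal (indicator {..x} t * mp_density t) \<partial>lborel)"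
    unfolding mp_law_def by (subst emeasure_density) (auto intro!: nn_integral_cong simp: indicator_def)
  then show ?thesis unfolding cdf_def measure_def
    by (subst integral_eq_nn_integral) (auto simp: mp_density_nonneg)
qed

lemma indicator_mp_integrable: "integrable lborel (\<lambda>t. indicator {..x::real} t * mp_density t)"
proof (rule Bochner_Integration.integrable_bound)
  show "integrable lborel mp_density" using mp_density_integral by (simp add: has_bochner_integral_iff)
qed (auto simp: indicator_def)

lemma lin_step_mp_integrable: "d > 0 \<Longrightarrow> integrable lborel (\<lambda>t. lin_step a d t * mp_density t)"
proof (rule Bochner_Integration.integrable_bound)
  show "integrable lborel mp_density" using mp_density_integral by (simp add: has_bochner_integral_iff)
  assume d: "d > 0"
  show "(\<lambda>t. lin_step a d t * mp_density t) \<in> borel_measurable lborel"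
    using borel_measurable_continuous_onI[OF lin_step(1)[OF d]] by simp
  show "AE x in lborel. norm (lin_step a d x * mp_density x) \<le> norm (mp_density x)"
    using lin_step(2,3)[OF d] mp_density_nonneg by (auto simp: abs_mult intro!: mult_left_le_one_le)
qed

text \<open>The ramp is placed on \<open>[x, x + d]\<close>, where continuity keeps the increase of
  the distribution function below \<open>e / 2\<close>; the other half of \<open>e\<close> pays for
  the polynomial.\<close>

lemma cdf_polynomial_majorant:
  assumes "isCont (cdf mp_law) x" "e > 0"
  obtains p where "\<And>t. 0 \<le> t \<Longrightarrow> indicator {..x} t \<le> poly p t" "mp_poly p \<le> cdf mp_law x + e"
proof -
  obtain d where d: "d > 0" "\<bar>cdf mp_law (x + d) - cdf mp_law x\<bar> < e / 2"
  proof -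
    obtain s where "s > 0" "\<And>y. \<bar>y - x\<bar> < s \<Longrightarrow> \<bar>cdf mp_law y - cdf mp_law x\<bar> < e / 2"
      using assms unfolding continuous_at_eps_delta dist_real_def by (metis half_gt_zero)
    then show ?thesis using that[of "s / 2"] by simp
  qed
  note s = lin_step[OF d(1), where a = x]
  obtain p where p: "\<And>t. 0 \<le> t \<Longrightarrow> lin_step x d t \<le> poly p t"
    "mp_poly p \<le> (\<integral>t. lin_step x d t * mp_density t \<partial>lborel) + e / 2"
    using polynomial_majorant[of "lin_step x d" "e / 2"] s assms(2) by auto
  have "(\<integral>t. lin_step x d t * mp_density t \<partial>lborel) \<le> cdf mp_law (x + d)"
    unfolding cdf_mp_law
  proof (rule integral_mono)
    fix t show "lin_step x d t * mp_density t \<le> indicator {..x + d} t * mp_density t"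
      using s(2,3,5)[of t] mp_density_nonneg[of t] by (intro mult_right_mono) (auto simp: indicator_def)
  qed (use lin_step_mp_integrable indicator_mp_integrable d in auto)
  then have "mp_poly p \<le> cdf mp_law x + e" using p(2) d(2) by linarith
  moreover have "indicator {..x} t \<le> poly p t" if "0 \<le> t" for t
    using p(1)[OF that] s(2,4)[of t] by (auto simp: indicator_def)
  ultimately show ?thesis using that by blast
qed

text \<open>A majorant \<open>p\<close> of the complementary ramp \<open>1 - lin_step\<close>, now
  placed on \<open>[x - d, x]\<close>, turns into the minorant \<open>1 - p\<close>.\<close>

lemma cdf_polynomial_minorant:
  assumes "isCont (cdf mp_law) x" "e > 0"
  obtains p where "\<And>t. 0 \<le> t \<Longrightarrow> poly p t \<le> indicator {..x} t" "cdf mp_law x - e \<le> mp_poly p"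
proof -
  obtain d where d: "d > 0" "\<bar>cdf mp_law (x - d) - cdf mp_law x\<bar> < e / 2"
  proof -
    obtain s where "s > 0" "\<And>y. \<bar>y - x\<bar> < s \<Longrightarrow> \<bar>cdf mp_law y - cdf mp_law x\<bar> < e / 2"
      using assms unfolding continuous_at_eps_delta dist_real_def by (metis half_gt_zero)
    then show ?thesis using that[of "s / 2"] by simp
  qed
  note s = lin_step[OF d(1), where a = "x - d"]
  let ?f = "\<lambda>t. 1 - lin_step (x - d) d t"
  obtain p where p: "\<And>t. 0 \<le> t \<Longrightarrow> ?f t \<le> poly p t"
    "mp_poly p \<le> (\<integral>t. ?f t * mp_density t \<partial>lborel) + e / 2"
  proof (rule polynomial_majorant[of ?f "e / 2"])
    show "continuous_on UNIV ?f" using s(1) by (intro continuous_intros)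
  qed (use s assms(2) in auto)
  have "(\<integral>t. ?f t * mp_density t \<partial>lborel) = 1 - (\<integral>t. lin_step (x - d) d t * mp_density t \<partial>lborel)"
    using lin_step_mp_integrable[OF d(1)] mp_density_integral
    by (simp add: left_diff_distrib has_bochner_integral_iff)
  moreover have "cdf mp_law (x - d) \<le> (\<integral>t. lin_step (x - d) d t * mp_density t \<partial>lborel)"
    unfolding cdf_mp_law
  proof (rule integral_mono)
    fix t show "indicator {..x - d} t * mp_density t \<le> lin_step (x - d) d t * mp_density t"
      using s(2,4)[of t] mp_density_nonneg[of t] by (intro mult_right_mono) (auto simp: indicator_def)
  qed (use lin_step_mp_integrable indicator_mp_integrable d in auto)
  ultimately have "cdf mp_law x - e \<le> mp_poly (1 - p)" using p(2) d(2) unfolding mp_poly_linear by linarith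
  moreover have "poly (1 - p) t \<le> indicator {..x} t" if "0 \<le> t" for t
    using p(1)[OF that] s(3,5)[of t] by (auto simp: indicator_def)
  ultimately show ?thesis using that by blast
qed

subsection \<open>Eigenvalues and traces of powers\<close>

text \<open>Powers are taken entrywise on functions, so that each entry is visibly a polynomial in
  the entries of \<open>A\<close> and can be differentiated; \<open>mpow_eq_pow_mat\<close> links
  them to matrix powers.\<close>

fun mpow :: "nat \<Rightarrow> (nat \<Rightarrow> nat \<Rightarrow> real) \<Rightarrow> nat \<Rightarrow> nat \<Rightarrow> nat \<Rightarrow> real" where
  "mpow n A 0 i j = (if i = j then 1 else 0)"
| "mpow n A (Suc p) i j = (\<Sum>k<n. A i k * mpow n A p k j)"

lemma mpow_add:
  assumes "i < n" "j < n"
  shows "mpow n A (p + q) i j = (\<Sum>k<n. mpow n A p i k * mpow n A q k j)"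
  using assms
proof (induction p arbitrary: i)
  case 0
  then show ?case by (simp add: if_distrib[of "\<lambda>x. x * _"] cong: if_cong)
next
  case (Suc p)
  have "mpow n A (Suc p + q) i j = (\<Sum>k<n. A i k * (\<Sum>l<n. mpow n A p k l * mpow n A q l j))"
    using Suc by simp
  also have "\<dots> = (\<Sum>k<n. \<Sum>l<n. A i k * mpow n A p k l * mpow n A q l j)"
    by (simp add: sum_distrib_left mult.assoc)
  also have "\<dots> = (\<Sum>l<n. mpow n A (Suc p) i l * mpow n A q l j)"
    by (subst sum.swap) (simp add: sum_distrib_right)
  finally show ?case .
qed

lemma mpow_one: "j < n \<Longrightarrow> mpow n A (Suc 0) i j = A i j"
  by (simp add: if_distrib[of "\<lambda>x. _ * x"] cong: if_cong)

lemma mpow_Suc_right: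
  assumes "i < n" "j < n"
  shows "mpow n A (Suc p) i j = (\<Sum>k<n. mpow n A p i k * A k j)"
  using mpow_add[of i n j A p "Suc 0"] assms mpow_one[of j n A] by simp

lemma mpow_sym:
  assumes "\<And>i j. A i j = A j i" "i < n" "j < n"
  shows "mpow n A p i j = mpow n A p j i"
  using assms(2,3)
proof (induction p arbitrary: i j)
  case (Suc p)
  have "mpow n A (Suc p) i j = (\<Sum>k<n. mpow n A p j k * A k i)"
    using Suc by (simp add: assms(1)[of i] mult.commute)
  then show ?case using mpow_Suc_right[of j n i A p] Suc by simp
qed auto

lemma mpow_eq_pow_mat:
  assumes "i < n" "j < n"
  shows "(mat n n (\<lambda>(i, j). A i j) ^\<^sub>m p) $$ (i, j) = mpow n A p i j"
  using assms
proof (induction p arbitrary: i j)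
  case (Suc p)
  let ?A = "mat n n (\<lambda>(i, j). A i j)"
  have "?A ^\<^sub>m p \<in> carrier_mat n n" by simp
  then have "(?A ^\<^sub>m Suc p) $$ (i, j) = (\<Sum>k<n. (?A ^\<^sub>m p) $$ (i, k) * A k j)"
    using Suc.prems by (simp add: scalar_prod_def lessThan_atLeast0)
  then show ?case using Suc by (simp add: mpow_Suc_right del: mpow.simps)
qed auto

section \<open>Triangular form, real eigenvalues and traces\<close>

lemma trace_mult_commute:
  fixes A B :: "'a::comm_semiring_0 mat"
  assumes "A \<in> carrier_mat n n" "B \<in> carrier_mat n n"
  shows "(\<Sum>i<n. (A * B) $$ (i, i)) = (\<Sum>i<n. (B * A) $$ (i, i))"
proof -
  have "(\<Sum>i<n. (A * B) $$ (i, i)) = (\<Sum>i<n. \<Sum>j<n. A $$ (i, j) * B $$ (j, i))"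
    using assms by (simp add: scalar_prod_def lessThan_atLeast0)
  also have "\<dots> = (\<Sum>j<n. \<Sum>i<n. B $$ (j, i) * A $$ (i, j))"
    by (subst sum.swap) (simp add: mult.commute)
  also have "\<dots> = (\<Sum>i<n. (B * A) $$ (i, i))"
    using assms by (simp add: scalar_prod_def lessThan_atLeast0)
  finally show ?thesis .
qed

lemma upper_triangular_pow_mat:
  fixes B :: "'a::comm_semiring_1 mat"
  assumes "B \<in> carrier_mat n n" "upper_triangular B" "i < n"
  shows "j < i \<Longrightarrow> (B ^\<^sub>m p) $$ (i, j) = 0" "(B ^\<^sub>m p) $$ (i, i) = B $$ (i, i) ^ p"
proof -
  have "(\<forall>j<i. (B ^\<^sub>m p) $$ (i, j) = 0) \<and> (B ^\<^sub>m p) $$ (i, i) = B $$ (i, i) ^ p"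
  proof (induction p)
    case (Suc p)
    have c: "B ^\<^sub>m p \<in> carrier_mat n n" using assms(1) by simp
    have e: "(B ^\<^sub>m Suc p) $$ (i, j) = (\<Sum>k<n. (B ^\<^sub>m p) $$ (i, k) * B $$ (k, j))" if "j < n" for j
      using assms(1,3) c that by (simp add: scalar_prod_def lessThan_atLeast0)
    have z: "(B ^\<^sub>m p) $$ (i, k) * B $$ (k, j) = 0" if "j \<le> i" "k < n" "k \<noteq> i \<or> j \<noteq> i" for k j
    proof (cases "k < i")
      case True then show ?thesis using Suc by simp
    next
      case False
      then have "j < k" using that by auto
      then have "B $$ (k, j) = 0" using assms(1,2) that by auto
      then show ?thesis by simp
    qed
    have "(B ^\<^sub>m Suc p) $$ (i, j) = 0" if "j < i" for j
      using that assms(3) z[of j] by (subst e) (auto intro!: sum.neutral)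
    moreover have "(B ^\<^sub>m Suc p) $$ (i, i) = (\<Sum>k<n. if k = i then (B ^\<^sub>m p) $$ (i, i) * B $$ (i, i) else 0)"
      unfolding e[OF assms(3)] using z[of i] by (intro sum.cong refl) auto
    ultimately show ?case using assms(3) Suc by (simp add: mult.commute)
  qed (use assms in auto)
  then show "j < i \<Longrightarrow> (B ^\<^sub>m p) $$ (i, j) = 0" "(B ^\<^sub>m p) $$ (i, i) = B $$ (i, i) ^ p" by auto
qed

text \<open>Schur's triangular form suffices: the trace is invariant under similarity, and powers of
  a triangular matrix carry the powers of the diagonal entries on their diagonal.\<close>

lemma trace_pow_mat_eigenvalues:
  fixes A :: "'a::conjugatable_ordered_field mat"
  assumes A: "A \<in> carrier_mat n n" and c: "char_poly A = (\<Prod>e\<leftarrow>es. [:- e, 1:])"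
  shows "(\<Sum>i<n. (A ^\<^sub>m p) $$ (i, i)) = (\<Sum>e\<leftarrow>es. e ^ p)"
proof -
  obtain B P Q where s: "schur_decomposition A es = (B, P, Q)" by (cases "schur_decomposition A es") auto
  from schur_decomposition[OF A c s] have w: "similar_mat_wit A B P Q" and u: "upper_triangular B"
    and d: "diag_mat B = es" by auto
  from similar_mat_witD2[OF A w] have car: "B \<in> carrier_mat n n" "P \<in> carrier_mat n n" "Q \<in> carrier_mat n n"
    and QP: "Q * P = 1\<^sub>m n" by auto
  have "similar_mat_wit (A ^\<^sub>m p) (B ^\<^sub>m p) P Q"
    using similar_mat_wit_pow[OF w] .
  then have "A ^\<^sub>m p = P * (B ^\<^sub>m p) * Q" using A similar_mat_witD2(3)[of "A ^\<^sub>m p" n n] by auto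
  also have "\<dots> = P * (B ^\<^sub>m p * Q)" using car by (intro assoc_mult_mat) auto
  finally have "(\<Sum>i<n. (A ^\<^sub>m p) $$ (i, i)) = (\<Sum>i<n. ((B ^\<^sub>m p * Q) * P) $$ (i, i))"
    using trace_mult_commute[OF car(2), of "B ^\<^sub>m p * Q"] car by (simp del: index_mult_mat add: mult_carrier_mat[OF pow_carrier_mat])
  also have "(B ^\<^sub>m p * Q) * P = B ^\<^sub>m p * (Q * P)" using car by (intro assoc_mult_mat) auto
  also have "\<dots> = B ^\<^sub>m p" using QP car by auto
  also have "(\<Sum>i<n. (B ^\<^sub>m p) $$ (i, i)) = (\<Sum>i<n. B $$ (i, i) ^ p)"
    using upper_triangular_pow_mat(2)[OF car(1) u] by auto
  also have "\<dots> = (\<Sum>e\<leftarrow>es. e ^ p)"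
    unfolding d[symmetric] using car by (simp add: diag_mat_def sum_list_sum_nth lessThan_atLeast0)
  finally show ?thesis .
qed

text \<open>The polynomial splits over the complex numbers. For an eigenvector \<open>v\<close> the
  Hermitian form \<open>?S\<close> equals the eigenvalue times the squared norm of \<open>v\<close>,
  and by symmetry it is its own conjugate; so all roots are real and the factorization descends
  along the injective embedding of the reals.\<close>

lemma symmetric_char_poly_splits:
  fixes A :: "real mat"
  assumes A: "A \<in> carrier_mat n n" and sym: "transpose_mat A = A"
  obtains es where "length es = n" "char_poly A = (\<Prod>e\<leftarrow>es. [:- e, 1:])"
proof -
  let ?B = "map_mat complex_of_real A"
  have B: "?B \<in> carrier_mat n n" using A by simp
  from char_poly_factorized[OF B] obtain as where as: "char_poly ?B = (\<Prod>a\<leftarrow>as. [:- a, 1:])" "length as = n"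
    by auto
  have real: "Im a = 0" if "a \<in> set as" for a
  proof -
    have "poly (char_poly ?B) a = 0" using that unfolding as(1) poly_prod_list prod_list_zero_iff
      by (auto intro!: image_eqI[of _ _ a])
    then have "eigenvalue ?B a" using eigenvalue_root_char_poly[OF B] by simp
    then obtain v where v: "v \<in> carrier_vec n" "v \<noteq> 0\<^sub>v n" "?B *\<^sub>v v = a \<cdot>\<^sub>v v"
      using B unfolding eigenvalue_def eigenvector_def by auto
    have e: "(\<Sum>j<n. complex_of_real (A $$ (i, j)) * v $ j) = a * v $ i" if "i < n" for i
    proof -
      have "(?B *\<^sub>v v) $ i = (\<Sum>j<n. complex_of_real (A $$ (i, j)) * v $ j)"
        using that A v(1) by (simp add: scalar_prod_def lessThan_atLeast0)
      then show ?thesis using v that by simp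
    qed
    have s: "A $$ (i, j) = A $$ (j, i)" if "i < n" "j < n" for i j
      using that A sym by (metis carrier_matD index_transpose_mat(1))
    let ?S = "\<Sum>i<n. \<Sum>j<n. cnj (v $ i) * complex_of_real (A $$ (i, j)) * v $ j"
    have "?S = (\<Sum>i<n. cnj (v $ i) * (a * v $ i))"
      using e by (simp add: sum_distrib_left[symmetric] mult.assoc)
    also have "\<dots> = a * (\<Sum>i<n. complex_of_real ((cmod (v $ i))\<^sup>2))"
      by (simp add: sum_distrib_left complex_norm_square mult_ac del: of_real_power)
    finally have 1: "?S = a * complex_of_real (\<Sum>i<n. (cmod (v $ i))\<^sup>2)" by simp
    have "cnj ?S = (\<Sum>i<n. \<Sum>j<n. v $ i * complex_of_real (A $$ (i, j)) * cnj (v $ j))" by simp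
    also have "\<dots> = (\<Sum>j<n. \<Sum>i<n. v $ i * complex_of_real (A $$ (i, j)) * cnj (v $ j))" by (rule sum.swap)
    also have "\<dots> = ?S" using s by (intro sum.cong refl) (auto simp: mult_ac)
    finally have "Im (cnj ?S) = Im ?S" by (rule arg_cong)
    then have "Im ?S = 0" unfolding cnj.simps by linarith
    then have 2: "Im a * (\<Sum>i<n. (cmod (v $ i))\<^sup>2) = 0" unfolding 1 by simp
    have "(\<Sum>i<n. (cmod (v $ i))\<^sup>2) \<noteq> 0"
    proof
      assume "(\<Sum>i<n. (cmod (v $ i))\<^sup>2) = 0"
      then have "\<forall>i<n. v $ i = 0" by (subst (asm) sum_nonneg_eq_0_iff) auto
      then have "v = 0\<^sub>v n" using v(1) by (intro eq_vecI) auto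
      then show False using v(2) by simp
    qed
    with 2 show ?thesis by simp
  qed
  define es where "es = map Re as"
  have "map complex_of_real es = as" unfolding es_def using real
    by (auto simp: complex_is_Real_iff map_idI of_real_Re)
  then have "char_poly ?B = (\<Prod>a\<leftarrow>map complex_of_real es. [:- a, 1:])" using as by simp
  also have "\<dots> = (\<Prod>e\<leftarrow>es. map_poly complex_of_real [:- e, 1:])" by (simp add: o_def)
  also have "\<dots> = map_poly complex_of_real (\<Prod>e\<leftarrow>es. [:- e, 1:])"
  proof -
    interpret h: map_poly_comm_ring_hom complex_of_real ..
    show ?thesis by (simp add: h.hom_prod_list o_def)
  qed
  finally have "map_poly complex_of_real (char_poly A) = map_poly complex_of_real (\<Prod>e\<leftarrow>es. [:- e, 1:])"
    unfolding of_real_hom.char_poly_hom[OF A, symmetric] .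
  then have "char_poly A = (\<Prod>e\<leftarrow>es. [:- e, 1:])"
    by (simp add: poly_eq_iff coeff_map_poly)
  moreover have "length es = n" using as unfolding es_def by simp
  ultimately show ?thesis using that by blast
qed

lemma proots_prod_linear: "proots (\<Prod>e\<leftarrow>es. [:- e, 1:]) = mset (es :: real list)"
proof (induction es)
  case (Cons e es)
  have "(\<Prod>e\<leftarrow>es. [:- e, 1:]) \<noteq> 0" by (auto simp: prod_list_zero_iff)
  then show ?case using Cons by (simp add: proots_mult del: mult_pCons_left)
qed auto

lemma char_poly_root_eigenvector:
  fixes A :: "real mat"
  assumes A: "A \<in> carrier_mat n n" and "char_poly A = (\<Prod>e\<leftarrow>es. [:- e, 1:])" "e \<in> set es"
  obtains v where "v \<in> carrier_vec n" "v \<noteq> 0\<^sub>v n" "A *\<^sub>v v = e \<cdot>\<^sub>v v"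
proof -
  have "poly (char_poly A) e = 0" using assms(3) unfolding assms(2) poly_prod_list prod_list_zero_iff
    by (auto intro!: image_eqI[of _ _ e])
  then have "eigenvalue A e" using eigenvalue_root_char_poly[OF A] by simp
  then show ?thesis using A that unfolding eigenvalue_def eigenvector_def by auto
qed

subsection \<open>Polynomial functions and a divergence theorem\<close>

lemma abs_mult_le:
  fixes x :: real
  assumes "\<bar>x\<bar> \<le> A" "0 \<le> c" "c \<le> C"
  shows "\<bar>x * c\<bar> \<le> A * C"
  using assms by (auto simp: abs_mult intro!: mult_mono)

text \<open>A class of functions rather than of formal polynomials in several variables:
  measurability, bounds on the cube, restriction to coordinate lines and closure under partial
  derivatives all follow by induction on how the function is built.\<close>

inductive poly_fun :: "'i set \<Rightarrow> (('i \<Rightarrow> real) \<Rightarrow> real) \<Rightarrow> bool" for I where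
  poly_fun_const: "poly_fun I (\<lambda>w. c)"
| poly_fun_coord: "i \<in> I \<Longrightarrow> poly_fun I (\<lambda>w. w i)"
| poly_fun_add: "poly_fun I f \<Longrightarrow> poly_fun I g \<Longrightarrow> poly_fun I (\<lambda>w. f w + g w)"
| poly_fun_mult: "poly_fun I f \<Longrightarrow> poly_fun I g \<Longrightarrow> poly_fun I (\<lambda>w. f w * g w)"

lemma poly_fun_uminus: "poly_fun I f \<Longrightarrow> poly_fun I (\<lambda>w. - f w)"
  using poly_fun_mult[OF poly_fun_const[of I "-1"], of f] by simp

lemma poly_fun_diff: "poly_fun I f \<Longrightarrow> poly_fun I g \<Longrightarrow> poly_fun I (\<lambda>w. f w - g w)"
  using poly_fun_add[OF _ poly_fun_uminus, of I f g] by simp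

lemma poly_fun_divide: "poly_fun I f \<Longrightarrow> poly_fun I (\<lambda>w. f w / c)"
  using poly_fun_mult[OF _ poly_fun_const[of I "1 / c"], of f] by simp

lemma poly_fun_sum: "(\<And>a. a \<in> A \<Longrightarrow> poly_fun I (f a)) \<Longrightarrow> poly_fun I (\<lambda>w. \<Sum>a\<in>A. f a w)"
  by (induction A rule: infinite_finite_induct) (auto intro: poly_fun_const poly_fun_add)

lemma poly_fun_prod: "(\<And>a. a \<in> A \<Longrightarrow> poly_fun I (f a)) \<Longrightarrow> poly_fun I (\<lambda>w. \<Prod>a\<in>A. f a w)"
  by (induction A rule: infinite_finite_induct) (auto intro: poly_fun_const poly_fun_mult)

lemmas poly_fun_intros = poly_fun_const poly_fun_coord poly_fun_add poly_fun_mult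
  poly_fun_uminus poly_fun_diff poly_fun_divide poly_fun_sum poly_fun_prod

lemma poly_fun_measurable:
  assumes "poly_fun I f"
  shows "f \<in> borel_measurable (PiM I (\<lambda>_. lborel))"
  using assms
proof induction
  case (poly_fun_coord i)
  then show ?case using measurable_component_singleton[of i I "\<lambda>_. lborel :: real measure"] by simp
qed (simp_all add: borel_measurable_add borel_measurable_times)

lemma poly_fun_bounded:
  assumes "poly_fun I f"
  obtains B where "B \<ge> 0" "\<And>w. (\<And>i. i \<in> I \<Longrightarrow> \<bar>w i\<bar> \<le> 1) \<Longrightarrow> \<bar>f w\<bar> \<le> B"
proof -
  have "\<exists>B\<ge>0. \<forall>w. (\<forall>i\<in>I. \<bar>w i\<bar> \<le> 1) \<longrightarrow> \<bar>f w\<bar> \<le> B"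
    using assms
  proof induction
    case (poly_fun_const c)
    show ?case by (intro exI[of _ "\<bar>c\<bar>"]) auto
  next
    case (poly_fun_coord i)
    then show ?case by (intro exI[of _ 1]) auto
  next
    case (poly_fun_add f g)
    then obtain A B where "A \<ge> 0" "B \<ge> 0"
      "\<And>w. \<forall>i\<in>I. \<bar>w i\<bar> \<le> 1 \<Longrightarrow> \<bar>f w\<bar> \<le> A" "\<And>w. \<forall>i\<in>I. \<bar>w i\<bar> \<le> 1 \<Longrightarrow> \<bar>g w\<bar> \<le> B"
      by metis
    then show ?case by (intro exI[of _ "A + B"]) (auto intro: order_trans[OF abs_triangle_ineq add_mono])
  next
    case (poly_fun_mult f g)
    then obtain A B where "A \<ge> 0" "B \<ge> 0"
      "\<And>w. \<forall>i\<in>I. \<bar>w i\<bar> \<le> 1 \<Longrightarrow> \<bar>f w\<bar> \<le> A" "\<And>w. \<forall>i\<in>I. \<bar>w i\<bar> \<le> 1 \<Longrightarrow> \<bar>g w\<bar> \<le> B"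
      by metis
    then show ?case by (intro exI[of _ "A * B"]) (auto simp: abs_mult intro!: mult_mono)
  qed
  then show ?thesis using that by blast
qed

text \<open>This gives both differentiability along coordinate lines and, unless the restriction is
  zero, finitely many zeros on them.\<close>

lemma poly_fun_univariate:
  assumes "poly_fun I f"
  obtains p where "\<And>t. f (w(e := t)) = poly p t"
proof -
  have "\<exists>p. \<forall>t. f (w(e := t)) = poly p t"
    using assms
  proof induction
    case (poly_fun_const c)
    show ?case by (intro exI[of _ "[:c:]"]) auto
  next
    case (poly_fun_coord i)
    show ?case by (cases "i = e") (auto intro: exI[of _ "[:0, 1:]"] exI[of _ "[:w i:]"])
  next
    case (poly_fun_add f g)
    then obtain p q where "\<And>t. f (w(e := t)) = poly p t" "\<And>t. g (w(e := t)) = poly q t" by blast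
    then have "f (w(e := t)) + g (w(e := t)) = poly (p + q) t" for t by (simp only: poly_add)
    then show ?case by blast
  next
    case (poly_fun_mult f g)
    then obtain p q where "\<And>t. f (w(e := t)) = poly p t" "\<And>t. g (w(e := t)) = poly q t" by blast
    then have "f (w(e := t)) * g (w(e := t)) = poly (p * q) t" for t by (simp only: poly_mult)
    then show ?case by blast
  qed
  then show ?thesis using that by blast
qed

lemma poly_fun_fix_coord:
  assumes "poly_fun (insert i I) f"
  shows "poly_fun I (\<lambda>w. f (w(i := y)))"
  using assms
proof induction
  case (poly_fun_coord j)
  then show ?case by (cases "j = i") (auto intro: poly_fun_intros)
qed (auto intro: poly_fun_intros)

section \<open>Partial derivatives of polynomial functions\<close>

definition partial :: "'i \<Rightarrow> (('i \<Rightarrow> real) \<Rightarrow> real) \<Rightarrow> ('i \<Rightarrow> real) \<Rightarrow> real" where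
  "partial e f w = deriv (\<lambda>t. f (w(e := t))) (w e)"

lemma partial_has_derivative:
  assumes "poly_fun I f"
  shows "((\<lambda>t. f (w(e := t))) has_real_derivative partial e f (w(e := t))) (at t within S)"
proof -
  obtain p where p: "\<And>t. f (w(e := t)) = poly p t" using poly_fun_univariate[OF assms] by blast
  have "((\<lambda>t. f (w(e := t))) has_real_derivative poly (pderiv p) t) (at t)"
    unfolding p by (rule poly_DERIV)
  moreover from this have "partial e f (w(e := t)) = poly (pderiv p) t"
    unfolding partial_def by (simp add: DERIV_imp_deriv)
  ultimately show ?thesis by (auto intro: has_field_derivative_at_within)
qed

lemma partial_eqI:
  assumes "((\<lambda>t. f (w(e := t))) has_real_derivative d) (at (w e))"
  shows "partial e f w = d"
  using assms unfolding partial_def by (rule DERIV_imp_deriv)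

lemma partial_has_derivative':
  assumes "poly_fun I f"
  shows "((\<lambda>t. f (w(e := t))) has_real_derivative partial e f w) (at (w e))"
  using partial_has_derivative[OF assms, of w e "w e"] by simp

lemma partial_const: "partial e (\<lambda>w. c) w = 0"
  by (rule partial_eqI) auto

lemma partial_coord: "partial e (\<lambda>w. w i) w = (if i = e then 1 else 0)"
  by (rule partial_eqI) auto

lemma partial_add:
  assumes "poly_fun I f" "poly_fun I g"
  shows "partial e (\<lambda>w. f w + g w) w = partial e f w + partial e g w"
  using partial_has_derivative'[OF assms(1)] partial_has_derivative'[OF assms(2)]
  by (intro partial_eqI DERIV_add)

lemma partial_mult:
  assumes "poly_fun I f" "poly_fun I g"
  shows "partial e (\<lambda>w. f w * g w) w = partial e f w * g w + f w * partial e g w"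
  by (rule partial_eqI, rule DERIV_cong,
      rule DERIV_mult[OF partial_has_derivative'[OF assms(1)] partial_has_derivative'[OF assms(2)]])
     (simp add: mult.commute)

lemma poly_fun_partial:
  assumes "poly_fun I f"
  shows "poly_fun I (partial e f)"
  using assms
proof induction
  case (poly_fun_add f g)
  have "partial e (\<lambda>w. f w + g w) = (\<lambda>w. partial e f w + partial e g w)"
    using partial_add[OF poly_fun_add.hyps] by auto
  then show ?case using poly_fun_add by (auto intro: poly_fun_intros)
next
  case (poly_fun_mult f g)
  have "partial e (\<lambda>w. f w * g w) = (\<lambda>w. partial e f w * g w + f w * partial e g w)"
    using partial_mult[OF poly_fun_mult.hyps] by auto
  then show ?case using poly_fun_mult by (auto intro: poly_fun_intros)
next
  case (poly_fun_const c)
  have "partial e (\<lambda>w. c) = (\<lambda>w. 0)" by (simp add: fun_eq_iff partial_const)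
  then show ?case by (auto intro: poly_fun_intros)
next
  case (poly_fun_coord i)
  have "partial e (\<lambda>w. w i) = (\<lambda>w. if i = e then 1 else 0)" by (simp add: fun_eq_iff partial_coord)
  then show ?case by (auto intro: poly_fun_intros)
qed

text \<open>Induction over the number of variables: if \<open>f\<close> does not vanish at \<open>w\<^sub>0\<close>, then for almost
  all values of the other variables \<open>f\<close> is a nonzero polynomial in the last one.\<close>

lemma poly_fun_AE_nonzero:
  assumes "finite I" "poly_fun I f" "f w\<^sub>0 \<noteq> 0"
  shows "AE w in PiM I (\<lambda>_. lborel). f w \<noteq> 0"
  using assms
proof (induction I arbitrary: f rule: finite_induct)
  case empty
  have "f w = f w\<^sub>0" for w
    using empty(1) by induction auto
  then have "f w \<noteq> 0" for w using empty(2) by metis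
  then show ?case by simp
next
  case (insert i I)
  interpret product_sigma_finite "\<lambda>_. lborel :: real measure" by standard
  let ?P = "PiM (insert i I) (\<lambda>_. lborel :: real measure)"
  let ?Z = "{w \<in> space ?P. f w = 0}"
  have [measurable]: "f \<in> borel_measurable ?P" using poly_fun_measurable[OF insert.prems(1)] .
  have Z: "?Z \<in> sets ?P" by measurable
  \<comment> \<open>Freezing coordinate \<open>i\<close> at its value in \<open>w\<^sub>0\<close>
    leaves a function that is still nonzero at \<open>w\<^sub>0\<close>, as the induction hypothesis
    requires.\<close>
  have "AE x in PiM I (\<lambda>_. lborel). f (x(i := w\<^sub>0 i)) \<noteq> 0"
    using insert.prems by (intro insert.IH poly_fun_fix_coord) auto
  then have ae: "AE x in PiM I (\<lambda>_. lborel). (\<integral>\<^sup>+y. indicator ?Z (x(i := y)) \<partial>lborel) = 0"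
  proof (rule AE_mp, intro AE_I2 impI)
    fix x assume x: "f (x(i := w\<^sub>0 i)) \<noteq> 0"
    obtain p where p: "\<And>t. f (x(i := t)) = poly p t"
      using poly_fun_univariate[OF insert.prems(1)] by blast
    have "p \<noteq> 0" using x p by auto
    then have "finite {y. poly p y = 0}" by (rule poly_roots_finite)
    then have "AE y in lborel. y \<notin> {y. poly p y = 0}"
      by (intro AE_not_in finite_imp_null_set_lborel)
    then have "AE y in lborel. indicator ?Z (x(i := y)) = (0::ennreal)"
      by (rule AE_mp) (auto simp: p indicator_def)
    then have "(\<integral>\<^sup>+y. indicator ?Z (x(i := y)) \<partial>lborel) = (\<integral>\<^sup>+y. 0 \<partial>(lborel :: real measure))"
      by (intro nn_integral_cong_AE) auto
    then show "(\<integral>\<^sup>+y. indicator ?Z (x(i := y)) \<partial>lborel) = 0" by simp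
  qed
  have "emeasure ?P ?Z = (\<integral>\<^sup>+w. indicator ?Z w \<partial>?P)" using Z by simp
  also have "\<dots> = (\<integral>\<^sup>+x. (\<integral>\<^sup>+y. indicator ?Z (x(i := y)) \<partial>lborel) \<partial>PiM I (\<lambda>_. lborel))"
    using insert.hyps Z by (intro product_nn_integral_insert) auto
  also have "\<dots> = (\<integral>\<^sup>+x. 0 \<partial>PiM I (\<lambda>_. lborel :: real measure))"
    using ae by (intro nn_integral_cong_AE)
  finally show ?case by (intro AE_I[of _ _ ?Z]) (use Z in auto)
qed

text \<open>What the divergence theorem below uses about its domain: every coordinate line meets
  \<open>K\<close> in a compact segment or not at all, and the polynomial \<open>\<delta>\<close>
  vanishes at the ends of the segment. The point \<open>w\<^sub>0\<close> certifies that
  \<open>\<delta>\<close> is not the zero polynomial, so its zero set is null.\<close>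

locale poly_body =
  fixes I :: "'i set" and K :: "('i \<Rightarrow> real) set" and \<delta> :: "('i \<Rightarrow> real) \<Rightarrow> real"
    and w\<^sub>0 :: "'i \<Rightarrow> real"
  assumes fin: "finite I"
    and delta: "poly_fun I \<delta>" "\<delta> w\<^sub>0 \<noteq> 0" "\<And>w. w \<in> K \<Longrightarrow> 0 \<le> \<delta> w"
    and sets: "K \<in> sets (PiM I (\<lambda>_. lborel))"
    and box: "\<And>w i. w \<in> K \<Longrightarrow> i \<in> I \<Longrightarrow> \<bar>w i\<bar> \<le> 1"
    and fiber: "\<And>w e s. w(e := s) \<in> K \<Longrightarrow> e \<in> I \<Longrightarrow>
      \<exists>a b. a \<le> b \<and> {t. w(e := t) \<in> K} = {a..b} \<and> \<delta> (w(e := a)) = 0 \<and> \<delta> (w(e := b)) = 0"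
begin

abbreviation P where "P \<equiv> PiM I (\<lambda>_. lborel :: real measure)"

lemma measure_finite: "emeasure P K < \<infinity>"
proof -
  interpret product_sigma_finite "\<lambda>_. lborel :: real measure" by standard
  have "K \<subseteq> PiE I (\<lambda>_. {-1..1})"
  proof
    fix w assume w: "w \<in> K"
    then have "w \<in> extensional I" using sets.sets_into_space[OF sets] by (auto simp: space_PiM PiE_def)
    then show "w \<in> PiE I (\<lambda>_. {-1..1})" using box[OF w] by (simp add: PiE_iff abs_le_iff)
  qed
  moreover have "PiE I (\<lambda>_. {-1..1}) \<in> sets P" 
    using sets_PiM_I_finite[OF fin, of "\<lambda>_. {-1..1::real}" "\<lambda>_. lborel"] by simp
  ultimately have "emeasure P K \<le> emeasure P (PiE I (\<lambda>_. {-1..1}))" by (intro emeasure_mono)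
  also have "\<dots> = (\<Prod>i\<in>I. emeasure lborel {-1..1::real})" 
    using emeasure_PiM[OF fin, of "\<lambda>_. {-1..1}"] by simp
  also have "\<dots> < \<infinity>" using fin by (simp add: power_less_top_ennreal)
  finally show ?thesis .
qed

lemma integrable_bounded:
  fixes f :: "('i \<Rightarrow> real) \<Rightarrow> real"
  assumes "f \<in> borel_measurable P" "\<And>w. w \<in> K \<Longrightarrow> \<bar>f w\<bar> \<le> B"
  shows "integrable P (\<lambda>w. indicator K w * f w)"
proof (rule Bochner_Integration.integrable_bound)
  show "integrable P (\<lambda>w. indicator K w * B)"
    using measure_finite sets by (intro integrable_mult_left integrable_real_indicator) auto
  show "(\<lambda>w. indicator K w * f w) \<in> borel_measurable P" using assms(1) sets by measurable
  show "AE w in P. norm (indicator K w * f w) \<le> norm (indicator K w * B)"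
    using assms(2) by (force simp: indicator_def)
qed

lemma integrable_poly_fun:
  assumes "poly_fun I f"
  shows "integrable P (\<lambda>w. indicator K w * f w)"
proof -
  obtain B where "\<And>w. (\<And>i. i \<in> I \<Longrightarrow> \<bar>w i\<bar> \<le> 1) \<Longrightarrow> \<bar>f w\<bar> \<le> B"
    using poly_fun_bounded[OF assms] by blast
  then show ?thesis using box
    by (intro integrable_bounded[where f = f and B = B] poly_fun_measurable assms; blast)
qed

text \<open>The integrand is the partial derivative of
  \<open>G * \<delta> / (\<delta> + \<epsilon>)\<close>, a function that vanishes at both ends of
  every fibre in direction \<open>e\<close>. Fubini and the fundamental theorem of calculus then
  give zero.\<close>

lemma cutoff_integral_zero:
  assumes e: "e \<in> I" and G: "poly_fun I G" and eps: "\<epsilon> > 0"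
  shows "(\<integral>w. indicator K w * (partial e G w * (\<delta> w / (\<delta> w + \<epsilon>)) +
    G w * partial e \<delta> w * (\<epsilon> / (\<delta> w + \<epsilon>)\<^sup>2)) \<partial>P) = 0"
    and "integrable P (\<lambda>w. indicator K w * (partial e G w * (\<delta> w / (\<delta> w + \<epsilon>)) +
    G w * partial e \<delta> w * (\<epsilon> / (\<delta> w + \<epsilon>)\<^sup>2)))"
proof -
  interpret product_sigma_finite "\<lambda>_. lborel :: real measure" by standard
  define g where "g = (\<lambda>w. partial e G w * (\<delta> w / (\<delta> w + \<epsilon>)) + G w * partial e \<delta> w * (\<epsilon> / (\<delta> w + \<epsilon>)\<^sup>2))"
  have pf: "poly_fun I (partial e G)" "poly_fun I (\<lambda>w. G w * partial e \<delta> w)"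
    using G delta(1) by (auto intro: poly_fun_intros poly_fun_partial)
  have [measurable]: "g \<in> borel_measurable P"
    unfolding g_def using pf[THEN poly_fun_measurable] delta(1)[THEN poly_fun_measurable] by measurable
  obtain A where A: "A \<ge> 0" "\<And>w. (\<And>i. i \<in> I \<Longrightarrow> \<bar>w i\<bar> \<le> 1) \<Longrightarrow> \<bar>partial e G w\<bar> \<le> A"
    using poly_fun_bounded[OF pf(1)] by blast
  obtain B where B: "B \<ge> 0" "\<And>w. (\<And>i. i \<in> I \<Longrightarrow> \<bar>w i\<bar> \<le> 1) \<Longrightarrow> \<bar>G w * partial e \<delta> w\<bar> \<le> B"
    using poly_fun_bounded[OF pf(2)] by blast
  \<comment> \<open>This bound degenerates as \<open>\<epsilon>\<close> tends to 0 and serves only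
    integrability for fixed \<open>\<epsilon>\<close>; a uniform bound appears only after summing
    over the directions.\<close>
  have bound: "\<bar>g w\<bar> \<le> A * 1 + B * (1 / \<epsilon>)" if "w \<in> K" for w
  proof -
    have d: "0 \<le> \<delta> w" using that delta(3) by auto
    have "\<epsilon> * \<epsilon> \<le> (\<delta> w + \<epsilon>)\<^sup>2" unfolding power2_eq_square using d eps by (intro mult_mono) auto
    then have "\<epsilon> / (\<delta> w + \<epsilon>)\<^sup>2 \<le> 1 / \<epsilon>" using d eps by (simp add: field_simps)
    moreover have "\<delta> w / (\<delta> w + \<epsilon>) \<le> 1" using d eps by simp
    ultimately have "\<bar>partial e G w * (\<delta> w / (\<delta> w + \<epsilon>))\<bar> \<le> A * 1"
      "\<bar>G w * partial e \<delta> w * (\<epsilon> / (\<delta> w + \<epsilon>)\<^sup>2)\<bar> \<le> B * (1 / \<epsilon>)"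
      using d eps A B box[OF that] by (intro abs_mult_le; simp)+
    then show ?thesis unfolding g_def using abs_triangle_ineq[of "partial e G w * (\<delta> w / (\<delta> w + \<epsilon>))"] by (meson add_mono order_trans)
  qed
  have int: "integrable P (\<lambda>w. indicator K w * g w)" by (rule integrable_bounded[OF _ bound]) auto
  then show "integrable P (\<lambda>w. indicator K w * (partial e G w * (\<delta> w / (\<delta> w + \<epsilon>)) +
    G w * partial e \<delta> w * (\<epsilon> / (\<delta> w + \<epsilon>)\<^sup>2)))" unfolding g_def .
  have I: "insert e (I - {e}) = I" using e by auto
  have "(\<integral>w. indicator K w * g w \<partial>P) = (\<integral>x. (\<integral>y. indicator K (x(e := y)) * g (x(e := y)) \<partial>lborel) \<partial>PiM (I - {e}) (\<lambda>_. lborel))"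
    using product_integral_insert[of "I - {e}" e "\<lambda>w. indicator K w * g w"] fin int unfolding I by simp
  also have "\<dots> = (\<integral>x. 0 \<partial>PiM (I - {e}) (\<lambda>_. lborel :: real measure))"
  proof (rule Bochner_Integration.integral_cong[OF refl])
    fix x
    show "(\<integral>y. indicator K (x(e := y)) * g (x(e := y)) \<partial>lborel) = 0"
    proof (cases "\<exists>s. x(e := s) \<in> K")
      case False then show ?thesis by simp
    next
      case True
      then obtain a b where ab: "a \<le> b" "{t. x(e := t) \<in> K} = {a..b}" "\<delta> (x(e := a)) = 0" "\<delta> (x(e := b)) = 0"
        using fiber e by meson
      let ?F = "\<lambda>t. G (x(e := t)) * (\<delta> (x(e := t)) / (\<delta> (x(e := t)) + \<epsilon>))"
      have der: "(?F has_real_derivative g (x(e := t))) (at t within {a..b})" if "a \<le> t" "t \<le> b" for t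
      proof -
        let ?d = "\<delta> (x(e := t))" and ?D = "partial e \<delta> (x(e := t))"
        have "x(e := t) \<in> K" using that ab(2) by auto
        then have "0 \<le> ?d" using delta(3) by auto
        then have nz: "?d + \<epsilon> \<noteq> 0" using eps by auto
        note dd = partial_has_derivative[OF delta(1), of x e t "{a..b}"]
        note q = DERIV_divide[OF dd DERIV_add[OF dd DERIV_const[of \<epsilon>]] nz]
        have "(?D * (?d + \<epsilon>) - ?d * (?D + 0)) / ((?d + \<epsilon>) * (?d + \<epsilon>)) = ?D * (\<epsilon> / (?d + \<epsilon>)\<^sup>2)"
          using nz by (simp add: power2_eq_square algebra_simps)
        then have "partial e G (x(e := t)) * (?d / (?d + \<epsilon>)) +
            (?D * (?d + \<epsilon>) - ?d * (?D + 0)) / ((?d + \<epsilon>) * (?d + \<epsilon>)) * G (x(e := t)) = g (x(e := t))"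
          unfolding g_def by simp
        with DERIV_mult[OF partial_has_derivative[OF G, of x e t "{a..b}"] q] show ?thesis
          by (rule DERIV_cong)
      qed
      have cont: "continuous_on {a..b} (\<lambda>t. g (x(e := t)))"
      proof -
        have c: "continuous_on {a..b} (\<lambda>t. f (x(e := t)))" if "poly_fun I f" for f
          using DERIV_continuous_on[of "{a..b}" "\<lambda>t. f (x(e := t))", OF partial_has_derivative[OF that]] by simp
        have "\<delta> (x(e := t)) + \<epsilon> \<noteq> 0" if "t \<in> {a..b}" for t
          using delta(3)[of "x(e := t)"] ab(2) that eps by force
        then show ?thesis unfolding g_def
          by (intro continuous_intros c G delta pf poly_fun_partial) auto
      qed
      have "(\<integral>y. indicator {a..b} y *\<^sub>R g (x(e := y)) \<partial>lborel) = ?F b - ?F a"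
        using ab(1) der[unfolded has_real_derivative_iff_has_vector_derivative] cont
        by (rule integral_FTC_Icc)
      also have "\<dots> = 0" using ab by simp
      finally have "(\<integral>y. indicator {a..b} y * g (x(e := y)) \<partial>lborel) = 0" by simp
      moreover have "indicator K (x(e := y)) = (indicator {a..b} y :: real)" for y
        using ab(2) unfolding indicator_def by auto
      ultimately show ?thesis by simp
    qed
  qed
  finally show "(\<integral>w. indicator K w * (partial e G w * (\<delta> w / (\<delta> w + \<epsilon>)) +
    G w * partial e \<delta> w * (\<epsilon> / (\<delta> w + \<epsilon>)\<^sup>2)) \<partial>P) = 0" unfolding g_def by simp
qed

text \<open>Pass to the limit \<open>\<epsilon> \<rightarrow> 0\<close> in the cutoff \<open>\<delta> / (\<delta> + \<epsilon>)\<close>; tangency makes the derivative of the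
  cutoff contribute only \<open>\<epsilon> \<delta> / (\<delta> + \<epsilon>)\<^sup>2 \<le> 1\<close>.\<close>

lemma divergence_integral_zero:
  assumes T: "T \<subseteq> I" and V: "\<And>e. e \<in> T \<Longrightarrow> poly_fun I (V e)" and lam: "poly_fun I lam"
    and tang: "\<And>w. w \<in> K \<Longrightarrow> (\<Sum>e\<in>T. V e w * partial e \<delta> w) = lam w * \<delta> w"
  shows "(\<integral>w. indicator K w * (\<Sum>e\<in>T. partial e (V e) w) \<partial>P) = 0"
proof -
  define divV where "divV = (\<lambda>w. \<Sum>e\<in>T. partial e (V e) w)"
  have dv: "poly_fun I divV" unfolding divV_def using V by (intro poly_fun_sum poly_fun_partial) auto
  \<comment> \<open>The sum over \<open>e\<close> of the cutoff integrands, with tangency already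
    used to replace the sum of \<open>V e w * partial e \<delta> w\<close> by
    \<open>lam w * \<delta> w\<close>.\<close>
  define s where "s = (\<lambda>m w. divV w * (\<delta> w / (\<delta> w + 1 / real (Suc m))) +
    lam w * (\<delta> w * (1 / real (Suc m)) / (\<delta> w + 1 / real (Suc m))\<^sup>2))"
  have s0: "(\<integral>w. indicator K w * s m w \<partial>P) = 0" for m
  proof -
    let ?e = "1 / real (Suc m)"
    let ?g = "\<lambda>e w. indicator K w * (partial e (V e) w * (\<delta> w / (\<delta> w + ?e)) + V e w * partial e \<delta> w * (?e / (\<delta> w + ?e)\<^sup>2))"
    have "indicator K w * s m w = (\<Sum>e\<in>T. ?g e w)" for w
    proof (cases "w \<in> K")
      case True
      define c d where "c = \<delta> w / (\<delta> w + ?e)" and "d = ?e / (\<delta> w + ?e)\<^sup>2"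
      have "(\<Sum>e\<in>T. ?g e w) = (\<Sum>e\<in>T. partial e (V e) w * c + V e w * partial e \<delta> w * d)"
        using True by (simp add: c_def d_def)
      also have "\<dots> = divV w * c + (\<Sum>e\<in>T. V e w * partial e \<delta> w) * d"
        by (simp add: divV_def sum.distrib sum_distrib_right)
      finally show ?thesis using True tang[OF True] by (simp add: s_def c_def d_def mult.assoc)
    qed auto
    then have "(\<integral>w. indicator K w * s m w \<partial>P) = (\<integral>w. (\<Sum>e\<in>T. ?g e w) \<partial>P)" by simp
    also have "\<dots> = (\<Sum>e\<in>T. \<integral>w. ?g e w \<partial>P)"
      using T V by (intro Bochner_Integration.integral_sum cutoff_integral_zero(2)) auto
    also have "\<dots> = 0" using T V by (intro sum.neutral ballI cutoff_integral_zero(1)) auto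
    finally show ?thesis .
  qed
  obtain A where A: "A \<ge> 0" "\<And>w. (\<And>i. i \<in> I \<Longrightarrow> \<bar>w i\<bar> \<le> 1) \<Longrightarrow> \<bar>divV w\<bar> \<le> A"
    using poly_fun_bounded[OF dv] by blast
  obtain B where B: "B \<ge> 0" "\<And>w. (\<And>i. i \<in> I \<Longrightarrow> \<bar>w i\<bar> \<le> 1) \<Longrightarrow> \<bar>lam w\<bar> \<le> B"
    using poly_fun_bounded[OF lam] by blast
  have "(\<lambda>m. \<integral>w. indicator K w * s m w \<partial>P) \<longlonglongrightarrow> (\<integral>w. indicator K w * divV w \<partial>P)"
  proof (rule integral_dominated_convergence[where w = "\<lambda>w. indicator K w * (A + B)"])
    show "integrable P (\<lambda>w. indicator K w * (A + B))"
      by (rule integrable_poly_fun) (rule poly_fun_const)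
    show "(\<lambda>w. indicator K w * divV w) \<in> borel_measurable P"
      using integrable_poly_fun[OF dv] by auto
    show "(\<lambda>w. indicator K w * s m w) \<in> borel_measurable P" for m
      unfolding s_def using dv[THEN poly_fun_measurable] lam[THEN poly_fun_measurable]
        delta(1)[THEN poly_fun_measurable] sets by measurable
    show "AE w in P. norm (indicator K w * s m w) \<le> indicator K w * (A + B)" for m
    proof (rule AE_I2)
      fix w
      show "norm (indicator K w * s m w) \<le> indicator K w * (A + B)"
      proof (cases "w \<in> K")
        case True
        define e where "e = 1 / real (Suc m)"
        have e: "e > 0" by (simp add: e_def)
        have d: "0 \<le> \<delta> w" using delta(3) True by auto
        have 1: "\<delta> w / (\<delta> w + e) \<le> 1" using d e by simp
        have "\<delta> w * e \<le> (\<delta> w + e) * (\<delta> w + e)" using d e by (intro mult_mono) auto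
        then have 2: "\<delta> w * e / (\<delta> w + e)\<^sup>2 \<le> 1" using d e by (simp add: power2_eq_square)
        have "\<bar>divV w * (\<delta> w / (\<delta> w + e))\<bar> \<le> A * 1" "\<bar>lam w * (\<delta> w * e / (\<delta> w + e)\<^sup>2)\<bar> \<le> B * 1"
          using 1 2 A B box[OF True] d e by (intro abs_mult_le; simp)+
        then show ?thesis using True unfolding s_def e_def[symmetric]
          using abs_triangle_ineq[of "divV w * (\<delta> w / (\<delta> w + e))" "lam w * (\<delta> w * e / (\<delta> w + e)\<^sup>2)"] by simp
      qed simp
    qed
    \<comment> \<open>Where \<open>\<delta>\<close> vanishes the cutoff is 0 for every
      \<open>m\<close> and does not tend to 1; those points form a null set.\<close>
    show "AE w in P. (\<lambda>m. indicator K w * s m w) \<longlonglongrightarrow> indicator K w * divV w"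
      using poly_fun_AE_nonzero[OF fin delta(1,2)]
    proof (rule AE_mp, intro AE_I2 impI)
      fix w assume nz: "\<delta> w \<noteq> 0"
      have i: "(\<lambda>m. 1 / real (Suc m)) \<longlonglongrightarrow> 0" using LIMSEQ_inverse_real_of_nat by (simp add: inverse_eq_divide)
      have "(\<lambda>m. s m w) \<longlonglongrightarrow> divV w * (\<delta> w / (\<delta> w + 0)) + lam w * (\<delta> w * 0 / (\<delta> w + 0)\<^sup>2)"
        unfolding s_def using nz by (intro tendsto_intros i) auto
      then have "(\<lambda>m. s m w) \<longlonglongrightarrow> divV w" using nz by simp
      then show "(\<lambda>m. indicator K w * s m w) \<longlonglongrightarrow> indicator K w * divV w" by (intro tendsto_intros)
    qed
  qed
  then have "(\<lambda>m. 0) \<longlonglongrightarrow> (\<integral>w. indicator K w * divV w \<partial>P)" unfolding s0 .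
  then have "(\<integral>w. indicator K w * divV w \<partial>P) = 0" using LIMSEQ_unique tendsto_const by metis
  then show ?thesis unfolding divV_def .
qed

end

subsection \<open>The body of correlation matrices\<close>

definition entry :: "(nat \<times> nat \<Rightarrow> real) \<Rightarrow> nat \<Rightarrow> nat \<Rightarrow> real" where
  "entry w i j = (if i = j then 1 else if i < j then w (i, j) else w (j, i))"

definition bil :: "nat \<Rightarrow> (nat \<times> nat \<Rightarrow> real) \<Rightarrow> (nat \<Rightarrow> real) \<Rightarrow> (nat \<Rightarrow> real) \<Rightarrow> real" where
  "bil n w u v = (\<Sum>i<n. \<Sum>j<n. u i * entry w i j * v j)"

text \<open>Extensional functions are the points of the product space that carries the uniform law.
  The test vectors live on all naturals, but \<open>bil\<close> reads only their values below
  \<open>n\<close>.\<close>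

definition corr_body :: "nat \<Rightarrow> (nat \<times> nat \<Rightarrow> real) set" where
  "corr_body n = {w \<in> extensional (upper_indices n). \<forall>v. 0 \<le> bil n w v v}"

definition corr_mat :: "nat \<Rightarrow> (nat \<times> nat \<Rightarrow> real) \<Rightarrow> real mat" where
  "corr_mat n w = mat n n (\<lambda>(i, j). entry w i j)"

definition corr_det :: "nat \<Rightarrow> (nat \<times> nat \<Rightarrow> real) \<Rightarrow> real" where
  "corr_det n w = det (corr_mat n w)"

lemma finite_upper_indices: "finite (upper_indices n)"
  by (rule finite_subset[of _ "{..<n} \<times> {..<n}"]) (auto simp: upper_indices_def)

lemma entry_sym: "entry w i j = entry w j i"
  by (auto simp: entry_def)

lemma entry_diag [simp]: "entry w i i = 1"
  by (simp add: entry_def)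

lemma corr_mat_carrier [simp]: "corr_mat n w \<in> carrier_mat n n"
  by (simp add: corr_mat_def)

lemma corr_mat_index [simp]: "i < n \<Longrightarrow> j < n \<Longrightarrow> corr_mat n w $$ (i, j) = entry w i j"
  by (simp add: corr_mat_def)

lemma corr_mat_transpose: "transpose_mat (corr_mat n w) = corr_mat n w"
  by (rule eq_matI) (auto simp: corr_mat_def entry_sym)

lemma scalar_prod_corr_mat:
  assumes "v \<in> carrier_vec n"
  shows "scalar_prod v (corr_mat n w *\<^sub>v v) = bil n w (\<lambda>i. v $ i) (\<lambda>i. v $ i)"
  using assms by (simp add: corr_mat_def scalar_prod_def bil_def sum_distrib_left mult.assoc lessThan_atLeast0)

lemma pos_semidef_corr_mat: "pos_semidef n (corr_mat n w) \<longleftrightarrow> (\<forall>v. 0 \<le> bil n w v v)"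
proof
  assume p: "pos_semidef n (corr_mat n w)"
  show "\<forall>v. 0 \<le> bil n w v v"
  proof
    fix v
    have "bil n w (\<lambda>i. vec n v $ i) (\<lambda>i. vec n v $ i) = bil n w v v" by (simp add: bil_def)
    moreover have "0 \<le> scalar_prod (vec n v) (corr_mat n w *\<^sub>v vec n v)"
      using p unfolding pos_semidef_def by simp
    ultimately show "0 \<le> bil n w v v"
      using scalar_prod_corr_mat[of "vec n v" n w] by simp
  qed
qed (simp add: pos_semidef_def scalar_prod_corr_mat)

lemma corr_mat_offdiag:
  assumes "C \<in> corr_matrices n"
  shows "corr_mat n (offdiag n C) = C"
proof (rule eq_matI)
  have C: "C \<in> carrier_mat n n" "transpose_mat C = C" "\<And>i. i < n \<Longrightarrow> C $$ (i, i) = 1"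
    using assms by (auto simp: corr_matrices_def)
  fix i j assume "i < dim_row C" "j < dim_col C"
  then have ij: "i < n" "j < n" using C by auto
  have "C $$ (j, i) = C $$ (i, j)" using C ij by (metis carrier_matD index_transpose_mat(1))
  then show "corr_mat n (offdiag n C) $$ (i, j) = C $$ (i, j)"
    using ij C(3) by (auto simp: entry_def offdiag_def upper_indices_def)
qed (use assms in \<open>auto simp: corr_matrices_def corr_mat_def\<close>)

lemma offdiag_corr_mat:
  assumes "w \<in> extensional (upper_indices n)"
  shows "offdiag n (corr_mat n w) = w"
proof
  fix ij
  show "offdiag n (corr_mat n w) ij = w ij"
    using assms by (cases ij) (auto simp: offdiag_def extensional_def upper_indices_def entry_def)
qed

lemma corr_mat_corr_matrices:
  assumes "w \<in> corr_body n"
  shows "corr_mat n w \<in> corr_matrices n"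
  using assms by (simp add: corr_matrices_def corr_body_def corr_mat_transpose pos_semidef_corr_mat)

lemma offdiag_corr_body:
  assumes "C \<in> corr_matrices n"
  shows "offdiag n C \<in> corr_body n"
proof -
  have "pos_semidef n (corr_mat n (offdiag n C))"
    using assms by (simp add: corr_mat_offdiag) (simp add: corr_matrices_def)
  then show ?thesis by (simp add: corr_body_def pos_semidef_corr_mat) (simp add: offdiag_def)
qed

lemma offdiag_image_corr_matrices: "offdiag n ` corr_matrices n = corr_body n"
proof
  show "corr_body n \<subseteq> offdiag n ` corr_matrices n"
    using corr_mat_corr_matrices offdiag_corr_mat by (force simp: corr_body_def image_iff)
qed (auto intro: offdiag_corr_body)

lemma corr_mat_eigenvalues:
  assumes "w \<in> corr_body n"
  obtains es where "length es = n" "char_poly (corr_mat n w) = (\<Prod>e\<leftarrow>es. [:- e, 1:])" "\<And>e. e \<in> set es \<Longrightarrow> 0 \<le> e"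
proof -
  obtain es where es: "length es = n" "char_poly (corr_mat n w) = (\<Prod>e\<leftarrow>es. [:- e, 1:])"
    using symmetric_char_poly_splits[OF corr_mat_carrier corr_mat_transpose] by blast
  have "0 \<le> e" if "e \<in> set es" for e
  proof -
    obtain v where v: "v \<in> carrier_vec n" "v \<noteq> 0\<^sub>v n" "corr_mat n w *\<^sub>v v = e \<cdot>\<^sub>v v"
      using char_poly_root_eigenvector[OF corr_mat_carrier es(2) \<open>e \<in> set es\<close>] by blast
    have "0 \<le> scalar_prod v (corr_mat n w *\<^sub>v v)"
      using assms v(1) by (simp add: scalar_prod_corr_mat corr_body_def)
    also have "\<dots> = e * scalar_prod v v" unfolding v(3) using v(1) by simp
    finally have 0: "0 \<le> e * scalar_prod v v" .
    have "scalar_prod v v = (\<Sum>i<n. (v $ i)\<^sup>2)"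
      using v(1) by (simp add: scalar_prod_def power2_eq_square lessThan_atLeast0)
    moreover have "(\<Sum>i<n. (v $ i)\<^sup>2) \<noteq> 0"
    proof
      assume "(\<Sum>i<n. (v $ i)\<^sup>2) = 0"
      then have "\<forall>i<n. v $ i = 0" by (subst (asm) sum_nonneg_eq_0_iff) auto
      then have "v = 0\<^sub>v n" using v(1) by (intro eq_vecI) auto
      then show False using v(2) by simp
    qed
    moreover have "0 \<le> (\<Sum>i<n. (v $ i)\<^sup>2)" by (simp add: sum_nonneg)
    ultimately show ?thesis using 0 by (simp add: zero_le_mult_iff)
  qed
  then show ?thesis using that es by blast
qed

lemma corr_det_nonneg:
  assumes "w \<in> corr_body n"
  shows "0 \<le> corr_det n w"
proof -
  obtain es where es: "length es = n" "char_poly (corr_mat n w) = (\<Prod>e\<leftarrow>es. [:- e, 1:])" "\<And>e. e \<in> set es \<Longrightarrow> 0 \<le> e"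
    using corr_mat_eigenvalues[OF assms] by blast
  obtain B P Q where s: "schur_decomposition (corr_mat n w) es = (B, P, Q)"
    by (cases "schur_decomposition (corr_mat n w) es") auto
  from schur_decomposition[OF corr_mat_carrier es(2) s] have B: "similar_mat_wit (corr_mat n w) B P Q"
    "upper_triangular B" "diag_mat B = es" by auto
  have "B \<in> carrier_mat n n" using similar_mat_witD2[OF corr_mat_carrier B(1)] by auto
  then have "det B = prod_list es" using B by (simp add: det_upper_triangular)
  moreover have "similar_mat (corr_mat n w) B" using B(1) by (auto simp: similar_mat_def)
  ultimately have "corr_det n w = prod_list es" unfolding corr_det_def using det_similar by metis
  also have "\<dots> \<ge> 0" using es(3) by (induction es) auto
  finally show ?thesis .
qed

section \<open>The quadratic form and changes of a single entry\<close>

lemma bil_commute: "bil n w u v = bil n w v u"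
proof -
  have "bil n w u v = (\<Sum>j<n. \<Sum>i<n. u i * entry w i j * v j)"
    unfolding bil_def by (rule sum.swap)
  also have "\<dots> = bil n w v u"
    unfolding bil_def by (intro sum.cong refl) (metis entry_sym mult.assoc mult.commute)
  finally show ?thesis .
qed

lemma bil_quad_expand:
  "bil n w (\<lambda>i. u i + s * v i) (\<lambda>i. u i + s * v i) = bil n w u u + 2 * s * bil n w u v + s\<^sup>2 * bil n w v v"
proof -
  have "bil n w (\<lambda>i. u i + s * v i) (\<lambda>i. u i + s * v i) =
    bil n w u u + s * bil n w u v + s * bil n w v u + s\<^sup>2 * bil n w v v"
    unfolding bil_def sum_distrib_left sum.distrib[symmetric]
    by (intro sum.cong refl) (simp add: algebra_simps power2_eq_square)
  then show ?thesis by (simp add: bil_commute[of n w v u])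
qed

lemma bil_delta:
  assumes "a < n"
  shows "bil n w (\<lambda>i. if i = a then 1 else 0) v = (\<Sum>j<n. entry w a j * v j)"
proof -
  have "bil n w (\<lambda>i. if i = a then 1 else 0) v = (\<Sum>i<n. if i = a then (\<Sum>j<n. entry w a j * v j) else 0)"
    unfolding bil_def by (intro sum.cong refl) auto
  then show ?thesis using assms by simp
qed

lemma bil_delta2:
  assumes "a < n" "b < n"
  shows "bil n w (\<lambda>i. if i = a then 1 else 0) (\<lambda>i. if i = b then 1 else 0) = entry w a b"
  using assms by (simp add: bil_delta if_distrib[of "\<lambda>x. _ * x"] cong: if_cong)

text \<open>Testing the form on the sum and on the difference of two unit vectors gives
  \<open>2 + 2 * entry w a b \<ge> 0\<close> and \<open>2 - 2 * entry w a b \<ge> 0\<close>.\<close>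

lemma corr_body_entry_le:
  assumes "w \<in> corr_body n" "a < n" "b < n"
  shows "\<bar>entry w a b\<bar> \<le> 1"
proof -
  have "0 \<le> 1 + 2 * s * entry w a b + s\<^sup>2 * 1" for s
  proof -
    let ?u = "\<lambda>i::nat. if i = a then 1 else 0 :: real" and ?v = "\<lambda>i::nat. if i = b then 1 else 0 :: real"
    have "0 \<le> bil n w (\<lambda>i. ?u i + s * ?v i) (\<lambda>i. ?u i + s * ?v i)"
      using assms(1) by (simp add: corr_body_def)
    also have "\<dots> = 1 + 2 * s * entry w a b + s\<^sup>2 * 1"
      unfolding bil_quad_expand using assms(2,3) by (simp add: bil_delta2)
    finally show ?thesis .
  qed
  from this[of 1] this[of "-1"] show ?thesis by simp
qed

lemma corr_body_box:
  assumes "w \<in> corr_body n" "e \<in> upper_indices n"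
  shows "\<bar>w e\<bar> \<le> 1"
proof -
  obtain a b where e: "e = (a, b)" "a < b" "b < n" using assms(2) by (auto simp: upper_indices_def)
  then show ?thesis using corr_body_entry_le[OF assms(1), of a b] by (simp add: entry_def)
qed

lemma entry_upd:
  assumes "a < b"
  shows "entry (w((a, b) := t)) i j =
    entry w i j + (t - w (a, b)) * ((if i = a \<and> j = b then 1 else 0) + (if i = b \<and> j = a then 1 else 0))"
proof -
  consider "i = j" | "i < j" | "j < i" by linarith
  then show ?thesis
    by cases (use assms in \<open>auto simp: entry_def\<close>)
qed

text \<open>The form is affine in each single coordinate. This makes the fibres of the body convex
  and quantifies the effect of a small perturbation.\<close>

lemma bil_upd:
  assumes "a < b" "b < n"
  shows "bil n (w((a, b) := t)) v v = bil n w v v + 2 * (t - w (a, b)) * (v a * v b)"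
proof -
  have s: "(\<Sum>i<n. \<Sum>j<n. if i = c \<and> j = d then x else 0) = x" if "c < n" "d < n" for c d and x :: real
  proof -
    have "(\<Sum>i<n. \<Sum>j<n. if i = c \<and> j = d then x else 0) = (\<Sum>i<n. if i = c then x else 0)"
      using that by (intro sum.cong refl) auto
    then show ?thesis using that by simp
  qed
  have "bil n (w((a, b) := t)) v v = (\<Sum>i<n. \<Sum>j<n. v i * entry w i j * v j +
      ((if i = a \<and> j = b then (t - w (a, b)) * (v a * v b) else 0) + (if i = b \<and> j = a then (t - w (a, b)) * (v a * v b) else 0)))"
    unfolding bil_def
  proof (intro sum.cong refl)
    fix i j
    consider "i = a" "j = b" | "i = b" "j = a" | "\<not> (i = a \<and> j = b)" "\<not> (i = b \<and> j = a)" by blast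
    then show "v i * entry (w((a, b) := t)) i j * v j = v i * entry w i j * v j +
      ((if i = a \<and> j = b then (t - w (a, b)) * (v a * v b) else 0) + (if i = b \<and> j = a then (t - w (a, b)) * (v a * v b) else 0))"
      unfolding entry_upd[OF assms(1)]
      by cases (use assms in \<open>auto simp: distrib_left distrib_right mult_ac\<close>)
  qed
  also have "\<dots> = bil n w v v + ((t - w (a, b)) * (v a * v b) + (t - w (a, b)) * (v a * v b))"
    unfolding bil_def sum.distrib using s[of a b] s[of b a] assms by simp
  finally show ?thesis by simp
qed

text \<open>With \<open>x\<close> a column of the inverse matrix, the Cauchy--Schwarz inequality bounds \<open>(v a)\<^sup>2\<close>
  by a multiple of the quadratic form, which therefore absorbs small changes of an entry.\<close>

lemma corr_body_coercive:
  assumes "w \<in> corr_body n" "corr_det n w \<noteq> 0" "a < n"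
  obtains c where "c > 0" "\<And>v. (v a)\<^sup>2 \<le> c * bil n w v v"
proof -
  define x where "x = (\<lambda>i. adj_mat (corr_mat n w) $$ (i, a) / corr_det n w)"
  have x: "(\<Sum>k<n. entry w i k * x k) = (if i = a then 1 else 0)" if "i < n" for i
  proof -
    have "(corr_mat n w * adj_mat (corr_mat n w)) $$ (i, a) = (\<Sum>k<n. entry w i k * adj_mat (corr_mat n w) $$ (k, a))"
      using that assms(3) carrier_matD[OF adj_mat(1)[OF corr_mat_carrier, of n w]]
        carrier_matD[OF corr_mat_carrier, of n w]
      by (simp add: scalar_prod_def lessThan_atLeast0)
    then have "(\<Sum>k<n. entry w i k * adj_mat (corr_mat n w) $$ (k, a)) = (if i = a then corr_det n w else 0)"
      using adj_mat(2)[OF corr_mat_carrier, of n w] that assms(3) by (cases "i = a") (auto simp: corr_det_def)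
    then show ?thesis using assms(2)
      by (simp add: x_def sum_divide_distrib[symmetric])
  qed
  have vx: "bil n w v x = v a" for v
  proof -
    have "bil n w v x = (\<Sum>i<n. v i * (\<Sum>j<n. entry w i j * x j))"
      by (simp add: bil_def sum_distrib_left mult.assoc)
    also have "\<dots> = (\<Sum>i<n. if i = a then v a else 0)" using x by (intro sum.cong) auto
    finally show ?thesis using assms(3) by simp
  qed
  have pos: "0 \<le> bil n w v v" for v using assms(1) by (simp add: corr_body_def)
  \<comment> \<open>The summand 1 makes \<open>c\<close> strictly positive, so that division by it
    is possible.\<close>
  define c where "c = bil n w x x + 1"
  have c: "c > 0" using pos[of x] by (simp add: c_def)
  have "(v a)\<^sup>2 \<le> c * bil n w v v" for v
  proof -
    \<comment> \<open>The minimizer of the quadratic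
      \<open>bil n w v v + 2 * s * v a + s\<^sup>2 * c\<close> in \<open>s\<close>.\<close>
    define s where "s = - v a / c"
    have "0 \<le> bil n w v v + 2 * s * v a + s\<^sup>2 * bil n w x x"
      using pos[of "\<lambda>i. v i + s * x i"] unfolding bil_quad_expand vx .
    also have "\<dots> \<le> bil n w v v + 2 * s * v a + s\<^sup>2 * c"
      unfolding c_def by (simp add: distrib_left)
    also have "\<dots> = bil n w v v - (v a)\<^sup>2 / c"
      unfolding s_def using c by (simp add: power2_eq_square)
    finally show ?thesis using c by (simp add: field_simps)
  qed
  then show ?thesis using that c by blast
qed

lemma fun_upd_in_extensional:
  assumes "w \<in> extensional I" "e \<in> I"
  shows "w(e := t) \<in> extensional I"
  using assms by (auto simp: extensional_def)

text \<open>Changing the entry \<open>(a, b)\<close> alters the form by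
  \<open>2 * (t - w e) * (v a * v b)\<close>. Coercivity bounds
  \<open>2 * \<bar>v a * v b\<bar>\<close> by \<open>c + d\<close> times the form, which dictates
  the radius \<open>1 / (c + d)\<close>.\<close>

lemma corr_body_perturb:
  assumes "w \<in> corr_body n" "corr_det n w \<noteq> 0" "e \<in> upper_indices n"
  obtains \<eta> where "\<eta> > 0" "\<And>t. \<bar>t - w e\<bar> \<le> \<eta> \<Longrightarrow> w(e := t) \<in> corr_body n"
proof -
  obtain a b where e: "e = (a, b)" "a < b" "b < n" using assms(3) by (auto simp: upper_indices_def)
  obtain c where c: "c > 0" "\<And>v. (v a)\<^sup>2 \<le> c * bil n w v v"
    using corr_body_coercive[OF assms(1,2), of a] e by auto
  obtain d where d: "d > 0" "\<And>v. (v b)\<^sup>2 \<le> d * bil n w v v"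
    using corr_body_coercive[OF assms(1,2), of b] e by auto
  define \<eta> where "\<eta> = 1 / (c + d)"
  have "w(e := t) \<in> corr_body n" if t: "\<bar>t - w e\<bar> \<le> \<eta>" for t
  proof -
    have "0 \<le> bil n (w(e := t)) v v" for v
    proof -
      have "2 * \<bar>v a * v b\<bar> \<le> (v a)\<^sup>2 + (v b)\<^sup>2"
        using sum_squares_bound[of "\<bar>v a\<bar>" "\<bar>v b\<bar>"] by (simp add: abs_mult)
      also have "\<dots> \<le> (c + d) * bil n w v v" using c(2)[of v] d(2)[of v] by (simp add: distrib_right)
      finally have "2 * \<bar>v a * v b\<bar> \<le> (c + d) * bil n w v v" .
      then have "\<eta> * (2 * \<bar>v a * v b\<bar>) \<le> \<eta> * ((c + d) * bil n w v v)"
        using c d by (intro mult_left_mono) (auto simp: \<eta>_def)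
      then have 1: "\<eta> * (2 * \<bar>v a * v b\<bar>) \<le> bil n w v v" using c d by (simp add: \<eta>_def)
      have "\<bar>2 * (t - w e) * (v a * v b)\<bar> = \<bar>t - w e\<bar> * (2 * \<bar>v a * v b\<bar>)"
        by (simp only: abs_mult abs_numeral mult_ac)
      also have "\<dots> \<le> \<eta> * (2 * \<bar>v a * v b\<bar>)" using t by (intro mult_right_mono) auto
      finally have "\<bar>2 * (t - w e) * (v a * v b)\<bar> \<le> bil n w v v" using 1 by linarith
      then show ?thesis unfolding e(1) bil_upd[OF e(2,3)] by (auto simp: e(1) abs_le_iff)
    qed
    then show ?thesis using assms(1,3) by (auto simp: corr_body_def extensional_def)
  qed
  moreover have "\<eta> > 0" using c d by (simp add: \<eta>_def)
  ultimately show ?thesis using that by blast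
qed

text \<open>By affinity the fibre is an intersection of closed convex sets, and it lies in
  \<open>[-1, 1]\<close>; so it is a compact interval. A nonzero determinant at an endpoint would
  allow a step beyond it, by \<open>corr_body_perturb\<close>.\<close>

lemma corr_body_fiber:
  assumes K: "w(e := s) \<in> corr_body n" and e: "e \<in> upper_indices n"
  shows "\<exists>a b. a \<le> b \<and> {t. w(e := t) \<in> corr_body n} = {a..b} \<and>
    corr_det n (w(e := a)) = 0 \<and> corr_det n (w(e := b)) = 0"
proof -
  obtain k l where kl: "e = (k, l)" "k < l" "l < n" using e by (auto simp: upper_indices_def)
  let ?S = "{t. w(e := t) \<in> corr_body n}"
  have "w(e := t) \<in> extensional (upper_indices n)" for t
  proof -
    show ?thesis
      using fun_upd_in_extensional[of "w(e := s)" "upper_indices n" e t] K e by (simp add: corr_body_def)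
  qed
  then have "w(e := t) \<in> corr_body n \<longleftrightarrow> (\<forall>v. 0 \<le> bil n w v v + 2 * (t - w e) * (v k * v l))" for t
    unfolding corr_body_def mem_Collect_eq unfolding kl(1) bil_upd[OF kl(2,3)] by metis
  then have S: "?S = (\<Inter>v. {t. 0 \<le> bil n w v v + 2 * (t - w e) * (v k * v l)})" by auto
  have "closed {t. 0 \<le> bil n w v v + 2 * (t - w e) * (v k * v l)}" for v
    by (intro closed_Collect_le continuous_intros)
  then have cl: "closed ?S" unfolding S by (intro closed_INT) auto
  have bd: "t \<in> {-1..1}" if "t \<in> ?S" for t using corr_body_box[of "w(e := t)" n e] that e by auto
  then have "bounded ?S" by (meson bounded_closed_interval bounded_subset subsetI)
  with cl have comp: "compact ?S" by (simp add: compact_eq_bounded_closed)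
  have "connected ?S"
  proof (rule connectedI_interval)
    fix x y z assume xy: "x \<in> ?S" "y \<in> ?S" "x \<le> z" "z \<le> y"
    show "z \<in> ?S"
      unfolding S
    proof (intro INT_I CollectI)
      fix v
      let ?q = "\<lambda>t. bil n w v v + 2 * (t - w e) * (v k * v l)"
      have q: "0 \<le> ?q x" "0 \<le> ?q y" using xy(1,2) unfolding S by auto
      show "0 \<le> ?q z"
      proof (cases "0 \<le> v k * v l")
        case True
        then have "(x - w e) * (v k * v l) \<le> (z - w e) * (v k * v l)" using xy by (intro mult_right_mono) auto
        then show ?thesis using q by linarith
      next
        case False
        then have "(y - w e) * (v k * v l) \<le> (z - w e) * (v k * v l)" using xy by (intro mult_right_mono_neg) auto
        then show ?thesis using q by linarith
      qed
    qed
  qed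
  then obtain a b where ab: "?S = {a..b}" using comp connected_compact_interval_1[of ?S] by auto
  moreover have "s \<in> ?S" using K by simp
  ultimately have le: "a \<le> b" by auto
  have end_det: "corr_det n (w(e := t)) = 0" if t: "t \<in> ?S" "\<And>\<eta>. \<eta> > 0 \<Longrightarrow> \<exists>r. \<bar>r - t\<bar> \<le> \<eta> \<and> r \<notin> ?S" for t
  proof (rule ccontr)
    assume "corr_det n (w(e := t)) \<noteq> 0"
    then obtain \<eta> where "\<eta> > 0" "\<And>r. \<bar>r - t\<bar> \<le> \<eta> \<Longrightarrow> w(e := t, e := r) \<in> corr_body n"
      using corr_body_perturb[of "w(e := t)" n e] t(1) e by auto
    then show False using t(2)[of \<eta>] by auto
  qed
  have "corr_det n (w(e := a)) = 0"
  proof (rule end_det)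
    fix \<eta> :: real assume "\<eta> > 0"
    then show "\<exists>r. \<bar>r - a\<bar> \<le> \<eta> \<and> r \<notin> ?S" unfolding ab by (intro exI[of _ "a - \<eta>"]) auto
  qed (use ab le in auto)
  moreover have "corr_det n (w(e := b)) = 0"
  proof (rule end_det)
    fix \<eta> :: real assume "\<eta> > 0"
    then show "\<exists>r. \<bar>r - b\<bar> \<le> \<eta> \<and> r \<notin> ?S" unfolding ab by (intro exI[of _ "b + \<eta>"]) auto
  qed (use ab le in auto)
  ultimately show ?thesis using ab le by blast
qed

section \<open>Polynomiality of the determinant, measurability of the body\<close>

lemma poly_fun_entry:
  assumes "i < n" "j < n"
  shows "poly_fun (upper_indices n) (\<lambda>w. entry w i j)"
proof -
  consider "i = j" | "i < j" "(i, j) \<in> upper_indices n" | "j < i" "(j, i) \<in> upper_indices n"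
    using assms by (fastforce simp: upper_indices_def)
  then show ?thesis by cases (simp_all add: entry_def poly_fun_const poly_fun_coord)
qed

lemma corr_det_leibniz:
  "corr_det n w = (\<Sum>p | p permutes {0..<n}. signof p * (\<Prod>i<n. entry w i (p i)))"
proof -
  have "corr_det n w = (\<Sum>p | p permutes {0..<n}. signof p * (\<Prod>i=0..<n. corr_mat n w $$ (i, p i)))"
    unfolding corr_det_def by (rule det_def') simp
  also have "\<dots> = (\<Sum>p | p permutes {0..<n}. signof p * (\<Prod>i<n. entry w i (p i)))"
  proof (intro sum.cong refl arg_cong2[where f = "(*)"])
    fix p assume "p \<in> {p. p permutes {0..<n}}"
    then have "p i < n" if "i < n" for i using that permutes_in_image[of p "{0..<n}" i] by auto
    then show "(\<Prod>i=0..<n. corr_mat n w $$ (i, p i)) = (\<Prod>i<n. entry w i (p i))"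
      by (intro prod.cong) (auto simp: lessThan_atLeast0)
  qed
  finally show ?thesis .
qed

lemma poly_fun_corr_det: "poly_fun (upper_indices n) (corr_det n)"
proof -
  have "poly_fun (upper_indices n) (\<lambda>w. \<Sum>p | p permutes {0..<n}. signof p * (\<Prod>i<n. entry w i (p i)))"
  proof (intro poly_fun_sum poly_fun_mult poly_fun_const poly_fun_prod poly_fun_entry)
    fix p i assume "p \<in> {p. p permutes {0..<n}}" "i \<in> {..<n}"
    then show "p i < n" using permutes_in_image[of p "{0..<n}" i] by auto
  qed auto
  then show ?thesis unfolding corr_det_leibniz[symmetric] by (simp add: eta_contract_eq)
qed

text \<open>Semidefiniteness is an uncountable family of conditions. By continuity of the form it is
  enough to test vectors with rational entries, of which there are countably many once they are made
  extensional on \<open>{..<n}\<close>.\<close>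

lemma sets_corr_body: "corr_body n \<in> sets (PiM (upper_indices n) (\<lambda>_. lborel))"
proof -
  let ?P = "PiM (upper_indices n) (\<lambda>_. lborel :: real measure)"
  let ?V = "{..<n} \<rightarrow>\<^sub>E \<rat> :: (nat \<Rightarrow> real) set"
  have [measurable]: "(\<lambda>w. bil n w v v) \<in> borel_measurable ?P" for v
    unfolding bil_def by (intro poly_fun_measurable poly_fun_sum poly_fun_mult poly_fun_const poly_fun_entry) auto
  have cV: "countable ?V" by (intro countable_PiE countable_rat) auto
  have "corr_body n = {w \<in> space ?P. \<forall>v\<in>?V. 0 \<le> bil n w v v}"
  proof (intro equalityI subsetI)
    fix w assume w: "w \<in> {w \<in> space ?P. \<forall>v\<in>?V. 0 \<le> bil n w v v}"
    have "0 \<le> bil n w v v" for v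
    proof -
      have "\<exists>X. (\<forall>m. X m \<in> \<rat>) \<and> X \<longlonglongrightarrow> v i" for i
        using closure_sequential[of "v i" "\<rat>"] Rats_closure_real by auto
      then obtain X where X: "\<And>i m. X i m \<in> \<rat>" "\<And>i. X i \<longlonglongrightarrow> v i" by metis
      have "(\<lambda>m. bil n w (\<lambda>i. X i m) (\<lambda>i. X i m)) \<longlonglongrightarrow> bil n w v v"
        unfolding bil_def by (intro tendsto_intros X)
      moreover have "0 \<le> bil n w (\<lambda>i. X i m) (\<lambda>i. X i m)" for m
      proof -
        have "restrict (\<lambda>i. X i m) {..<n} \<in> ?V" using X by auto
        then have "0 \<le> bil n w (restrict (\<lambda>i. X i m) {..<n}) (restrict (\<lambda>i. X i m) {..<n})" using w by blast
        also have "\<dots> = bil n w (\<lambda>i. X i m) (\<lambda>i. X i m)" by (simp add: bil_def)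
        finally show ?thesis .
      qed
      ultimately show ?thesis by (intro LIMSEQ_le_const) auto
    qed
    then show "w \<in> corr_body n" using w by (auto simp: corr_body_def space_PiM PiE_def)
  qed (auto simp: corr_body_def space_PiM PiE_def)
  also have "\<dots> \<in> sets ?P"
    by (intro sets.sets_Collect_countable_All' cV) measurable
  finally show ?thesis .
qed

lemma corr_det_zero: "corr_det n (\<lambda>_. 0) = 1"
proof -
  have "corr_mat n (\<lambda>_. 0) = 1\<^sub>m n" by (rule eq_matI) (auto simp: corr_mat_def entry_def)
  then show ?thesis by (simp add: corr_det_def)
qed

text \<open>The point where the determinant is nonzero has all coordinates 0, that is, it represents
  the identity matrix.\<close>

interpretation corr: poly_body "upper_indices n" "corr_body n" "corr_det n" "\<lambda>_. 0" for n
proof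
  show "corr_det n (\<lambda>_. 0) \<noteq> 0" by (simp add: corr_det_zero)
qed (fact finite_upper_indices poly_fun_corr_det corr_det_nonneg sets_corr_body corr_body_box corr_body_fiber)+

subsection \<open>Integration by parts and the loop equation\<close>

definition coord_pair :: "nat \<Rightarrow> nat \<Rightarrow> nat \<times> nat" where
  "coord_pair i k = (min i k, max i k)"

text \<open>If \<open>entry w i k\<close> is the inner product of unit vectors \<open>u i\<close> and \<open>u k\<close>, this is its rate of
  change as \<open>u i\<close> moves on the sphere with velocity \<open>u j - entry w i j u i\<close>. The motion preserves
  the set of correlation matrices.\<close>

definition velocity :: "(nat \<times> nat \<Rightarrow> real) \<Rightarrow> nat \<Rightarrow> nat \<Rightarrow> nat \<Rightarrow> real" where
  "velocity w i j k = entry w j k - entry w i j * entry w i k"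

text \<open>Moving the \<open>i\<close>-th vector changes only row and column \<open>i\<close>. The
  index \<open>k = i\<close> is left out because the diagonal entry is no coordinate.\<close>

definition lie :: "nat \<Rightarrow> nat \<Rightarrow> nat \<Rightarrow> ((nat \<times> nat \<Rightarrow> real) \<Rightarrow> real) \<Rightarrow> (nat \<times> nat \<Rightarrow> real) \<Rightarrow> real" where
  "lie n i j f w = (\<Sum>k\<in>{..<n} - {i}. velocity w i j k * partial (coord_pair i k) f w)"

abbreviation poly_corr where "poly_corr n \<equiv> poly_fun (upper_indices n)"

lemma coord_pair_upper: "i < n \<Longrightarrow> k < n \<Longrightarrow> k \<noteq> i \<Longrightarrow> coord_pair i k \<in> upper_indices n"
  by (auto simp: coord_pair_def upper_indices_def min_def max_def)

lemma inj_coord_pair: "inj_on (coord_pair i) A"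
  by (auto simp: inj_on_def coord_pair_def min_def max_def split: if_splits)

lemma partial_entry:
  assumes "k \<noteq> i"
  shows "partial (coord_pair i k) (\<lambda>w. entry w a b) w = (if a = i \<and> b = k \<or> a = k \<and> b = i then 1 else 0)"
proof -
  consider "a = b" | "a < b" | "b < a" by linarith
  then show ?thesis
  proof cases
    case 1 then show ?thesis using assms by (auto simp: entry_def partial_const)
  next
    case 2 then show ?thesis using assms by (auto simp: entry_def partial_coord coord_pair_def min_def max_def)
  next
    case 3 then show ?thesis using assms by (auto simp: entry_def partial_coord coord_pair_def min_def max_def)
  qed
qed

lemma velocity_self [simp]: "velocity w i j i = 0"
  by (simp add: velocity_def entry_sym)

section \<open>Calculus of the directional derivative\<close>

lemma lie_const: "lie n i j (\<lambda>w. c) w = 0"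
  by (simp add: lie_def partial_const)

lemma lie_add:
  assumes "poly_corr n f" "poly_corr n g"
  shows "lie n i j (\<lambda>w. f w + g w) w = lie n i j f w + lie n i j g w"
  by (simp add: lie_def partial_add[OF assms] distrib_left sum.distrib)

lemma lie_mult:
  assumes "poly_corr n f" "poly_corr n g"
  shows "lie n i j (\<lambda>w. f w * g w) w = lie n i j f w * g w + f w * lie n i j g w"
  by (simp add: lie_def partial_mult[OF assms] distrib_left sum.distrib sum_distrib_left sum_distrib_right mult_ac)

lemma lie_cmult:
  assumes "poly_corr n f"
  shows "lie n i j (\<lambda>w. c * f w) w = c * lie n i j f w"
  using lie_mult[OF poly_fun_const assms, of i j c w] by (simp add: lie_const)

lemma lie_sum:
  assumes "\<And>a. a \<in> A \<Longrightarrow> poly_corr n (f a)"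
  shows "lie n i j (\<lambda>w. \<Sum>a\<in>A. f a w) w = (\<Sum>a\<in>A. lie n i j (f a) w)"
  using assms
proof (induction A rule: infinite_finite_induct)
  case (insert a A)
  have "lie n i j (\<lambda>w. f a w + (\<Sum>a\<in>A. f a w)) w = lie n i j (f a) w + lie n i j (\<lambda>w. \<Sum>a\<in>A. f a w) w"
    using insert.prems by (intro lie_add poly_fun_sum) auto
  then show ?case using insert by simp
qed (simp_all add: lie_const)

lemma lie_prod:
  assumes "finite A" "\<And>a. a \<in> A \<Longrightarrow> poly_corr n (f a)"
  shows "lie n i j (\<lambda>w. \<Prod>a\<in>A. f a w) w = (\<Sum>a\<in>A. lie n i j (f a) w * (\<Prod>b\<in>A - {a}. f b w))"
  using assms
proof (induction A rule: finite_induct)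
  case (insert a A)
  have "lie n i j (\<lambda>w. f a w * (\<Prod>a\<in>A. f a w)) w =
      lie n i j (f a) w * (\<Prod>a\<in>A. f a w) + f a w * lie n i j (\<lambda>w. \<Prod>a\<in>A. f a w) w"
    using insert.prems by (intro lie_mult poly_fun_prod) auto
  also have "lie n i j (\<lambda>w. \<Prod>a\<in>A. f a w) w = (\<Sum>c\<in>A. lie n i j (f c) w * (\<Prod>b\<in>A - {c}. f b w))"
    using insert by auto
  also have "f a w * \<dots> = (\<Sum>c\<in>A. lie n i j (f c) w * (\<Prod>b\<in>insert a A - {c}. f b w))"
    unfolding sum_distrib_left
  proof (intro sum.cong refl)
    fix c assume c: "c \<in> A"
    then have "insert a A - {c} = insert a (A - {c})" using insert.hyps by auto
    then show "f a w * (lie n i j (f c) w * (\<Prod>b\<in>A - {c}. f b w)) = lie n i j (f c) w * (\<Prod>b\<in>insert a A - {c}. f b w)"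
      using insert.hyps by simp
  qed
  finally show ?case using insert.hyps by (simp add: insert_Diff_if)
qed (simp add: lie_const)

text \<open>For \<open>a = b = i\<close> both terms are zero by \<open>velocity_self\<close>, in
  agreement with the constant diagonal.\<close>

lemma lie_entry:
  assumes "a < n" "b < n" "i < n"
  shows "lie n i j (\<lambda>w. entry w a b) w = (if a = i then velocity w i j b else 0) + (if b = i then velocity w i j a else 0)"
proof -
  have "lie n i j (\<lambda>w. entry w a b) w = (\<Sum>k\<in>{..<n} - {i}. if a = i \<and> b = k \<or> a = k \<and> b = i then velocity w i j k else 0)"
    unfolding lie_def by (intro sum.cong refl) (auto simp: partial_entry)
  also have "\<dots> = (\<Sum>k\<in>{..<n} - {i}. (if a = i then if k = b then velocity w i j k else 0 else 0) + (if b = i then if k = a then velocity w i j k else 0 else 0))"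
    by (intro sum.cong refl) auto
  also have "\<dots> = (if a = i then if b = i then 0 else velocity w i j b else 0) + (if b = i then if a = i then 0 else velocity w i j a else 0)"
    using assms by (auto simp: sum.distrib)
  finally show ?thesis by auto
qed

text \<open>Jacobi's formula, applied to the velocity of the matrix along the field.\<close>

lemma lie_corr_det:
  assumes "i < n" "j < n" "i \<noteq> j"
  shows "lie n i j (corr_det n) w = - 2 * entry w i j * corr_det n w"
proof -
  let ?C = "corr_mat n w"
  let ?S = "{p. p permutes {0..<n}}"
  let ?h = "\<lambda>k. velocity w i j k"
  define l where "l = (\<lambda>r c. lie n i j (\<lambda>w. entry w r c) w)"
  have pn: "p r < n" if "p \<in> ?S" "r < n" for p r using that permutes_in_image[of p "{0..<n}" r] by auto
  have pf: "poly_corr n (\<lambda>w. \<Prod>r<n. entry w r (p r))" if "p \<in> ?S" for p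
    using pn[OF that] by (intro poly_fun_prod poly_fun_entry) auto
  have "corr_det n = (\<lambda>w. \<Sum>p\<in>?S. signof p * (\<Prod>r<n. entry w r (p r)))"
    by (rule ext) (rule corr_det_leibniz)
  then have "lie n i j (corr_det n) w = lie n i j (\<lambda>w. \<Sum>p\<in>?S. signof p * (\<Prod>r<n. entry w r (p r))) w" by simp
  also have "\<dots> = (\<Sum>p\<in>?S. lie n i j (\<lambda>w. signof p * (\<Prod>r<n. entry w r (p r))) w)"
    using pf by (intro lie_sum poly_fun_mult poly_fun_const) auto
  also have "\<dots> = (\<Sum>p\<in>?S. signof p * (\<Sum>r<n. l r (p r) * (\<Prod>s\<in>{..<n} - {r}. entry w s (p s))))"
  proof (intro sum.cong refl)
    fix p assume p: "p \<in> ?S"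
    show "lie n i j (\<lambda>w. signof p * (\<Prod>r<n. entry w r (p r))) w =
        signof p * (\<Sum>r<n. l r (p r) * (\<Prod>s\<in>{..<n} - {r}. entry w s (p s)))"
      unfolding lie_cmult[OF pf[OF p]] l_def using pn[OF p]
      by (subst lie_prod) (auto intro: poly_fun_entry)
  qed
  also have "\<dots> = (\<Sum>r<n. \<Sum>p\<in>?S. signof p * (l r (p r) * (\<Prod>s\<in>{..<n} - {r}. entry w s (p s))))"
    unfolding sum_distrib_left by (rule sum.swap)
  also have "\<dots> = (\<Sum>r<n. \<Sum>c<n. l r c * cofactor ?C r c)"
  proof (intro sum.cong refl)
    fix r assume "r \<in> {..<n}"
    then have r: "r < n" by simp
    \<comment> \<open>Replacing row \<open>r\<close> by its derivative turns the part of the Leibniz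
      sum in which row \<open>r\<close> is differentiated into a determinant, which is then expanded
      along that row.\<close>
    define R where "R = mat n n (\<lambda>(s, c). if s = r then l r c else entry w s c)"
    have R: "R \<in> carrier_mat n n" by (simp add: R_def)
    have cof: "cofactor R r c = cofactor ?C r c" if "c < n" for c
    proof -
      have "mat_delete R r c = mat_delete ?C r c"
        using r that by (intro eq_matI) (auto simp: mat_delete_def R_def corr_mat_def)
      then show ?thesis by (simp add: cofactor_def)
    qed
    have "(\<Sum>p\<in>?S. signof p * (l r (p r) * (\<Prod>s\<in>{..<n} - {r}. entry w s (p s)))) =
        (\<Sum>p\<in>?S. signof p * (\<Prod>s=0..<n. R $$ (s, p s)))"
    proof (intro sum.cong refl arg_cong2[where f = "(*)"])
      fix p assume p: "p \<in> ?S"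
      have "(\<Prod>s=0..<n. R $$ (s, p s)) = R $$ (r, p r) * (\<Prod>s\<in>{0..<n} - {r}. R $$ (s, p s))"
        using r by (subst prod.remove[of _ r]) auto
      also have "(\<Prod>s\<in>{0..<n} - {r}. R $$ (s, p s)) = (\<Prod>s\<in>{..<n} - {r}. entry w s (p s))"
        using pn[OF p] by (intro prod.cong) (auto simp: R_def)
      also have "R $$ (r, p r) = l r (p r)" using r pn[OF p] by (simp add: R_def)
      finally show "l r (p r) * (\<Prod>s\<in>{..<n} - {r}. entry w s (p s)) = (\<Prod>s=0..<n. R $$ (s, p s))" by simp
    qed
    also have "\<dots> = det R" by (rule det_def'[OF R, symmetric])
    also have "\<dots> = (\<Sum>c<n. R $$ (r, c) * cofactor R r c)" by (rule laplace_expansion_row[OF R r])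
    also have "\<dots> = (\<Sum>c<n. l r c * cofactor ?C r c)" using r cof by (intro sum.cong) (auto simp: R_def)
    finally show "(\<Sum>p\<in>?S. signof p * (l r (p r) * (\<Prod>s\<in>{..<n} - {r}. entry w s (p s)))) = (\<Sum>c<n. l r c * cofactor ?C r c)" .
  qed
  also have "\<dots> = (\<Sum>r<n. \<Sum>c<n. (if r = i then ?h c * cofactor ?C i c else 0) + (if c = i then ?h r * cofactor ?C r i else 0))"
    using assms by (intro sum.cong refl) (auto simp: l_def lie_entry)
  also have "\<dots> = (\<Sum>c<n. ?h c * cofactor ?C i c) + (\<Sum>r<n. ?h r * cofactor ?C r i)"
  proof -
    have "(\<Sum>r<n. \<Sum>c<n. if r = i then ?h c * cofactor ?C i c else 0) = (\<Sum>r<n. if r = i then (\<Sum>c<n. ?h c * cofactor ?C i c) else 0)"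
      by (intro sum.cong refl) auto
    then show ?thesis using assms by (simp add: sum.distrib)
  qed
  \<comment> \<open>Row \<open>j\<close> paired with the cofactors of row \<open>i\<close> gives 0,
    because \<open>i \<noteq> j\<close>; only the normalizing part of the velocity, a multiple of
    row \<open>i\<close>, survives. The column sum below is treated in the same way.\<close>
  also have "(\<Sum>c<n. ?h c * cofactor ?C i c) = - entry w i j * corr_det n w"
  proof -
    have e: "(\<Sum>c<n. entry w r c * cofactor ?C i c) = (if r = i then corr_det n w else 0)" if "r < n" for r
    proof -
      have "(?C * adj_mat ?C) $$ (r, i) = (\<Sum>c<n. entry w r c * cofactor ?C i c)"
        using that assms by (simp add: adj_mat_def scalar_prod_def lessThan_atLeast0 corr_mat_def)
      then show ?thesis using adj_mat(2)[OF corr_mat_carrier, of n w] that assms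
        by (cases "r = i") (auto simp: corr_det_def)
    qed
    have "(\<Sum>c<n. ?h c * cofactor ?C i c) = (\<Sum>c<n. entry w j c * cofactor ?C i c) - entry w i j * (\<Sum>c<n. entry w i c * cofactor ?C i c)"
      by (simp add: velocity_def left_diff_distrib sum_subtractf sum_distrib_left mult.assoc)
    then show ?thesis using e[of j] e[of i] assms by simp
  qed
  also have "(\<Sum>r<n. ?h r * cofactor ?C r i) = - entry w i j * corr_det n w"
  proof -
    have e: "(\<Sum>r<n. entry w s r * cofactor ?C r i) = (if s = i then corr_det n w else 0)" if "s < n" for s
    proof -
      have "(adj_mat ?C * ?C) $$ (i, s) = (\<Sum>r<n. entry w s r * cofactor ?C r i)"
        using that assms by (simp add: adj_mat_def scalar_prod_def lessThan_atLeast0 corr_mat_def entry_sym mult.commute)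
      then show ?thesis using adj_mat(3)[OF corr_mat_carrier, of n w] that assms
        by (cases "s = i") (auto simp: corr_det_def)
    qed
    have "(\<Sum>r<n. ?h r * cofactor ?C r i) = (\<Sum>r<n. entry w j r * cofactor ?C r i) - entry w i j * (\<Sum>r<n. entry w i r * cofactor ?C r i)"
      by (simp add: velocity_def left_diff_distrib sum_subtractf sum_distrib_left mult.assoc)
    then show ?thesis using e[of j] e[of i] assms by simp
  qed
  finally show ?thesis by simp
qed

lemma poly_corr_velocity: "i < n \<Longrightarrow> j < n \<Longrightarrow> k < n \<Longrightarrow> poly_corr n (\<lambda>w. velocity w i j k)"
  unfolding velocity_def by (intro poly_fun_diff poly_fun_mult poly_fun_entry)

lemma poly_corr_lie:
  assumes "poly_corr n f" "i < n" "j < n"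
  shows "poly_corr n (lie n i j f)"
proof -
  have "poly_corr n (\<lambda>w. \<Sum>k\<in>{..<n} - {i}. velocity w i j k * partial (coord_pair i k) f w)"
    using assms by (intro poly_fun_sum poly_fun_mult poly_corr_velocity poly_fun_partial) auto
  then show ?thesis unfolding lie_def .
qed

section \<open>Integration by parts on the body\<close>

definition corr_integral :: "nat \<Rightarrow> ((nat \<times> nat \<Rightarrow> real) \<Rightarrow> real) \<Rightarrow> real" where
  "corr_integral n f = (\<integral>w. indicator (corr_body n) w * f w \<partial>PiM (upper_indices n) (\<lambda>_. lborel))"

text \<open>The divergence theorem for \<open>f\<close> times the field. Tangency to the boundary is
  \<open>lie_corr_det\<close>.\<close>

lemma corr_integral_parts:
  assumes ij: "i < n" "j < n" "i \<noteq> j" and f: "poly_corr n f"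
  shows "corr_integral n (\<lambda>w. lie n i j f w - real n * entry w i j * f w) = 0"
proof -
  let ?B = "{..<n} - {i}"
  \<comment> \<open>The divergence theorem indexes components by coordinates; the conditional
    recovers from the pair \<open>e\<close> the index other than \<open>i\<close>.\<close>
  define V where "V = (\<lambda>e w. velocity w i j (if fst e = i then snd e else fst e) * f w)"
  have V: "V (coord_pair i k) = (\<lambda>w. velocity w i j k * f w)" for k
    by (auto simp: V_def coord_pair_def min_def max_def fun_eq_iff)
  have S: "(\<Sum>e\<in>coord_pair i ` ?B. g e) = (\<Sum>k\<in>?B. g (coord_pair i k))" for g :: "nat \<times> nat \<Rightarrow> real"
    by (simp add: sum.reindex[OF inj_coord_pair] o_def)
  have fe: "poly_corr n (\<lambda>w. velocity w i j k * f w)" if "k < n" for k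
    using that ij f by (intro poly_fun_mult poly_corr_velocity)
  have zero: "corr_integral n (\<lambda>w. \<Sum>e\<in>coord_pair i ` ?B. partial e (V e) w) = 0"
    unfolding corr_integral_def
  proof (rule corr.divergence_integral_zero[where lam = "\<lambda>w. - 2 * entry w i j * f w"])
    show "coord_pair i ` ?B \<subseteq> upper_indices n" using coord_pair_upper[OF ij(1)] by blast
    show "poly_corr n (V e)" if "e \<in> coord_pair i ` ?B" for e using that fe V by auto
    show "poly_corr n (\<lambda>w. - 2 * entry w i j * f w)"
      using ij f by (intro poly_fun_mult poly_fun_const poly_fun_entry)
    fix w
    have "(\<Sum>e\<in>coord_pair i ` ?B. V e w * partial e (corr_det n) w) = f w * lie n i j (corr_det n) w"
      unfolding S V lie_def by (simp add: sum_distrib_left mult_ac)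
    then show "(\<Sum>e\<in>coord_pair i ` ?B. V e w * partial e (corr_det n) w) = - 2 * entry w i j * f w * corr_det n w"
      by (simp add: lie_corr_det[OF ij])
  qed
  have eq: "(\<lambda>w. \<Sum>e\<in>coord_pair i ` ?B. partial e (V e) w) = (\<lambda>w. lie n i j f w - real n * entry w i j * f w)"
  proof
    fix w
    \<comment> \<open>The entry \<open>(j, k)\<close> does not depend on this coordinate, the factor
      \<open>entry w i k\<close> has derivative 1, and for \<open>k = j\<close> so does
      \<open>entry w i j\<close>. Summed over the \<open>n - 1\<close> values of \<open>k\<close>,
      with one extra contribution from \<open>k = j\<close>, this produces exactly the factor
      \<open>n\<close>.\<close>
    have pf: "partial (coord_pair i k) (\<lambda>w. velocity w i j k) w = - (if k = j then entry w i j else 0) - entry w i j" if k: "k < n" "k \<noteq> i" for k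
    proof -
      note e = partial_entry[OF k(2)]
      have "partial (coord_pair i k) (\<lambda>w. velocity w i j k) w =
        partial (coord_pair i k) (\<lambda>w. entry w j k + (- 1) * (entry w i j * entry w i k)) w"
        by (simp add: velocity_def)
      also have "\<dots> = partial (coord_pair i k) (\<lambda>w. entry w j k) w + (- 1) *
         (partial (coord_pair i k) (\<lambda>w. entry w i j) w * entry w i k + entry w i j * partial (coord_pair i k) (\<lambda>w. entry w i k) w)"
        using ij k by (simp only: partial_add[where I = "upper_indices n"] partial_mult[where I = "upper_indices n"] partial_const
            poly_fun_mult poly_fun_entry poly_fun_const)
      finally show ?thesis unfolding e using ij k by auto
    qed
    have "(\<Sum>e\<in>coord_pair i ` ?B. partial e (V e) w) = (\<Sum>k\<in>?B. partial (coord_pair i k) (\<lambda>w. velocity w i j k * f w) w)"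
      unfolding S V ..
    also have "\<dots> = (\<Sum>k\<in>?B. (- (if k = j then entry w i j else 0) - entry w i j) * f w + velocity w i j k * partial (coord_pair i k) f w)"
      using ij f by (intro sum.cong refl) (simp add: partial_mult[OF poly_corr_velocity f] pf)
    also have "\<dots> = lie n i j f w + (\<Sum>k\<in>?B. - (if k = j then entry w i j else 0) - entry w i j) * f w"
      unfolding lie_def sum_distrib_right by (simp add: sum.distrib)
    also have "(\<Sum>k\<in>?B. - (if k = j then entry w i j else 0) - entry w i j) = - real n * entry w i j"
      using ij by (simp add: sum_subtractf sum_negf of_nat_diff algebra_simps)
    finally show "(\<Sum>e\<in>coord_pair i ` ?B. partial e (V e) w) = lie n i j f w - real n * entry w i j * f w" by simp
  qed
  show ?thesis using zero unfolding eq .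
qed

lemma corr_integral_add:
  assumes "poly_corr n f" "poly_corr n g"
  shows "corr_integral n (\<lambda>w. f w + g w) = corr_integral n f + corr_integral n g"
  unfolding corr_integral_def
  using Bochner_Integration.integral_add[OF corr.integrable_poly_fun[OF assms(1)] corr.integrable_poly_fun[OF assms(2)]]
  by (simp add: distrib_left)

lemma corr_integral_cmult: "corr_integral n (\<lambda>w. c * f w) = c * corr_integral n f"
  unfolding corr_integral_def by (simp add: mult.left_commute)

lemma corr_integral_sum:
  assumes "\<And>a. a \<in> A \<Longrightarrow> poly_corr n (f a)"
  shows "corr_integral n (\<lambda>w. \<Sum>a\<in>A. f a w) = (\<Sum>a\<in>A. corr_integral n (f a))"
  using assms
proof (induction A rule: infinite_finite_induct)
  case (insert a A)
  have "corr_integral n (\<lambda>w. f a w + (\<Sum>a\<in>A. f a w)) = corr_integral n (f a) + corr_integral n (\<lambda>w. \<Sum>a\<in>A. f a w)"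
    using insert.prems by (intro corr_integral_add poly_fun_sum) auto
  then show ?case using insert by simp
qed (simp_all add: corr_integral_def)

lemma corr_integral_mono:
  assumes "poly_corr n f" "poly_corr n g" "\<And>w. w \<in> corr_body n \<Longrightarrow> f w \<le> g w"
  shows "corr_integral n f \<le> corr_integral n g"
  unfolding corr_integral_def
  using assms by (intro integral_mono corr.integrable_poly_fun) (auto simp: indicator_def)

section \<open>Derivatives of powers and traces\<close>

abbreviation pw :: "nat \<Rightarrow> (nat \<times> nat \<Rightarrow> real) \<Rightarrow> nat \<Rightarrow> nat \<Rightarrow> nat \<Rightarrow> real" where
  "pw n w \<equiv> mpow n (entry w)"

definition tr :: "nat \<Rightarrow> nat \<Rightarrow> (nat \<times> nat \<Rightarrow> real) \<Rightarrow> real" where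
  "tr n p w = (\<Sum>i<n. pw n w p i i)"

text \<open>The correction terms produced by the normalizing part of the velocity. They are of the
  size of a single trace, against the product of two traces in the leading term.\<close>

definition diag_prod :: "nat \<Rightarrow> nat \<Rightarrow> nat \<Rightarrow> (nat \<times> nat \<Rightarrow> real) \<Rightarrow> real" where
  "diag_prod n p q w = (\<Sum>i<n. pw n w p i i * pw n w q i i)"

lemma pw_sym: "i < n \<Longrightarrow> j < n \<Longrightarrow> pw n w p i j = pw n w p j i"
  by (rule mpow_sym) (rule entry_sym)

lemma poly_corr_pw: "i < n \<Longrightarrow> j < n \<Longrightarrow> poly_corr n (\<lambda>w. pw n w p i j)"
proof (induction p arbitrary: i)
  case (Suc p)
  then show ?case by (auto intro!: poly_fun_sum poly_fun_mult poly_fun_entry)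
qed (auto intro: poly_fun_const)

lemma poly_corr_tr: "poly_corr n (tr n p)"
  unfolding tr_def[abs_def] by (intro poly_fun_sum poly_corr_pw) auto

lemma poly_corr_diag_prod: "poly_corr n (diag_prod n p q)"
  unfolding diag_prod_def[abs_def] by (intro poly_fun_sum poly_fun_mult poly_corr_pw) auto

lemma velocity_pw:
  assumes "i < n" "b < n"
  shows "(\<Sum>c<n. velocity w i j c * pw n w q c b) = pw n w (Suc q) j b - entry w i j * pw n w (Suc q) i b"
  by (simp add: velocity_def left_diff_distrib sum_subtractf sum_distrib_left mult.assoc)

text \<open>Along the field \<open>C\<close> changes at the rate \<open>e h' + h e'\<close>, where
  \<open>e\<close> is the \<open>i\<close>-th unit vector and \<open>h\<close> the velocity. The
  product rule puts this rank-two matrix between \<open>C ^ q\<close> and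
  \<open>C ^ (p - Suc q)\<close>; applying a power to \<open>h\<close> raises its exponent by one,
  by \<open>velocity_pw\<close>.\<close>

lemma lie_pw:
  assumes "a < n" "b < n" "i < n" "j < n"
  shows "lie n i j (\<lambda>w. pw n w p a b) w =
    (\<Sum>q<p. pw n w q a i * (pw n w (p - q) j b - entry w i j * pw n w (p - q) i b) +
      (pw n w (Suc q) a j - entry w i j * pw n w (Suc q) a i) * pw n w (p - Suc q) i b)"
  using assms(1)
proof (induction p arbitrary: a)
  case 0
  then show ?case by (simp add: lie_const)
next
  case (Suc p)
  let ?t = "\<lambda>a q. pw n w q a i * (pw n w (p - q) j b - entry w i j * pw n w (p - q) i b) +
      (pw n w (Suc q) a j - entry w i j * pw n w (Suc q) a i) * pw n w (p - Suc q) i b"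
  have "lie n i j (\<lambda>w. pw n w (Suc p) a b) w = (\<Sum>c<n. lie n i j (\<lambda>w. entry w a c * pw n w p c b) w)"
    using Suc.prems assms by (simp, intro lie_sum poly_fun_mult poly_fun_entry poly_corr_pw) auto
  also have "\<dots> = (\<Sum>c<n. ((if a = i then velocity w i j c else 0) + (if c = i then velocity w i j a else 0)) * pw n w p c b + entry w a c * (\<Sum>q<p. ?t c q))"
    using Suc assms by (intro sum.cong refl) (simp add: lie_mult[OF poly_fun_entry poly_corr_pw] lie_entry)
  also have "\<dots> = (\<Sum>c<n. (if a = i then velocity w i j c * pw n w p c b else 0)) + (\<Sum>c<n. if c = i then velocity w i j a * pw n w p c b else 0)
      + (\<Sum>c<n. entry w a c * (\<Sum>q<p. ?t c q))"
    unfolding sum.distrib[symmetric] by (intro sum.cong refl) (auto simp: algebra_simps)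
  also have "(\<Sum>c<n. (if a = i then velocity w i j c * pw n w p c b else 0)) = pw n w 0 a i * (\<Sum>c<n. velocity w i j c * pw n w p c b)"
    by simp
  also have "\<dots> = pw n w 0 a i * (pw n w (Suc p) j b - entry w i j * pw n w (Suc p) i b)"
    using assms by (simp only: velocity_pw)
  also have "(\<Sum>c<n. if c = i then velocity w i j a * pw n w p c b else 0) = velocity w i j a * pw n w p i b"
    using assms by simp
  also have "velocity w i j a = pw n w (Suc 0) a j - entry w i j * pw n w (Suc 0) a i"
    using assms Suc.prems by (simp add: mpow_one velocity_def entry_sym del: mpow.simps)
  also have "(\<Sum>c<n. entry w a c * (\<Sum>q<p. ?t c q)) =
     (\<Sum>q<p. pw n w (Suc q) a i * (pw n w (p - q) j b - entry w i j * pw n w (p - q) i b) +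
      (pw n w (Suc (Suc q)) a j - entry w i j * pw n w (Suc (Suc q)) a i) * pw n w (p - Suc q) i b)"
  proof -
    have "(\<Sum>c<n. entry w a c * ?t c q) = pw n w (Suc q) a i * (pw n w (p - q) j b - entry w i j * pw n w (p - q) i b) +
      (pw n w (Suc (Suc q)) a j - entry w i j * pw n w (Suc (Suc q)) a i) * pw n w (p - Suc q) i b" for q
    proof -
      have s: "pw n w (Suc r) a k = (\<Sum>c<n. entry w a c * pw n w r c k)" for r k by simp
      show ?thesis unfolding s[of q] s[of "Suc q"]
        by (simp only: sum_distrib_right sum_distrib_left sum.distrib[symmetric] sum_subtractf[symmetric])
           (intro sum.cong refl, simp add: algebra_simps del: mpow.simps)
    qed
    then show ?thesis unfolding sum_distrib_left by (subst sum.swap) simp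
  qed
  finally show ?case by (simp add: sum.lessThan_Suc_shift del: mpow.simps sum.lessThan_Suc)
qed

text \<open>Once the trace is taken, all \<open>p\<close> positions in the product rule and both of
  their terms give the same contribution.\<close>

lemma lie_tr:
  assumes "i < n" "j < n"
  shows "lie n i j (tr n p) w = 2 * real p * (pw n w p i j - entry w i j * pw n w p i i)"
proof -
  have m: "(\<Sum>a<n. pw n w q a k * pw n w r l a) = pw n w (q + r) l k" if "l < n" "k < n" for q r l k
    using mpow_add[of l n k "entry w" r q] that by (simp add: add.commute mult.commute del: mpow.simps)
  have "lie n i j (tr n p) w = (\<Sum>a<n. lie n i j (\<lambda>w. pw n w p a a) w)"
    unfolding tr_def[abs_def] by (intro lie_sum poly_corr_pw) auto
  also have "\<dots> = (\<Sum>q<p. \<Sum>a<n. pw n w q a i * (pw n w (p - q) j a - entry w i j * pw n w (p - q) i a) +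
      (pw n w (Suc q) a j - entry w i j * pw n w (Suc q) a i) * pw n w (p - Suc q) i a)"
    using assms by (subst sum.swap) (simp add: lie_pw del: mpow.simps)
  also have "\<dots> = (\<Sum>q<p. 2 * (pw n w p i j - entry w i j * pw n w p i i))"
  proof (intro sum.cong refl)
    fix q assume q: "q \<in> {..<p}"
    have "(\<Sum>a<n. pw n w q a i * (pw n w (p - q) j a - entry w i j * pw n w (p - q) i a) +
      (pw n w (Suc q) a j - entry w i j * pw n w (Suc q) a i) * pw n w (p - Suc q) i a) =
      (\<Sum>a<n. pw n w q a i * pw n w (p - q) j a) - entry w i j * (\<Sum>a<n. pw n w q a i * pw n w (p - q) i a)
      + ((\<Sum>a<n. pw n w (Suc q) a j * pw n w (p - Suc q) i a) - entry w i j * (\<Sum>a<n. pw n w (Suc q) a i * pw n w (p - Suc q) i a))"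
      unfolding sum_distrib_left sum_subtractf[symmetric] sum.distrib[symmetric]
      by (intro sum.cong refl) (simp add: algebra_simps del: mpow.simps)
    also have "\<dots> = 2 * (pw n w p i j - entry w i j * pw n w p i i)"
      using assms q pw_sym[of j n i w p] by (simp add: m del: mpow.simps)
    finally show "(\<Sum>a<n. pw n w q a i * (pw n w (p - q) j a - entry w i j * pw n w (p - q) i a) +
      (pw n w (Suc q) a j - entry w i j * pw n w (Suc q) a i) * pw n w (p - Suc q) i a) = 2 * (pw n w p i j - entry w i j * pw n w p i i)" .
  qed
  finally show ?thesis by simp
qed

text \<open>The part of the summed integration by parts in which the derivative falls on the test
  function \<open>F\<close>.\<close>

definition lie_pair :: "nat \<Rightarrow> nat \<Rightarrow> ((nat \<times> nat \<Rightarrow> real) \<Rightarrow> real) \<Rightarrow> (nat \<times> nat \<Rightarrow> real) \<Rightarrow> real" where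
  "lie_pair n p F w = (\<Sum>i<n. \<Sum>j<n. lie n i j F w * pw n w p j i)"

lemma poly_corr_lie_pair: "poly_corr n F \<Longrightarrow> poly_corr n (lie_pair n p F)"
  unfolding lie_pair_def[abs_def] by (intro poly_fun_sum poly_fun_mult poly_corr_lie poly_corr_pw) auto

lemma sum_entry_pw: "i < n \<Longrightarrow> (\<Sum>j<n. entry w i j * pw n w p j k) = pw n w (Suc p) i k"
  by simp

lemma lie_pair_tr: "lie_pair n p (tr n q) w = 2 * real q * (tr n (p + q) w - diag_prod n (Suc p) q w)"
proof -
  have "lie_pair n p (tr n q) w = (\<Sum>i<n. \<Sum>j<n. 2 * real q * (pw n w q i j * pw n w p j i - (entry w i j * pw n w p j i) * pw n w q i i))"
    unfolding lie_pair_def by (intro sum.cong refl) (simp add: lie_tr algebra_simps del: mpow.simps)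
  also have "\<dots> = 2 * real q * (\<Sum>i<n. (\<Sum>j<n. pw n w q i j * pw n w p j i) - (\<Sum>j<n. entry w i j * pw n w p j i) * pw n w q i i)"
    by (simp add: sum_distrib_left sum_distrib_right sum_subtractf right_diff_distrib del: mpow.simps)
  also have "(\<Sum>i<n. (\<Sum>j<n. pw n w q i j * pw n w p j i) - (\<Sum>j<n. entry w i j * pw n w p j i) * pw n w q i i) =
     (\<Sum>i<n. pw n w (q + p) i i - pw n w (Suc p) i i * pw n w q i i)"
    by (intro sum.cong refl) (simp only: mpow_add lessThan_iff sum_entry_pw)
  finally show ?thesis
    unfolding tr_def[of n "p + q"] diag_prod_def by (simp only: sum_subtractf add.commute[of q p])
qed

text \<open>In exactly one term of \<open>lie_pw\<close>, the one with
  \<open>pw n w (Suc q) j j\<close> and \<open>pw n w (p - Suc q) i i\<close>, the sums over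
  \<open>i\<close> and \<open>j\<close> decouple into two traces. Every other term collapses to one
  trace or one \<open>diag_prod\<close>.\<close>

lemma lie_pw_sum:
  "(\<Sum>i<n. \<Sum>j<n. lie n i j (\<lambda>w. pw n w p j i) w) =
    (\<Sum>q<p. tr n p w - diag_prod n (Suc q) (p - q) w + (tr n (Suc q) w * tr n (p - Suc q) w - diag_prod n (Suc (Suc q)) (p - Suc q) w))"
proof -
  have "(\<Sum>i<n. \<Sum>j<n. lie n i j (\<lambda>w. pw n w p j i) w) = (\<Sum>i<n. \<Sum>j<n. \<Sum>q<p.
      pw n w q j i * (pw n w (p - q) j i - entry w i j * pw n w (p - q) i i) +
      (pw n w (Suc q) j j - entry w i j * pw n w (Suc q) j i) * pw n w (p - Suc q) i i)"
    by (intro sum.cong refl) (simp add: lie_pw del: mpow.simps)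
  also have "\<dots> = (\<Sum>i<n. \<Sum>q<p. \<Sum>j<n.
      pw n w q j i * (pw n w (p - q) j i - entry w i j * pw n w (p - q) i i) +
      (pw n w (Suc q) j j - entry w i j * pw n w (Suc q) j i) * pw n w (p - Suc q) i i)"
    by (intro sum.cong refl sum.swap)
  also have "\<dots> = (\<Sum>q<p. \<Sum>i<n. \<Sum>j<n.
      pw n w q j i * (pw n w (p - q) j i - entry w i j * pw n w (p - q) i i) +
      (pw n w (Suc q) j j - entry w i j * pw n w (Suc q) j i) * pw n w (p - Suc q) i i)"
    by (rule sum.swap)
  also have "\<dots> = (\<Sum>q<p. tr n p w - diag_prod n (Suc q) (p - q) w + (tr n (Suc q) w * tr n (p - Suc q) w - diag_prod n (Suc (Suc q)) (p - Suc q) w))"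
  proof (intro sum.cong refl)
    fix q assume q: "q \<in> {..<p}"
    have "(\<Sum>j<n. pw n w q j i * (pw n w (p - q) j i - entry w i j * pw n w (p - q) i i) +
      (pw n w (Suc q) j j - entry w i j * pw n w (Suc q) j i) * pw n w (p - Suc q) i i) =
      pw n w p i i - pw n w (Suc q) i i * pw n w (p - q) i i +
      (tr n (Suc q) w * pw n w (p - Suc q) i i - pw n w (Suc (Suc q)) i i * pw n w (p - Suc q) i i)" if i: "i < n" for i
    proof -
      have "(\<Sum>j<n. pw n w q j i * (pw n w (p - q) j i - entry w i j * pw n w (p - q) i i) +
        (pw n w (Suc q) j j - entry w i j * pw n w (Suc q) j i) * pw n w (p - Suc q) i i) =
        (\<Sum>j<n. pw n w q j i * pw n w (p - q) j i) - (\<Sum>j<n. entry w i j * pw n w q j i) * pw n w (p - q) i i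
        + ((\<Sum>j<n. pw n w (Suc q) j j) * pw n w (p - Suc q) i i - (\<Sum>j<n. entry w i j * pw n w (Suc q) j i) * pw n w (p - Suc q) i i)"
        unfolding sum_distrib_right sum_subtractf[symmetric] sum.distrib[symmetric]
        by (intro sum.cong refl) (simp add: algebra_simps del: mpow.simps)
      also have "(\<Sum>j<n. pw n w q j i * pw n w (p - q) j i) = (\<Sum>j<n. pw n w q i j * pw n w (p - q) j i)"
        using i by (intro sum.cong refl) (simp add: pw_sym[of i n] del: mpow.simps)
      also have "\<dots> = pw n w p i i" using mpow_add[of i n i "entry w" q "p - q"] i q by (simp del: mpow.simps)
      finally show ?thesis using i by (simp only: sum_entry_pw tr_def)
    qed
    then show "(\<Sum>i<n. \<Sum>j<n.
      pw n w q j i * (pw n w (p - q) j i - entry w i j * pw n w (p - q) i i) +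
      (pw n w (Suc q) j j - entry w i j * pw n w (Suc q) j i) * pw n w (p - Suc q) i i) =
      tr n p w - diag_prod n (Suc q) (p - q) w + (tr n (Suc q) w * tr n (p - Suc q) w - diag_prod n (Suc (Suc q)) (p - Suc q) w)"
      by (simp add: diag_prod_def sum.distrib sum_subtractf sum_distrib_left[symmetric] del: mpow.simps) (simp add: tr_def del: mpow.simps)
  qed
  finally show ?thesis .
qed

lemma loop_equation:
  assumes F: "poly_corr n F"
  shows "real n * corr_integral n (\<lambda>w. F w * tr n (Suc p) w) = real n * corr_integral n (\<lambda>w. F w * tr n p w) +
    corr_integral n (\<lambda>w. F w * (\<Sum>q<p. tr n p w - diag_prod n (Suc q) (p - q) w +
      (tr n (Suc q) w * tr n (p - Suc q) w - diag_prod n (Suc (Suc q)) (p - Suc q) w)) + lie_pair n p F w)"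
proof -
  let ?f = "\<lambda>i j w. F w * pw n w p j i"
  have pf: "poly_corr n (?f i j)" if "i < n" "j < n" for i j
    using F that by (intro poly_fun_mult poly_corr_pw)
  \<comment> \<open>On the diagonal the field is zero while \<open>entry w i i = 1\<close>, so the
    identity needs a correction there. Summed over \<open>i\<close>, the correction becomes the
    trace of \<open>C ^ p\<close>, the Catalan term with one index 0.\<close>
  have 1: "corr_integral n (lie n i j (?f i j)) =
    real n * corr_integral n (\<lambda>w. F w * (entry w i j * pw n w p j i)) - (if i = j then real n * corr_integral n (?f i i) else 0)"
    if ij: "i < n" "j < n" for i j
  proof (cases "i = j")
    case True
    have "velocity w i i k = 0" for w k by (simp add: velocity_def)
    then have "lie n i i g w = 0" for g w by (simp add: lie_def)
    then show ?thesis using True by (simp add: corr_integral_def del: mpow.simps)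
  next
    case False
    let ?g = "\<lambda>w. F w * (entry w i j * pw n w p j i)" and ?d = "\<lambda>w. lie n i j (?f i j) w - real n * entry w i j * ?f i j w"
    have "lie n i j (?f i j) = (\<lambda>w. ?d w + real n * ?g w)"
      by (simp add: fun_eq_iff algebra_simps del: mpow.simps)
    then have "corr_integral n (lie n i j (?f i j)) = corr_integral n (\<lambda>w. ?d w + real n * ?g w)" by (rule arg_cong)
    also have "\<dots> = corr_integral n ?d + corr_integral n (\<lambda>w. real n * ?g w)"
      using ij F by (intro corr_integral_add poly_fun_diff poly_corr_lie poly_fun_mult poly_fun_const poly_fun_entry poly_corr_pw)
    also have "corr_integral n ?d = 0" by (rule corr_integral_parts[OF ij False pf[OF ij]])
    also have "corr_integral n (\<lambda>w. real n * ?g w) = real n * corr_integral n ?g" by (rule corr_integral_cmult)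
    finally show ?thesis using False by simp
  qed
  have "corr_integral n (\<lambda>w. \<Sum>i<n. \<Sum>j<n. lie n i j (?f i j) w) = (\<Sum>i<n. \<Sum>j<n. corr_integral n (lie n i j (?f i j)))"
  proof -
    have "corr_integral n (\<lambda>w. \<Sum>i<n. \<Sum>j<n. lie n i j (?f i j) w) = (\<Sum>i<n. corr_integral n (\<lambda>w. \<Sum>j<n. lie n i j (?f i j) w))"
      by (intro corr_integral_sum poly_fun_sum poly_corr_lie pf) auto
    also have "\<dots> = (\<Sum>i<n. \<Sum>j<n. corr_integral n (lie n i j (?f i j)))"
      by (intro sum.cong refl corr_integral_sum poly_corr_lie pf) auto
    finally show ?thesis .
  qed
  also have "\<dots> = (\<Sum>i<n. \<Sum>j<n. real n * corr_integral n (\<lambda>w. F w * (entry w i j * pw n w p j i)) - (if j = i then real n * corr_integral n (?f i i) else 0))"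
    by (intro sum.cong refl) (auto simp: 1 simp del: mpow.simps)
  also have "\<dots> = real n * (\<Sum>i<n. \<Sum>j<n. corr_integral n (\<lambda>w. F w * (entry w i j * pw n w p j i))) - real n * (\<Sum>i<n. corr_integral n (?f i i))"
    by (simp add: sum_subtractf sum_distrib_left del: mpow.simps)
  also have "(\<Sum>i<n. corr_integral n (?f i i)) = corr_integral n (\<lambda>w. F w * tr n p w)"
    unfolding tr_def sum_distrib_left by (rule corr_integral_sum[symmetric]) (simp add: pf)
  also have "(\<Sum>i<n. \<Sum>j<n. corr_integral n (\<lambda>w. F w * (entry w i j * pw n w p j i))) = corr_integral n (\<lambda>w. F w * tr n (Suc p) w)"
  proof -
    have pg: "poly_corr n (\<lambda>w. F w * (entry w i j * pw n w p j i))" if "i < n" "j < n" for i j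
      using F that by (intro poly_fun_mult poly_corr_pw poly_fun_entry)
    have "corr_integral n (\<lambda>w. F w * tr n (Suc p) w) = corr_integral n (\<lambda>w. \<Sum>i<n. \<Sum>j<n. F w * (entry w i j * pw n w p j i))"
      by (simp add: tr_def sum_distrib_left)
    also have "\<dots> = (\<Sum>i<n. corr_integral n (\<lambda>w. \<Sum>j<n. F w * (entry w i j * pw n w p j i)))"
      by (intro corr_integral_sum poly_fun_sum pg) auto
    also have "\<dots> = (\<Sum>i<n. \<Sum>j<n. corr_integral n (\<lambda>w. F w * (entry w i j * pw n w p j i)))"
      by (intro sum.cong refl corr_integral_sum pg) auto
    finally show ?thesis by simp
  qed
  finally have main: "corr_integral n (\<lambda>w. \<Sum>i<n. \<Sum>j<n. lie n i j (?f i j) w) =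
    real n * corr_integral n (\<lambda>w. F w * tr n (Suc p) w) - real n * corr_integral n (\<lambda>w. F w * tr n p w)" .
  have eq: "(\<lambda>w. \<Sum>i<n. \<Sum>j<n. lie n i j (?f i j) w) = (\<lambda>w. F w * (\<Sum>q<p. tr n p w - diag_prod n (Suc q) (p - q) w +
      (tr n (Suc q) w * tr n (p - Suc q) w - diag_prod n (Suc (Suc q)) (p - Suc q) w)) + lie_pair n p F w)"
  proof
    fix w
    have "(\<Sum>i<n. \<Sum>j<n. lie n i j (?f i j) w) = (\<Sum>i<n. \<Sum>j<n. lie n i j F w * pw n w p j i + F w * lie n i j (\<lambda>w. pw n w p j i) w)"
      by (intro sum.cong refl) (simp add: lie_mult[OF F poly_corr_pw] del: mpow.simps)
    then show "(\<Sum>i<n. \<Sum>j<n. lie n i j (?f i j) w) = F w * (\<Sum>q<p. tr n p w - diag_prod n (Suc q) (p - q) w +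
      (tr n (Suc q) w * tr n (p - Suc q) w - diag_prod n (Suc (Suc q)) (p - Suc q) w)) + lie_pair n p F w"
      unfolding lie_pw_sum[symmetric] lie_pair_def by (simp add: sum.distrib sum_distrib_left del: mpow.simps)
  qed
  show ?thesis using main unfolding eq by simp
qed

subsection \<open>Convergence of moments\<close>

lemma corr_trace_eigenvalues:
  assumes "w \<in> corr_body n"
  obtains es where "length es = n" "char_poly (corr_mat n w) = (\<Prod>e\<leftarrow>es. [:- e, 1:])"
    "\<And>e. e \<in> set es \<Longrightarrow> 0 \<le> e" "\<And>k. tr n k w = (\<Sum>e\<leftarrow>es. e ^ k)"
proof -
  obtain es where es: "length es = n" "char_poly (corr_mat n w) = (\<Prod>e\<leftarrow>es. [:- e, 1:])"
    "\<And>e. e \<in> set es \<Longrightarrow> 0 \<le> e"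
    using corr_mat_eigenvalues[OF assms] by blast
  have "tr n k w = (\<Sum>e\<leftarrow>es. e ^ k)" for k
    using trace_pow_mat_eigenvalues[OF corr_mat_carrier es(2), of k]
    by (simp add: tr_def corr_mat_def mpow_eq_pow_mat del: mpow.simps)
  then show ?thesis using that es by blast
qed

section \<open>Inequalities between traces and moments\<close>

lemma pw_diag_square: "i < n \<Longrightarrow> pw n w (p + p) i i = (\<Sum>c<n. (pw n w p i c)\<^sup>2)"
  by (simp add: mpow_add pw_sym[of _ n i] power2_eq_square del: mpow.simps)

text \<open>For an even exponent the entry is a sum of squares; for \<open>2k + 1\<close> it is the
  quadratic form of \<open>C\<close> evaluated at a row of \<open>C ^ k\<close>.\<close>

lemma pw_diag_nonneg:
  assumes "w \<in> corr_body n" "i < n"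
  shows "0 \<le> pw n w p i i"
proof (cases "even p")
  case True
  then obtain k where "p = k + k" by (metis evenE mult_2)
  then show ?thesis using assms by (simp add: pw_diag_square sum_nonneg del: mpow.simps)
next
  case False
  then obtain k where "p = k + Suc k" by (metis oddE mult_2 add_Suc_right Suc_eq_plus1)
  then have "pw n w p i i = (\<Sum>c<n. pw n w k i c * pw n w (Suc k) c i)"
    using assms by (simp only: mpow_add)
  also have "\<dots> = (\<Sum>c<n. \<Sum>d<n. pw n w k i c * entry w c d * pw n w k i d)"
    using assms by (intro sum.cong refl) (simp add: sum_distrib_left mult.assoc pw_sym[of _ n i])
  also have "\<dots> \<ge> 0" using assms(1) by (simp add: corr_body_def bil_def)
  finally show ?thesis .
qed

lemma diag_prod_nonneg: "w \<in> corr_body n \<Longrightarrow> 0 \<le> diag_prod n p q w"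
  unfolding diag_prod_def by (intro sum_nonneg mult_nonneg_nonneg pw_diag_nonneg) auto

text \<open>The square of \<open>pw n w r i i\<close> is one of the squares summing up to
  \<open>pw n w (r + r) i i\<close>; the arithmetic-geometric mean inequality then makes the bound
  linear in traces.\<close>

lemma diag_prod_le: "diag_prod n p q w \<le> (tr n (p + p) w + tr n (q + q) w) / 2"
proof -
  have sq: "(pw n w r i i)\<^sup>2 \<le> pw n w (r + r) i i" if "i < n" for r i
    using that member_le_sum[of i "{..<n}" "\<lambda>c. (pw n w r i c)\<^sup>2"] by (simp add: pw_diag_square del: mpow.simps)
  have "pw n w p i i * pw n w q i i \<le> (pw n w (p + p) i i + pw n w (q + q) i i) / 2" if "i < n" for i
    using sq[OF that, of p] sq[OF that, of q] sum_squares_bound[of "pw n w p i i" "pw n w q i i"]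
    by (simp del: mpow.simps)
  then have "diag_prod n p q w \<le> (\<Sum>i<n. (pw n w (p + p) i i + pw n w (q + q) i i) / 2)"
    unfolding diag_prod_def by (intro sum_mono) auto
  also have "\<dots> = (tr n (p + p) w + tr n (q + q) w) / 2"
    by (simp add: tr_def sum.distrib sum_divide_distrib add_divide_distrib del: mpow.simps)
  finally show ?thesis .
qed

definition mom :: "nat \<Rightarrow> nat \<Rightarrow> (nat \<times> nat \<Rightarrow> real) \<Rightarrow> real" where
  "mom n k w = tr n k w / real n"

lemma poly_corr_mom: "poly_corr n (mom n k)"
  unfolding mom_def[abs_def] by (intro poly_fun_divide poly_corr_tr)

lemma mom_0: "0 < n \<Longrightarrow> mom n 0 w = 1"
  by (simp add: mom_def tr_def)

lemma mom_eigenvalues: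
  assumes "w \<in> corr_body n"
  obtains x where "\<And>i. i < n \<Longrightarrow> 0 \<le> x i" "\<And>k. mom n k w = (\<Sum>i<n. x i ^ k) / real n"
proof -
  obtain es where es: "length es = n" "\<And>e. e \<in> set es \<Longrightarrow> 0 \<le> e" "\<And>k. tr n k w = (\<Sum>e\<leftarrow>es. e ^ k)"
    using corr_trace_eigenvalues[OF assms] by metis
  show ?thesis
    by (rule that[of "\<lambda>i. es ! i"]) (use es in \<open>auto simp: mom_def sum_list_sum_nth lessThan_atLeast0\<close>)
qed

lemma mom_nonneg: "w \<in> corr_body n \<Longrightarrow> 0 \<le> mom n k w"
  by (erule mom_eigenvalues[of w n]) (auto intro!: sum_nonneg divide_nonneg_nonneg zero_le_power)

text \<open>Chebyshev's sum inequality: on nonnegative numbers the powers \<open>a\<close> and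
  \<open>b\<close> are ordered alike, so every product of differences is nonnegative.\<close>

lemma mom_mult_le:
  assumes "w \<in> corr_body n" "0 < n"
  shows "mom n a w * mom n b w \<le> mom n (a + b) w"
proof -
  obtain x where x: "\<And>i. i < n \<Longrightarrow> 0 \<le> x i" "\<And>k. mom n k w = (\<Sum>i<n. x i ^ k) / real n"
    using mom_eigenvalues[OF assms(1)] by metis
  let ?s = "\<lambda>k. \<Sum>i<n. x i ^ k"
  have "0 \<le> (x i ^ a - x j ^ a) * (x i ^ b - x j ^ b)" if "i < n" "j < n" for i j
  proof (cases "x i \<le> x j")
    case True
    then have "x i ^ a \<le> x j ^ a" "x i ^ b \<le> x j ^ b" using x(1) that by (auto intro: power_mono)
    then show ?thesis by (simp add: mult_nonpos_nonpos)
  next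
    case False
    then have "x j ^ a \<le> x i ^ a" "x j ^ b \<le> x i ^ b" using x(1) that by (auto intro: power_mono)
    then show ?thesis by simp
  qed
  then have "0 \<le> (\<Sum>i<n. \<Sum>j<n. (x i ^ a - x j ^ a) * (x i ^ b - x j ^ b))" by (intro sum_nonneg) auto
  also have "\<dots> = (\<Sum>i<n. \<Sum>j<n. x i ^ (a + b) + x j ^ (a + b) - (x i ^ a * x j ^ b + x j ^ a * x i ^ b))"
    by (intro sum.cong refl) (simp add: power_add algebra_simps)
  also have "\<dots> = 2 * real n * ?s (a + b) - 2 * (?s a * ?s b)"
    by (simp add: sum.distrib sum_subtractf sum_distrib_left[symmetric] sum_distrib_right[symmetric])
  finally have "?s a * ?s b \<le> real n * ?s (a + b)" by simp
  then show ?thesis using assms(2) unfolding x(2) by (simp add: field_simps)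
qed

lemma mom_le_one_plus:
  assumes "w \<in> corr_body n" "0 < n" "a \<le> b"
  shows "mom n a w \<le> 1 + mom n b w"
proof -
  obtain x where x: "\<And>i. i < n \<Longrightarrow> 0 \<le> x i" "\<And>k. mom n k w = (\<Sum>i<n. x i ^ k) / real n"
    using mom_eigenvalues[OF assms(1)] by metis
  have "x i ^ a \<le> 1 + x i ^ b" if "i < n" for i
  proof (cases "x i \<le> 1")
    case True
    then have "x i ^ a \<le> 1" using x(1)[OF that] by (simp add: power_le_one)
    moreover have "0 \<le> x i ^ b" using x(1)[OF that] by simp
    ultimately show ?thesis by linarith
  next
    case False
    then have "x i ^ a \<le> x i ^ b" using assms(3) by (intro power_increasing) auto
    then show ?thesis by linarith
  qed
  then have "(\<Sum>i<n. x i ^ a) \<le> (\<Sum>i<n. 1 + x i ^ b)" by (intro sum_mono) auto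
  then show ?thesis using assms(2) unfolding x(2) by (simp add: sum.distrib field_simps)
qed

section \<open>Means under the uniform law\<close>

definition corr_mean :: "nat \<Rightarrow> ((nat \<times> nat \<Rightarrow> real) \<Rightarrow> real) \<Rightarrow> real" where
  "corr_mean n f = corr_integral n f / measure (PiM (upper_indices n) (\<lambda>_. lborel)) (corr_body n)"

lemma corr_mean_add:
  "poly_corr n f \<Longrightarrow> poly_corr n g \<Longrightarrow> corr_mean n (\<lambda>w. f w + g w) = corr_mean n f + corr_mean n g"
  by (simp add: corr_mean_def corr_integral_add add_divide_distrib)

lemma corr_mean_cmult: "corr_mean n (\<lambda>w. c * f w) = c * corr_mean n f"
  unfolding corr_mean_def corr_integral_cmult by simp

lemma corr_mean_sum:
  "(\<And>a. a \<in> A \<Longrightarrow> poly_corr n (f a)) \<Longrightarrow> corr_mean n (\<lambda>w. \<Sum>a\<in>A. f a w) = (\<Sum>a\<in>A. corr_mean n (f a))"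
  by (simp add: corr_mean_def corr_integral_sum sum_divide_distrib)

lemma corr_mean_mono:
  "poly_corr n f \<Longrightarrow> poly_corr n g \<Longrightarrow> (\<And>w. w \<in> corr_body n \<Longrightarrow> f w \<le> g w) \<Longrightarrow> corr_mean n f \<le> corr_mean n g"
  unfolding corr_mean_def by (intro divide_right_mono corr_integral_mono) auto

lemma corr_mean_cong: "(\<And>w. w \<in> corr_body n \<Longrightarrow> f w = g w) \<Longrightarrow> corr_mean n f = corr_mean n g"
  unfolding corr_mean_def corr_integral_def
  by (intro arg_cong2[where f = "(/)"] Bochner_Integration.integral_cong) (auto simp: indicator_def)

lemma corr_mean_one:
  assumes "0 < measure (PiM (upper_indices n) (\<lambda>_. lborel)) (corr_body n)"
  shows "corr_mean n (\<lambda>w. 1) = 1"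
  using assms by (simp add: corr_mean_def corr_integral_def sets.Int_space_eq2[OF sets_corr_body])

text \<open>The lower-order terms of the loop equation, scaled so as to stay bounded in mean; after
  division by \<open>n\<^sup>2\<close> they enter with a factor \<open>1 / n\<close>.\<close>

definition loop_error :: "nat \<Rightarrow> nat \<Rightarrow> ((nat \<times> nat \<Rightarrow> real) \<Rightarrow> real) \<Rightarrow> (nat \<times> nat \<Rightarrow> real) \<Rightarrow> real" where
  "loop_error n p F w = F w * (\<Sum>q<p. mom n p w - diag_prod n (Suc q) (p - q) w / real n
     - diag_prod n (Suc (Suc q)) (p - Suc q) w / real n) + lie_pair n p F w / real n"

lemma poly_corr_loop_error: "poly_corr n F \<Longrightarrow> poly_corr n (loop_error n p F)"
  unfolding loop_error_def[abs_def]
  by (intro poly_fun_add poly_fun_mult poly_fun_sum poly_fun_diff poly_fun_divide poly_corr_mom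
      poly_corr_diag_prod poly_corr_lie_pair)

lemma loop_equation_mean:
  assumes F: "poly_corr n F" and n: "0 < n"
  shows "corr_mean n (\<lambda>w. F w * mom n (Suc p) w) = corr_mean n (\<lambda>w. F w * mom n p w) +
    (\<Sum>q<p. corr_mean n (\<lambda>w. F w * (mom n (Suc q) w * mom n (p - Suc q) w))) + corr_mean n (loop_error n p F) / real n"
proof -
  let ?N = "real n"
  let ?f = "\<lambda>q w. F w * (mom n (Suc q) w * mom n (p - Suc q) w)"
  let ?E = "\<lambda>w. F w * (\<Sum>q<p. tr n p w - diag_prod n (Suc q) (p - q) w +
      (tr n (Suc q) w * tr n (p - Suc q) w - diag_prod n (Suc (Suc q)) (p - Suc q) w)) + lie_pair n p F w"
  have pf: "poly_corr n (?f q)" for q using F by (intro poly_fun_mult poly_corr_mom)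
  have t: "corr_mean n (\<lambda>w. F w * tr n k w) = ?N * corr_mean n (\<lambda>w. F w * mom n k w)" for k
  proof -
    have "(\<lambda>w. F w * tr n k w) = (\<lambda>w. ?N * (F w * mom n k w))" using n by (simp add: mom_def)
    then show ?thesis by (simp only: corr_mean_cmult)
  qed
  have "?E w = ?N * (?N * (\<Sum>q<p. ?f q w) + loop_error n p F w)" for w
  proof -
    have "F w * (\<Sum>q<p. tr n p w - diag_prod n (Suc q) (p - q) w +
      (tr n (Suc q) w * tr n (p - Suc q) w - diag_prod n (Suc (Suc q)) (p - Suc q) w)) =
      (\<Sum>q<p. ?N * (?N * ?f q w) + ?N * (F w * (mom n p w - diag_prod n (Suc q) (p - q) w / ?N - diag_prod n (Suc (Suc q)) (p - Suc q) w / ?N)))"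
      unfolding sum_distrib_left using n by (intro sum.cong refl) (simp add: mom_def field_simps)
    then show ?thesis
      unfolding loop_error_def using n
      by (simp add: sum.distrib sum_distrib_left distrib_left)
  qed
  then have E: "?E = (\<lambda>w. ?N * (?N * (\<Sum>q<p. ?f q w) + loop_error n p F w))" by (rule ext)
  have "corr_mean n ?E = ?N * corr_mean n (\<lambda>w. ?N * (\<Sum>q<p. ?f q w) + loop_error n p F w)"
    unfolding E by (rule corr_mean_cmult)
  also have "corr_mean n (\<lambda>w. ?N * (\<Sum>q<p. ?f q w) + loop_error n p F w) =
    corr_mean n (\<lambda>w. ?N * (\<Sum>q<p. ?f q w)) + corr_mean n (loop_error n p F)"
    using F pf by (intro corr_mean_add poly_fun_mult poly_fun_const poly_fun_sum poly_corr_loop_error poly_corr_mom)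
  also have "corr_mean n (\<lambda>w. ?N * (\<Sum>q<p. ?f q w)) = ?N * corr_mean n (\<lambda>w. \<Sum>q<p. ?f q w)"
    by (rule corr_mean_cmult)
  also have "corr_mean n (\<lambda>w. \<Sum>q<p. ?f q w) = (\<Sum>q<p. corr_mean n (?f q))"
    by (intro corr_mean_sum pf)
  finally have 1: "corr_mean n ?E = ?N * (?N * (\<Sum>q<p. corr_mean n (?f q)) + corr_mean n (loop_error n p F))" .
  have "?N * corr_mean n (\<lambda>w. F w * tr n (Suc p) w) = ?N * corr_mean n (\<lambda>w. F w * tr n p w) + corr_mean n ?E"
    using loop_equation[OF F, of p] unfolding corr_mean_def by (simp add: add_divide_distrib[symmetric])
  then have "?N * (?N * corr_mean n (\<lambda>w. F w * mom n (Suc p) w)) =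
    ?N * (?N * corr_mean n (\<lambda>w. F w * mom n p w) + (?N * (\<Sum>q<p. corr_mean n (?f q)) + corr_mean n (loop_error n p F)))"
    unfolding t 1 by (simp add: distrib_left)
  then have "?N * corr_mean n (\<lambda>w. F w * mom n (Suc p) w) =
    ?N * corr_mean n (\<lambda>w. F w * mom n p w) + (?N * (\<Sum>q<p. corr_mean n (?f q)) + corr_mean n (loop_error n p F))"
    using n by simp
  then show ?thesis using n by (simp add: field_simps)
qed

lemma lie_pair_const: "lie_pair n p (\<lambda>w. c) w = 0"
  by (simp add: lie_pair_def lie_const)

text \<open>The loop equation with \<open>F = 1\<close>, for which \<open>lie_pair\<close> vanishes.
  In the constant, 1 comes from the term \<open>mom n p\<close>, one \<open>p\<close> from the
  products, each at most \<open>mom n p\<close> by \<open>mom_mult_le\<close>, and another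
  \<open>p\<close> from the error after its nonnegative \<open>diag_prod\<close> terms are
  discarded.\<close>

lemma corr_mean_mom_Suc_le:
  assumes n: "0 < n"
  shows "corr_mean n (mom n (Suc p)) \<le> (1 + 2 * real p) * corr_mean n (mom n p)"
proof -
  have "corr_mean n (\<lambda>w. 1 * (mom n (Suc q) w * mom n (p - Suc q) w)) \<le> corr_mean n (mom n p)" if "q < p" for q
  proof (rule corr_mean_mono)
    fix w assume w: "w \<in> corr_body n"
    show "1 * (mom n (Suc q) w * mom n (p - Suc q) w) \<le> mom n p w"
      using mom_mult_le[OF w n, of "Suc q" "p - Suc q"] that by simp
  qed (intro poly_fun_mult poly_fun_const poly_corr_mom)+
  then have 1: "(\<Sum>q<p. corr_mean n (\<lambda>w. 1 * (mom n (Suc q) w * mom n (p - Suc q) w))) \<le> (\<Sum>q<p. corr_mean n (mom n p))"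
    by (intro sum_mono) auto
  have "corr_mean n (loop_error n p (\<lambda>w. 1)) \<le> corr_mean n (\<lambda>w. real p * mom n p w)"
  proof (rule corr_mean_mono)
    fix w assume w: "w \<in> corr_body n"
    have "(\<Sum>q<p. mom n p w - diag_prod n (Suc q) (p - q) w / real n - diag_prod n (Suc (Suc q)) (p - Suc q) w / real n)
       \<le> (\<Sum>q<p. mom n p w)"
      using diag_prod_nonneg[OF w] by (intro sum_mono) (simp add: add_nonneg_nonneg diff_le_eq)
    then show "loop_error n p (\<lambda>w. 1) w \<le> real p * mom n p w"
      by (simp add: loop_error_def lie_pair_const)
  qed (intro poly_fun_mult poly_fun_const poly_corr_mom poly_corr_loop_error)+
  then have 2: "corr_mean n (loop_error n p (\<lambda>w. 1)) \<le> real p * corr_mean n (mom n p)"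
    by (simp only: corr_mean_cmult)
  have nn: "0 \<le> corr_mean n (mom n p)"
    using corr_mean_mono[OF poly_fun_const poly_corr_mom mom_nonneg, of n p]
    by (simp add: corr_mean_def corr_integral_def)
  have "corr_mean n (loop_error n p (\<lambda>w. 1)) / real n \<le> real p * corr_mean n (mom n p) / real n"
    using 2 by (intro divide_right_mono) auto
  also have "\<dots> \<le> real p * corr_mean n (mom n p) / 1"
    using nn n by (intro divide_left_mono) auto
  finally show ?thesis
    using loop_equation_mean[OF poly_fun_const n, of 1 p] 1 by (simp add: algebra_simps)
qed

text \<open>The bound is uniform in \<open>n\<close> and holds only in mean: the all-ones matrix is
  a correlation matrix with eigenvalue \<open>n\<close>.\<close>

lemma corr_mean_mom_bounded:
  assumes pos: "\<And>n. 0 < measure (PiM (upper_indices n) (\<lambda>_. lborel)) (corr_body n)"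
  obtains B where "\<And>n. 0 < n \<Longrightarrow> corr_mean n (mom n k) \<le> B"
proof -
  have "\<exists>B. \<forall>n>0. corr_mean n (mom n k) \<le> B"
  proof (induction k)
    case 0
    have "corr_mean n (mom n 0) = 1" if n: "n > 0" for n
    proof -
      have "corr_mean n (mom n 0) = corr_mean n (\<lambda>w. 1)"
        by (rule corr_mean_cong) (rule mom_0[OF n])
      then show ?thesis using corr_mean_one[OF pos[of n]] by simp
    qed
    then show ?case by (intro exI[of _ 1]) simp
  next
    case (Suc k)
    then obtain B where B: "\<And>n. n > 0 \<Longrightarrow> corr_mean n (mom n k) \<le> B" by auto
    have "corr_mean n (mom n (Suc k)) \<le> (1 + 2 * real k) * B" if "n > 0" for n
      using corr_mean_mom_Suc_le[OF that, of k] B[OF that]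
      by (meson order_trans mult_left_mono add_nonneg_nonneg zero_le_one mult_nonneg_nonneg of_nat_0_le_iff zero_le_numeral)
    then show ?case by blast
  qed
  then show ?thesis using that by blast
qed

text \<open>The constants \<open>A\<close> and \<open>R\<close> are independent of \<open>n\<close>.
  The class is closed under sums and products because moments of different orders can be compared,
  and its members have means bounded in \<open>n\<close>.\<close>

definition moment_dominated :: "(nat \<Rightarrow> (nat \<times> nat \<Rightarrow> real) \<Rightarrow> real) \<Rightarrow> bool" where
  "moment_dominated G \<longleftrightarrow> (\<exists>A R. 0 \<le> A \<and> (\<forall>n>0. \<forall>w\<in>corr_body n. \<bar>G n w\<bar> \<le> A * (1 + mom n R w)))"

lemma moment_dominatedE:
  assumes "moment_dominated G"
  obtains A R where "0 \<le> A" "\<And>n w. 0 < n \<Longrightarrow> w \<in> corr_body n \<Longrightarrow> \<bar>G n w\<bar> \<le> A * (1 + mom n R w)"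
  using assms unfolding moment_dominated_def by blast

lemma moment_dominatedI:
  assumes "0 \<le> A" "\<And>n w. 0 < n \<Longrightarrow> w \<in> corr_body n \<Longrightarrow> \<bar>G n w\<bar> \<le> A * (1 + mom n R w)"
  shows "moment_dominated G"
  using assms unfolding moment_dominated_def by blast

lemma moment_dominated_mom: "moment_dominated (\<lambda>n w. mom n k w)"
  by (rule moment_dominatedI[of 1 _ k]) (simp_all add: mom_nonneg)

lemma moment_dominated_const: "moment_dominated (\<lambda>n w. c)"
  by (rule moment_dominatedI[of "\<bar>c\<bar>" _ 0]) (simp_all add: mom_0)

lemma moment_dominated_bound:
  assumes "moment_dominated H" "\<And>n w. 0 < n \<Longrightarrow> w \<in> corr_body n \<Longrightarrow> \<bar>G n w\<bar> \<le> \<bar>H n w\<bar>"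
  shows "moment_dominated G"
proof (rule moment_dominatedE[OF assms(1)])
  fix A R assume "0 \<le> A" "\<And>n w. 0 < n \<Longrightarrow> w \<in> corr_body n \<Longrightarrow> \<bar>H n w\<bar> \<le> A * (1 + mom n R w)"
  then show ?thesis using assms(2) by (intro moment_dominatedI[of A _ R]) (blast intro: order_trans)+
qed

lemma moment_dominated_add:
  assumes "moment_dominated G" "moment_dominated H"
  shows "moment_dominated (\<lambda>n w. G n w + H n w)"
proof (rule moment_dominatedE[OF assms(1)], rule moment_dominatedE[OF assms(2)])
  fix A R B S
  assume A: "0 \<le> A" "\<And>n w. 0 < n \<Longrightarrow> w \<in> corr_body n \<Longrightarrow> \<bar>G n w\<bar> \<le> A * (1 + mom n R w)"
    and B: "0 \<le> B" "\<And>n w. 0 < n \<Longrightarrow> w \<in> corr_body n \<Longrightarrow> \<bar>H n w\<bar> \<le> B * (1 + mom n S w)"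
  show ?thesis
  proof (rule moment_dominatedI[of "2 * (A + B)" _ "R + S"])
    fix n w assume n: "0 < n" and w: "w \<in> corr_body n"
    have nn: "0 \<le> mom n (R + S) w" using mom_nonneg[OF w] .
    have "\<bar>G n w\<bar> \<le> A * (2 + 2 * mom n (R + S) w)"
      using A(2)[OF n w] mom_le_one_plus[OF w n, of R "R + S"] A(1) nn
      by (elim order_trans) (intro mult_left_mono, auto)
    moreover have "\<bar>H n w\<bar> \<le> B * (2 + 2 * mom n (R + S) w)"
      using B(2)[OF n w] mom_le_one_plus[OF w n, of S "R + S"] B(1) nn
      by (elim order_trans) (intro mult_left_mono, auto)
    ultimately show "\<bar>G n w + H n w\<bar> \<le> 2 * (A + B) * (1 + mom n (R + S) w)"
      by (simp add: algebra_simps)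
  qed (use A B in auto)
qed

lemma moment_dominated_mult:
  assumes "moment_dominated G" "moment_dominated H"
  shows "moment_dominated (\<lambda>n w. G n w * H n w)"
proof (rule moment_dominatedE[OF assms(1)], rule moment_dominatedE[OF assms(2)])
  fix A R B S
  assume A: "0 \<le> A" "\<And>n w. 0 < n \<Longrightarrow> w \<in> corr_body n \<Longrightarrow> \<bar>G n w\<bar> \<le> A * (1 + mom n R w)"
    and B: "0 \<le> B" "\<And>n w. 0 < n \<Longrightarrow> w \<in> corr_body n \<Longrightarrow> \<bar>H n w\<bar> \<le> B * (1 + mom n S w)"
  show ?thesis
  \<comment> \<open>With \<open>m\<close> the moment of order \<open>R + S\<close>, both single
    moments are at most \<open>1 + m\<close> and their product is at most \<open>m\<close>; so
    \<open>(1 + mom n R w) * (1 + mom n S w)\<close> is at most \<open>3 * (1 + m)\<close>.\<close>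
  proof (rule moment_dominatedI[of "3 * (A * B)" _ "R + S"])
    fix n w assume n: "0 < n" and w: "w \<in> corr_body n"
    have nn: "0 \<le> mom n R w" "0 \<le> mom n S w" "0 \<le> mom n (R + S) w" using mom_nonneg[OF w] by auto
    have "\<bar>G n w * H n w\<bar> \<le> A * (1 + mom n R w) * (B * (1 + mom n S w))"
      unfolding abs_mult using A(2)[OF n w] B(2)[OF n w] A(1) nn by (intro mult_mono) auto
    also have "\<dots> = A * B * (1 + mom n R w + mom n S w + mom n R w * mom n S w)" by (simp add: algebra_simps)
    also have "\<dots> \<le> A * B * (3 * (1 + mom n (R + S) w))"
      using mom_le_one_plus[OF w n, of R "R + S"] mom_le_one_plus[OF w n, of S "R + S"] mom_mult_le[OF w n, of R S] A(1) B(1)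
      by (intro mult_left_mono) auto
    finally show "\<bar>G n w * H n w\<bar> \<le> 3 * (A * B) * (1 + mom n (R + S) w)" by (simp add: mult_ac)
  qed (use A B in auto)
qed

lemma moment_dominated_diff:
  assumes "moment_dominated G" "moment_dominated H"
  shows "moment_dominated (\<lambda>n w. G n w - H n w)"
  using moment_dominated_add[OF assms(1) moment_dominated_mult[OF moment_dominated_const[of "-1"] assms(2)]] by simp

lemma moment_dominated_sum:
  "(\<And>a. a \<in> A \<Longrightarrow> moment_dominated (G a)) \<Longrightarrow> moment_dominated (\<lambda>n w. \<Sum>a\<in>A. G a n w)"
  by (induction A rule: infinite_finite_induct) (auto intro: moment_dominated_const moment_dominated_add)

lemma moment_dominated_diag_prod: "moment_dominated (\<lambda>n w. diag_prod n p q w / real n)"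
proof (rule moment_dominated_bound)
  show "moment_dominated (\<lambda>n w. mom n (p + p) w + mom n (q + q) w)"
    by (intro moment_dominated_add moment_dominated_mom)
  fix n w assume n: "0 < n" and w: "w \<in> corr_body n"
  have "diag_prod n p q w / real n \<le> (mom n (p + p) w + mom n (q + q) w) / 2"
    using diag_prod_le[of n p q w] n by (simp add: mom_def field_simps)
  moreover have "0 \<le> diag_prod n p q w / real n" using diag_prod_nonneg[OF w] by simp
  moreover have "0 \<le> mom n (p + p) w + mom n (q + q) w" using mom_nonneg[OF w] by (simp add: add_nonneg_nonneg)
  moreover have "\<bar>x\<bar> \<le> \<bar>y\<bar>" if "x \<le> y / 2" "0 \<le> x" "0 \<le> y" for x y :: real using that by linarith
  ultimately show "\<bar>diag_prod n p q w / real n\<bar> \<le> \<bar>mom n (p + p) w + mom n (q + q) w\<bar>" by blast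
qed

lemma eventually_sequentially_posI:
  assumes "\<And>n::nat. 0 < n \<Longrightarrow> P n"
  shows "eventually P sequentially"
  using eventually_gt_at_top[of 0] by (rule eventually_mono) (rule assms)

text \<open>Bounded moments in mean bound the mean of any dominated family, so division by
  \<open>n\<close> sends it to 0.\<close>

lemma moment_dominated_mean:
  assumes pos: "\<And>n. 0 < measure (PiM (upper_indices n) (\<lambda>_. lborel)) (corr_body n)"
    and G: "moment_dominated G" "\<And>n. poly_corr n (G n)"
  shows "(\<lambda>n. corr_mean n (G n) / real n) \<longlonglongrightarrow> 0"
proof (rule moment_dominatedE[OF G(1)])
  fix A R assume A: "0 \<le> A" "\<And>n w. 0 < n \<Longrightarrow> w \<in> corr_body n \<Longrightarrow> \<bar>G n w\<bar> \<le> A * (1 + mom n R w)"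
  obtain B where B: "\<And>n. 0 < n \<Longrightarrow> corr_mean n (mom n R) \<le> B" using corr_mean_mom_bounded[OF pos] by blast
  have bound: "\<bar>corr_mean n (G n)\<bar> \<le> A * (1 + B)" if n: "0 < n" for n
  proof -
    have one: "corr_mean n (\<lambda>w. 1) = 1" by (rule corr_mean_one[OF pos])
    have m: "corr_mean n (\<lambda>w. c * (1 + mom n R w)) = c * (1 + corr_mean n (mom n R))" for c
      unfolding corr_mean_cmult using corr_mean_add[OF poly_fun_const poly_corr_mom, of n 1 R] one by simp
    have pc: "poly_corr n (\<lambda>w. c * (1 + mom n R w))" for c
      by (intro poly_fun_mult poly_fun_add poly_fun_const poly_corr_mom)
    have "corr_mean n (G n) \<le> corr_mean n (\<lambda>w. A * (1 + mom n R w))"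
      using A(2)[OF n] by (intro corr_mean_mono G pc) (auto simp: abs_le_iff)
    moreover have "corr_mean n (\<lambda>w. (- A) * (1 + mom n R w)) \<le> corr_mean n (G n)"
    proof (rule corr_mean_mono[OF pc G(2)])
      show "(- A) * (1 + mom n R w) \<le> G n w" if "w \<in> corr_body n" for w
        using A(2)[OF n that] by simp
    qed
    moreover have "A * (1 + corr_mean n (mom n R)) \<le> A * (1 + B)"
      using A(1) B[OF n] by (intro mult_left_mono) auto
    ultimately show ?thesis unfolding m by auto
  qed
  have "(\<lambda>n. A * (1 + B) / real n) \<longlonglongrightarrow> 0" by (rule lim_const_over_n)
  moreover have "eventually (\<lambda>n. norm (corr_mean n (G n) / real n) \<le> A * (1 + B) / real n) sequentially"
    by (rule eventually_sequentially_posI) (simp add: divide_right_mono bound)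
  ultimately show ?thesis by (rule Lim_null_comparison[rotated])
qed

text \<open>A multiset of exponents, because the order of the factors is immaterial and the sum of
  the multiset is the total degree that drives the induction.\<close>

definition mom_prod :: "nat multiset \<Rightarrow> nat \<Rightarrow> (nat \<times> nat \<Rightarrow> real) \<Rightarrow> real" where
  "mom_prod Q n w = (\<Prod>q\<in>#Q. mom n q w)"

lemma mom_prod_add_mset: "mom_prod (add_mset q Q) n = (\<lambda>w. mom n q w * mom_prod Q n w)"
  by (simp add: mom_prod_def fun_eq_iff)

lemma mom_prod_empty: "mom_prod {#} n = (\<lambda>w. 1)"
  by (simp add: mom_prod_def fun_eq_iff)

lemma poly_corr_mom_prod: "poly_corr n (mom_prod Q n)"
  by (induction Q) (auto simp: mom_prod_add_mset mom_prod_empty intro: poly_fun_mult poly_fun_const poly_corr_mom)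

lemma moment_dominated_mom_prod: "moment_dominated (\<lambda>n w. mom_prod Q n w)"
  by (induction Q) (auto simp: mom_prod_add_mset mom_prod_empty intro: moment_dominated_mult moment_dominated_const moment_dominated_mom)

lemma lie_pair_mult:
  assumes "poly_corr n F" "poly_corr n G"
  shows "lie_pair n p (\<lambda>w. F w * G w) w = lie_pair n p F w * G w + F w * lie_pair n p G w"
  unfolding lie_pair_def
  by (simp add: lie_mult[OF assms] algebra_simps sum.distrib sum_distrib_left del: mpow.simps)

lemma lie_pair_mom: "lie_pair n p (mom n q) w = 2 * real q * (mom n (p + q) w - diag_prod n (Suc p) q w / real n)"
proof -
  have "lie_pair n p (\<lambda>w. 1 / real n * tr n q w) w = 1 / real n * lie_pair n p (tr n q) w"
    unfolding lie_pair_mult[OF poly_fun_const poly_corr_tr] by (simp add: lie_pair_const)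
  moreover have "mom n q = (\<lambda>w. 1 / real n * tr n q w)" by (simp add: mom_def fun_eq_iff)
  ultimately show ?thesis unfolding lie_pair_tr by (simp add: mom_def diff_divide_distrib[symmetric])
qed

text \<open>As a derivation in its test function, \<open>lie_pair\<close> can be followed factor by
  factor, and on a single moment it is given by \<open>lie_pair_mom\<close>.\<close>

lemma moment_dominated_lie_pair: "moment_dominated (\<lambda>n w. lie_pair n p (mom_prod Q n) w)"
proof (induction Q)
  case empty
  then show ?case by (simp add: mom_prod_empty lie_pair_const moment_dominated_const)
next
  case (add q Q)
  have "moment_dominated (\<lambda>n w. 2 * real q * (mom n (p + q) w - diag_prod n (Suc p) q w / real n) * mom_prod Q n w
      + mom n q w * lie_pair n p (mom_prod Q n) w)"
    by (intro moment_dominated_add moment_dominated_mult moment_dominated_diff moment_dominated_const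
        moment_dominated_mom moment_dominated_diag_prod moment_dominated_mom_prod add)
  then show ?case
    unfolding mom_prod_add_mset lie_pair_mult[OF poly_corr_mom poly_corr_mom_prod] lie_pair_mom .
qed

lemma moment_dominated_loop_error: "moment_dominated (\<lambda>n w. loop_error n p (mom_prod Q n) w)"
proof -
  have "moment_dominated (\<lambda>n w. lie_pair n p (mom_prod Q n) w / real n)"
  proof (rule moment_dominated_bound[OF moment_dominated_lie_pair])
    fix n :: nat and w assume n: "0 < n"
    have "\<bar>lie_pair n p (mom_prod Q n) w\<bar> / real n \<le> \<bar>lie_pair n p (mom_prod Q n) w\<bar> / 1"
      using n by (intro divide_left_mono) auto
    then show "\<bar>lie_pair n p (mom_prod Q n) w / real n\<bar> \<le> \<bar>lie_pair n p (mom_prod Q n) w\<bar>" by simp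
  qed
  then show ?thesis
    unfolding loop_error_def
    by (intro moment_dominated_add moment_dominated_mult moment_dominated_diff moment_dominated_sum
        moment_dominated_mom moment_dominated_diag_prod moment_dominated_mom_prod)
qed

text \<open>Induction on the total degree: the loop equation expresses products of moments of degree
  \<open>N + 1\<close> through products of degree \<open>N\<close>, and passes to the limit as the Catalan recursion.\<close>

lemma mom_prod_limit:
  assumes pos: "\<And>n. 0 < measure (PiM (upper_indices n) (\<lambda>_. lborel)) (corr_body n)"
  shows "(\<lambda>n. corr_mean n (mom_prod Q n)) \<longlonglongrightarrow> (\<Prod>q\<in>#Q. mp_moment q)"
proof (induction "sum_mset Q" arbitrary: Q)
  case 0
  then have Q: "q = 0" if "q \<in># Q" for q using that by auto
  have "corr_mean n (mom_prod Q n) = 1" if n: "0 < n" for n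
  proof -
    have "mom_prod Q n = (\<lambda>w. 1)"
      unfolding mom_prod_def by (rule ext) (intro prod_mset.neutral, auto dest!: Q simp: mom_0[OF n])
    then show ?thesis
      using corr_mean_one[OF pos[of n]] by simp
  qed
  then have "eventually (\<lambda>n. corr_mean n (mom_prod Q n) = 1) sequentially"
    by (rule eventually_sequentially_posI)
  moreover have "(\<Prod>q\<in>#Q. mp_moment q) = 1"
    by (intro prod_mset.neutral) (auto dest!: Q simp: mp_moment_0)
  ultimately show ?case using tendsto_eventually by simp
next
  case (Suc N)
  \<comment> \<open>One factor of positive order is lowered by the loop equation; the remaining
    factors \<open>R\<close> serve as the test function.\<close>
  have "\<exists>q\<in>#Q. q \<noteq> 0" using Suc.hyps(2) by (metis sum_mset_0_iff nat.distinct(1))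
  then obtain p R where Q: "Q = add_mset (Suc p) R"
    by (metis multi_member_split not0_implies_Suc)
  have N: "N = p + sum_mset R" using Suc.hyps(2) Q by simp
  let ?F = "\<lambda>n. mom_prod R n"
  \<comment> \<open>The Catalan convolution with its term of index 0 split off, to match the shape
    of the loop equation.\<close>
  have c: "(\<Prod>q\<in>#R. mp_moment q) * mp_moment (Suc p) = (\<Prod>q\<in>#add_mset p R. mp_moment q)
     + (\<Sum>q<p. (\<Prod>r\<in>#add_mset (Suc q) (add_mset (p - Suc q) R). mp_moment r)) + 0"
  proof -
    have "mp_moment (Suc p) = mp_moment p + (\<Sum>q<p. mp_moment (Suc q) * mp_moment (p - Suc q))"
      using mp_moment_convolution[of p] unfolding lessThan_Suc_atMost[symmetric] sum.lessThan_Suc_shift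
      by (simp add: mp_moment_0)
    then show ?thesis by (simp add: distrib_left sum_distrib_left mult_ac)
  qed
  \<comment> \<open>Each multiset on the right has sum \<open>p + sum_mset R = N\<close>, since
    \<open>Suc q + (p - Suc q) = p\<close> for \<open>q < p\<close>; so the induction hypothesis
    covers every term but the error.\<close>
  have "(\<lambda>n. corr_mean n (mom_prod (add_mset p R) n) +
      (\<Sum>q<p. corr_mean n (mom_prod (add_mset (Suc q) (add_mset (p - Suc q) R)) n)) + corr_mean n (loop_error n p (?F n)) / real n)
    \<longlonglongrightarrow> (\<Prod>q\<in>#R. mp_moment q) * mp_moment (Suc p)"
    unfolding c
    by (intro tendsto_add tendsto_sum Suc.hyps(1) moment_dominated_mean[OF pos moment_dominated_loop_error]
        poly_corr_loop_error poly_corr_mom_prod) (auto simp: N)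
  moreover have "corr_mean n (mom_prod (add_mset p R) n) +
      (\<Sum>q<p. corr_mean n (mom_prod (add_mset (Suc q) (add_mset (p - Suc q) R)) n)) + corr_mean n (loop_error n p (?F n)) / real n
      = corr_mean n (mom_prod Q n)" if n: "0 < n" for n
    using loop_equation_mean[OF poly_corr_mom_prod n, of R p] unfolding Q mom_prod_add_mset by (simp add: mult_ac)
  then have "eventually (\<lambda>n. corr_mean n (mom_prod (add_mset p R) n) +
      (\<Sum>q<p. corr_mean n (mom_prod (add_mset (Suc q) (add_mset (p - Suc q) R)) n)) + corr_mean n (loop_error n p (?F n)) / real n
      = corr_mean n (mom_prod Q n)) sequentially"
    by (rule eventually_sequentially_posI)
  ultimately have "(\<lambda>n. corr_mean n (mom_prod Q n)) \<longlonglongrightarrow> (\<Prod>q\<in>#R. mp_moment q) * mp_moment (Suc p)"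
    by (rule Lim_transform_eventually)
  then show ?case by (simp add: Q mult.commute)
qed

subsection \<open>Convergence of the spectral distribution\<close>

definition mom_poly :: "nat \<Rightarrow> real poly \<Rightarrow> (nat \<times> nat \<Rightarrow> real) \<Rightarrow> real" where
  "mom_poly n p w = (\<Sum>i\<le>degree p. coeff p i * mom n i w)"

lemma poly_corr_mom_poly: "poly_corr n (mom_poly n p)"
  unfolding mom_poly_def[abs_def] by (intro poly_fun_sum poly_fun_mult poly_fun_const poly_corr_mom)

text \<open>The eigenvalues are nonnegative and add up to the trace \<open>n\<close>, so none
  exceeds \<open>n\<close>. Their confinement to \<open>[0, n]\<close> for fixed \<open>n\<close> is
  used for measurability.\<close>

lemma esd_eigenvalues:
  assumes "C \<in> corr_matrices n"
  obtains es where "\<And>e. e \<in> set es \<Longrightarrow> 0 \<le> e" "\<And>e. e \<in> set es \<Longrightarrow> e \<le> real n"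
    "\<And>x. esd C x = (\<Sum>e\<leftarrow>es. indicator {..x} e) / real n"
    "\<And>p. mom_poly n p (offdiag n C) = (\<Sum>e\<leftarrow>es. poly p e) / real n"
proof -
  let ?w = "offdiag n C"
  obtain es where es: "length es = n" "char_poly (corr_mat n ?w) = (\<Prod>e\<leftarrow>es. [:- e, 1:])"
    "\<And>e. e \<in> set es \<Longrightarrow> 0 \<le> e" "\<And>k. tr n k ?w = (\<Sum>e\<leftarrow>es. e ^ k)"
    using corr_trace_eigenvalues[OF offdiag_corr_body[OF assms]] by metis
  have "tr n 1 ?w = real n" by (simp add: tr_def mpow_one del: mpow.simps)
  then have sum: "sum_list es = real n" using es(4)[of 1] by simp
  have le: "e \<le> real n" if "e \<in> set es" for e
    unfolding sum[symmetric] using that es(3) by (induction es) (auto intro: add_increasing add_increasing2 sum_list_nonneg)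
  have proots: "proots (char_poly C) = mset es"
    using proots_prod_linear[of es] unfolding es(2)[symmetric] corr_mat_offdiag[OF assms] .
  have "dim_row C = n" using assms by (auto simp: corr_matrices_def)
  moreover have "real (size {#a \<in># mset es. a \<le> x#}) = (\<Sum>e\<leftarrow>es. indicator {..x} e)" for x
    by (induction es) auto
  ultimately have esd: "esd C x = (\<Sum>e\<leftarrow>es. indicator {..x} e) / real n" for x
    unfolding esd_def proots by simp
  have "mom_poly n p ?w = (\<Sum>e\<leftarrow>es. poly p e) / real n" for p
  proof -
    have "(\<Sum>e\<leftarrow>es. poly p e) = (\<Sum>i\<le>degree p. coeff p i * (\<Sum>e\<leftarrow>es. e ^ i))"
      by (induction es) (simp_all add: poly_altdef sum.distrib distrib_left)
    then show ?thesis by (simp add: mom_poly_def mom_def es(4) sum_divide_distrib)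
  qed
  then show ?thesis using that es(3) le esd by blast
qed

lemma esd_le_mom_poly:
  assumes "C \<in> corr_matrices n" "\<And>t. 0 \<le> t \<Longrightarrow> indicator {..x} t \<le> poly p t"
  shows "esd C x \<le> mom_poly n p (offdiag n C)"
  using assms(2) by (rule_tac esd_eigenvalues[OF assms(1)]) (auto intro!: divide_right_mono sum_list_mono)

lemma mom_poly_le_esd:
  assumes "C \<in> corr_matrices n" "\<And>t. 0 \<le> t \<Longrightarrow> poly p t \<le> indicator {..x} t"
  shows "mom_poly n p (offdiag n C) \<le> esd C x"
  using assms(2) by (rule_tac esd_eigenvalues[OF assms(1)]) (auto intro!: divide_right_mono sum_list_mono)

text \<open>Ramp width and approximation error shrink together. The ramp lies to the right of
  \<open>x\<close>, so the limit is correct at \<open>t = x\<close> too.\<close>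

lemma indicator_polynomial_limit:
  fixes b x :: real
  obtains p where "\<And>t. 0 \<le> t \<Longrightarrow> t \<le> b \<Longrightarrow> (\<lambda>m. poly (p m) t) \<longlonglongrightarrow> indicator {..x} t"
proof -
  let ?e = "\<lambda>m. 1 / real (Suc m)"
  have "\<exists>p. \<forall>t\<in>{0..b}. \<bar>lin_step x (?e m) t - poly p t\<bar> < ?e m" for m
  proof -
    have "continuous_on {0..b} (lin_step x (?e m))"
      using lin_step(1)[of "?e m" x] continuous_on_subset by fastforce
    then show ?thesis using polynomial_approx_interval[of 0 b "lin_step x (?e m)" "?e m"] by (metis zero_less_divide_1_iff of_nat_0_less_iff zero_less_Suc)
  qed
  then obtain p where p: "\<And>m t. t \<in> {0..b} \<Longrightarrow> \<bar>lin_step x (?e m) t - poly (p m) t\<bar> < ?e m" by metis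
  have e0: "?e \<longlonglongrightarrow> 0" using LIMSEQ_inverse_real_of_nat by (simp add: inverse_eq_divide)
  show ?thesis
  proof (rule that)
    fix t assume t: "0 \<le> t" "t \<le> b"
    have "(\<lambda>m. lin_step x (?e m) t - poly (p m) t) \<longlonglongrightarrow> 0"
      by (rule Lim_null_comparison[OF _ e0]) (use p[of t] t in \<open>auto intro!: always_eventually less_imp_le\<close>)
    moreover have "(\<lambda>m. lin_step x (?e m) t) \<longlonglongrightarrow> indicator {..x} t"
    proof (cases "t \<le> x")
      case True
      then have "lin_step x (?e m) t = 1" for m by (intro lin_step(4)) auto
      then show ?thesis using True by simp
    next
      case False
      then have "eventually (\<lambda>m. ?e m < t - x) sequentially" using order_tendstoD(2)[OF e0] by simp
      then have "eventually (\<lambda>m. lin_step x (?e m) t = 0) sequentially"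
        by eventually_elim (intro lin_step(5), auto)
      then show ?thesis using False by (simp add: tendsto_eventually)
    qed
    ultimately have "(\<lambda>m. lin_step x (?e m) t - (lin_step x (?e m) t - poly (p m) t)) \<longlonglongrightarrow> indicator {..x} t - 0"
      by (intro tendsto_diff)
    then show "(\<lambda>m. poly (p m) t) \<longlonglongrightarrow> indicator {..x} t" by simp
  qed
qed

section \<open>A uniformly distributed random correlation matrix\<close>

context
  fixes M :: "'a measure" and n :: nat and C :: "'a \<Rightarrow> real mat"
  assumes M: "prob_space M" and C: "uniform_corr M n C"
begin

lemma uniform_corr_matrices: "w \<in> space M \<Longrightarrow> C w \<in> corr_matrices n"
  using C by (auto simp: uniform_corr_def)

lemma offdiag_measurable: "(\<lambda>w. offdiag n (C w)) \<in> measurable M (PiM (upper_indices n) (\<lambda>_. lborel))"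
  using C by (simp add: uniform_corr_def offdiag_lebesgue_def)

lemma offdiag_distr: "distr M (PiM (upper_indices n) (\<lambda>_. lborel)) (\<lambda>w. offdiag n (C w)) =
    uniform_measure (PiM (upper_indices n) (\<lambda>_. lborel)) (corr_body n)"
  using C by (simp add: uniform_corr_def offdiag_lebesgue_def offdiag_image_corr_matrices)

text \<open>Positive volume is inherited from the existence of \<open>C\<close>: its law is a
  probability measure, whereas normalizing a null set would give total mass 0.\<close>

lemma measure_corr_body_pos: "0 < measure (PiM (upper_indices n) (\<lambda>_. lborel)) (corr_body n)"
proof -
  let ?P = "PiM (upper_indices n) (\<lambda>_. lborel :: real measure)"
  interpret D: prob_space "uniform_measure ?P (corr_body n)"
    using prob_space.prob_space_distr[OF M offdiag_measurable] unfolding offdiag_distr .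
  have "emeasure ?P (corr_body n) \<noteq> 0"
  proof
    assume 0: "emeasure ?P (corr_body n) = 0"
    have "emeasure (uniform_measure ?P (corr_body n)) (space ?P) = emeasure ?P (corr_body n \<inter> space ?P) / emeasure ?P (corr_body n)"
      using sets_corr_body[of n] by (intro emeasure_uniform_measure) auto
    \<comment> \<open>In the extended nonnegative reals \<open>0 / 0 = 0\<close>.\<close>
    also have "\<dots> = 0" using 0 sets_corr_body[of n] by simp
    finally show False using D.emeasure_space_1 by simp
  qed
  then show ?thesis
    using corr.measure_finite[of n] by (simp add: measure_def enn2real_positive_iff zero_less_iff_neq_zero)
qed

lemma uniform_corr_integral:
  assumes f: "poly_corr n f"
  shows "(\<integral>w. f (offdiag n (C w)) \<partial>M) = corr_mean n f"
proof -
  let ?P = "PiM (upper_indices n) (\<lambda>_. lborel :: real measure)" and ?K = "corr_body n"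
  have fm [measurable]: "f \<in> borel_measurable ?P" using poly_fun_measurable[OF f] .
  note [measurable] = sets_corr_body[of n]
  have m: "emeasure ?P ?K = ennreal (measure ?P ?K)"
    using corr.measure_finite[of n] by (intro emeasure_eq_ennreal_measure) auto
  have "(\<integral>w. f (offdiag n (C w)) \<partial>M) = integral\<^sup>L (uniform_measure ?P ?K) f"
    unfolding offdiag_distr[symmetric] by (rule integral_distr[OF offdiag_measurable fm, symmetric])
  also have "uniform_measure ?P ?K = density ?P (\<lambda>w. ennreal (indicator ?K w / measure ?P ?K))"
    unfolding uniform_measure_def m using measure_corr_body_pos
    by (intro arg_cong[where f = "density ?P"] ext) (auto simp: indicator_def divide_ennreal[symmetric])
  also have "integral\<^sup>L \<dots> f = (\<integral>w. (indicator ?K w / measure ?P ?K) *\<^sub>R f w \<partial>?P)"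
    by (intro integral_density) auto
  also have "\<dots> = corr_mean n f" unfolding corr_mean_def corr_integral_def by simp
  finally show ?thesis .
qed

lemma uniform_corr_measurable:
  assumes f: "poly_corr n f"
  shows "(\<lambda>w. f (offdiag n (C w))) \<in> borel_measurable M"
  using measurable_compose[OF offdiag_measurable poly_fun_measurable[OF f]] .

lemma uniform_corr_integrable:
  assumes f: "poly_corr n f"
  shows "integrable M (\<lambda>w. f (offdiag n (C w)))"
proof -
  interpret prob_space M by (rule M)
  obtain B where B: "\<And>w. (\<And>i. i \<in> upper_indices n \<Longrightarrow> \<bar>w i\<bar> \<le> 1) \<Longrightarrow> \<bar>f w\<bar> \<le> B"
    using poly_fun_bounded[OF f] by metis
  have "\<bar>f (offdiag n (C w))\<bar> \<le> B" if "w \<in> space M" for w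
    using corr_body_box[OF offdiag_corr_body[OF uniform_corr_matrices[OF that]]] by (intro B)
  then show ?thesis using uniform_corr_measurable[OF f]
    by (intro integrable_const_bound[of _ B]) auto
qed

text \<open>Eigenvalues need not be selected measurably: the count is a pointwise limit of the
  statistics \<open>mom_poly\<close>, which are polynomials in the entries.\<close>

lemma esd_measurable: "(\<lambda>w. esd (C w) x) \<in> borel_measurable M"
proof -
  obtain p where p: "\<And>t. 0 \<le> t \<Longrightarrow> t \<le> real n \<Longrightarrow> (\<lambda>m. poly (p m) t) \<longlonglongrightarrow> indicator {..x} t"
    using indicator_polynomial_limit by metis
  show ?thesis
  proof (rule borel_measurable_LIMSEQ_real)
    show "(\<lambda>w. mom_poly n (p m) (offdiag n (C w))) \<in> borel_measurable M" for m
      by (rule uniform_corr_measurable[OF poly_corr_mom_poly])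
    fix w assume "w \<in> space M"
    then obtain es where es: "\<And>e. e \<in> set es \<Longrightarrow> 0 \<le> e" "\<And>e. e \<in> set es \<Longrightarrow> e \<le> real n"
      "\<And>x. esd (C w) x = (\<Sum>e\<leftarrow>es. indicator {..x} e) / real n"
      "\<And>p. mom_poly n p (offdiag n (C w)) = (\<Sum>e\<leftarrow>es. poly p e) / real n"
      using esd_eigenvalues[OF uniform_corr_matrices] by metis
    have "(\<lambda>m. \<Sum>e\<leftarrow>es. poly (p m) e) \<longlonglongrightarrow> (\<Sum>e\<leftarrow>es. indicator {..x} e)"
      using es(1,2) by (induction es) (auto intro!: tendsto_add p)
    then show "(\<lambda>m. mom_poly n (p m) (offdiag n (C w))) \<longlonglongrightarrow> esd (C w) x"
      unfolding es(3,4) divide_inverse by (intro tendsto_mult tendsto_const)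
  qed
qed

lemma mom_poly_deviation:
  assumes "d > 0"
  shows "measure M {w \<in> space M. d \<le> \<bar>mom_poly n p (offdiag n (C w)) - c\<bar>} \<le> corr_mean n (\<lambda>w. (mom_poly n p w - c)\<^sup>2) / d\<^sup>2"
proof -
  interpret prob_space M by (rule M)
  have f: "poly_corr n (\<lambda>w. mom_poly n p w - c)" and f2: "poly_corr n (\<lambda>w. (mom_poly n p w - c)\<^sup>2)"
    unfolding power2_eq_square by (intro poly_fun_diff poly_fun_mult poly_corr_mom_poly poly_fun_const)+
  show ?thesis
    using second_moment_method[OF uniform_corr_measurable[OF f] uniform_corr_integrable[OF f2] assms]
    unfolding uniform_corr_integral[OF f2] .
qed

end

text \<open>The expanded square involves products of at most two moments, whose limits factor; with
  \<open>c\<close> the limit of the mean, the three parts tend to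
  \<open>c\<^sup>2 - 2 * c\<^sup>2 + c\<^sup>2 = 0\<close>.\<close>

lemma mom_poly_variance_limit:
  assumes pos: "\<And>n. 0 < measure (PiM (upper_indices n) (\<lambda>_. lborel)) (corr_body n)"
  shows "(\<lambda>n. corr_mean n (\<lambda>w. (mom_poly n p w - mp_poly p)\<^sup>2)) \<longlonglongrightarrow> 0"
proof -
  let ?I = "{..degree p}" and ?a = "coeff p" and ?c = "mp_poly p"
  have e: "corr_mean n (\<lambda>w. (mom_poly n p w - ?c)\<^sup>2) =
      (\<Sum>i\<in>?I. \<Sum>j\<in>?I. ?a i * ?a j * corr_mean n (mom_prod {#i, j#} n)) +
      ((\<Sum>i\<in>?I. - 2 * ?c * ?a i * corr_mean n (mom_prod {#i#} n)) + ?c\<^sup>2)" for n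
  proof -
    let ?f = "\<lambda>w. \<Sum>i\<in>?I. \<Sum>j\<in>?I. ?a i * ?a j * mom_prod {#i, j#} n w"
    let ?g = "\<lambda>w. \<Sum>i\<in>?I. - 2 * ?c * ?a i * mom_prod {#i#} n w"
    have "(mom_poly n p w - ?c)\<^sup>2 = ?f w + (?g w + ?c\<^sup>2 * 1)" for w
    proof -
      have "mom_poly n p w * mom_poly n p w = ?f w"
        unfolding mom_poly_def sum_product by (intro sum.cong refl) (simp add: mom_prod_def)
      moreover have "- 2 * ?c * mom_poly n p w = ?g w"
        unfolding mom_poly_def sum_distrib_left by (intro sum.cong refl) (simp add: mom_prod_def)
      ultimately show ?thesis by (simp add: power2_eq_square algebra_simps)
    qed
    then have "corr_mean n (\<lambda>w. (mom_poly n p w - ?c)\<^sup>2) = corr_mean n (\<lambda>w. ?f w + (?g w + ?c\<^sup>2 * 1))" by simp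
    also have "\<dots> = corr_mean n ?f + corr_mean n (\<lambda>w. ?g w + ?c\<^sup>2 * 1)"
      by (intro corr_mean_add poly_fun_add poly_fun_sum poly_fun_mult poly_fun_const poly_corr_mom_prod)
    also have "corr_mean n (\<lambda>w. ?g w + ?c\<^sup>2 * 1) = corr_mean n ?g + corr_mean n (\<lambda>w. ?c\<^sup>2 * 1)"
      by (intro corr_mean_add poly_fun_add poly_fun_sum poly_fun_mult poly_fun_const poly_corr_mom_prod)
    also have "corr_mean n (\<lambda>w. ?c\<^sup>2 * 1) = ?c\<^sup>2" unfolding corr_mean_cmult corr_mean_one[OF pos] by simp
    also have "corr_mean n ?g = (\<Sum>i\<in>?I. corr_mean n (\<lambda>w. - 2 * ?c * ?a i * mom_prod {#i#} n w))"
      by (intro corr_mean_sum poly_fun_mult poly_fun_const poly_corr_mom_prod)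
    also have "corr_mean n ?f = (\<Sum>i\<in>?I. corr_mean n (\<lambda>w. \<Sum>j\<in>?I. ?a i * ?a j * mom_prod {#i, j#} n w))"
      by (intro corr_mean_sum poly_fun_sum poly_fun_mult poly_fun_const poly_corr_mom_prod)
    also have "\<dots> = (\<Sum>i\<in>?I. \<Sum>j\<in>?I. corr_mean n (\<lambda>w. ?a i * ?a j * mom_prod {#i, j#} n w))"
      by (intro sum.cong refl corr_mean_sum poly_fun_mult poly_fun_const poly_corr_mom_prod)
    finally show ?thesis unfolding corr_mean_cmult .
  qed
  have "(\<lambda>n. corr_mean n (\<lambda>w. (mom_poly n p w - ?c)\<^sup>2)) \<longlonglongrightarrow>
      (\<Sum>i\<in>?I. \<Sum>j\<in>?I. ?a i * ?a j * (\<Prod>q\<in>#{#i, j#}. mp_moment q)) +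
      ((\<Sum>i\<in>?I. - 2 * ?c * ?a i * (\<Prod>q\<in>#{#i#}. mp_moment q)) + ?c\<^sup>2)"
    unfolding e by (intro tendsto_intros mom_prod_limit[OF pos])
  moreover have "(\<Sum>i\<in>?I. \<Sum>j\<in>?I. ?a i * ?a j * (\<Prod>q\<in>#{#i, j#}. mp_moment q)) = ?c * ?c"
    unfolding mp_poly_def sum_product by (intro sum.cong refl) simp
  moreover have "(\<Sum>i\<in>?I. - 2 * ?c * ?a i * (\<Prod>q\<in>#{#i#}. mp_moment q)) = - 2 * ?c * ?c"
    unfolding mp_poly_def[of p] by (subst (3) sum_distrib_left) (intro sum.cong refl, simp)
  ultimately show ?thesis by (simp add: power2_eq_square)
qed

theorem theorem2:
  fixes M :: "nat \<Rightarrow> 'a measure" and C :: "nat \<Rightarrow> 'a \<Rightarrow> real mat"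
  assumes "\<And>n. prob_space (M n)"
    and "\<And>n. uniform_corr (M n) n (C n)"
  shows "weak_conv_in_prob M (\<lambda>n w. esd (C n w)) (cdf mp_law)"
  unfolding weak_conv_in_prob_def tendsto_in_prob_def
proof (intro allI impI conjI)
  fix x n
  show "(\<lambda>w. esd (C n w) x) \<in> borel_measurable (M n)" by (rule esd_measurable[OF assms])
next
  fix x e :: real
  assume x: "isCont (cdf mp_law) x" and e: "0 < e"
  let ?G = "cdf mp_law x" and ?d = "e / 2"
  note pos = measure_corr_body_pos[OF assms]
  obtain p where p: "\<And>t. 0 \<le> t \<Longrightarrow> indicator {..x} t \<le> poly p t" "mp_poly p \<le> ?G + ?d"
    using cdf_polynomial_majorant[OF x, of ?d] e by auto
  obtain q where q: "\<And>t. 0 \<le> t \<Longrightarrow> poly q t \<le> indicator {..x} t" "?G - ?d \<le> mp_poly q"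
    using cdf_polynomial_minorant[OF x, of ?d] e by auto
  let ?v = "\<lambda>r n. corr_mean n (\<lambda>w. (mom_poly n r w - mp_poly r)\<^sup>2) / ?d\<^sup>2"
  let ?A = "\<lambda>r n. {w \<in> space (M n). ?d \<le> \<bar>mom_poly n r (offdiag n (C n w)) - mp_poly r\<bar>}"
  have bound: "measure (M n) {w \<in> space (M n). e < \<bar>esd (C n w) x - ?G\<bar>} \<le> ?v p n + ?v q n" for n
  proof -
    interpret prob_space "M n" by (rule assms)
    have A: "?A r n \<in> sets (M n)" for r
      using uniform_corr_measurable[OF assms poly_corr_mom_poly, of n r] by measurable
    have "{w \<in> space (M n). e < \<bar>esd (C n w) x - ?G\<bar>} \<subseteq> ?A p n \<union> ?A q n"
    proof
      fix w assume w: "w \<in> {w \<in> space (M n). e < \<bar>esd (C n w) x - ?G\<bar>}"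
      then have c: "C n w \<in> corr_matrices n" using uniform_corr_matrices[OF assms] by auto
      have "e < \<bar>esd (C n w) x - ?G\<bar>" using w by simp
      \<comment> \<open>If \<open>esd\<close> exceeds \<open>?G + e\<close>, then so does the
        majorant statistic, whose limit is at most \<open>?G + e / 2\<close>; if \<open>esd\<close>
        is below \<open>?G - e\<close>, the minorant deviates likewise.\<close>
      then have "?d \<le> \<bar>mom_poly n p (offdiag n (C n w)) - mp_poly p\<bar> \<or>
          ?d \<le> \<bar>mom_poly n q (offdiag n (C n w)) - mp_poly q\<bar>"
        using p(2) q(2) esd_le_mom_poly[OF c p(1)] mom_poly_le_esd[OF c q(1)] by linarith
      then show "w \<in> ?A p n \<union> ?A q n" using w by auto
    qed
    then have "measure (M n) {w \<in> space (M n). e < \<bar>esd (C n w) x - ?G\<bar>} \<le> measure (M n) (?A p n \<union> ?A q n)"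
      using A by (intro finite_measure_mono sets.Un)
    also have "\<dots> \<le> measure (M n) (?A p n) + measure (M n) (?A q n)" using A by (intro measure_Un_le)
    also have "\<dots> \<le> ?v p n + ?v q n"
      using e by (intro add_mono mom_poly_deviation[OF assms]) auto
    finally show ?thesis .
  qed
  have "(\<lambda>n. ?v p n + ?v q n) \<longlonglongrightarrow> 0 / ?d\<^sup>2 + 0 / ?d\<^sup>2"
    using e by (intro tendsto_intros mom_poly_variance_limit[OF pos]) auto
  then have "(\<lambda>n. ?v p n + ?v q n) \<longlonglongrightarrow> 0" by simp
  then show "(\<lambda>n. measure (M n) {w \<in> space (M n). e < \<bar>esd (C n w) x - ?G\<bar>}) \<longlonglongrightarrow> 0"
    by (rule tendsto_sandwich[OF _ _ tendsto_const, rotated 2]) (auto intro!: always_eventually bound)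
qed

end
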